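(* For each $n$ let $M=M_n$ be a random $n\times n$ matrix whose entries are independent, each equal to $1$ with probability $p=p(n)$ and $0$ otherwise, where $0\le p=\frac{1}{2n}(\log n+\log\log n+c_n)\le \frac12$ for a real sequence $(c_n)$. (a) If $c_n\to\infty$ as $n\to\infty$, then with high probability $M$ is reconstructible from the collection of its rows and columns. (b) If $c_n\to-\infty$ as $n\to\infty$, and assuming that $M$ has at least two $1$'s, then with high probability $M$ is not reconstructible from the collection of its rows and columns; that is, with high probability, either $M$ has fewer than two entries equal to $1$ or $M$ is not reconstructible. (c) If $c_n\to c\in\mathbb{R}$ as $n\to\infty$, then the probability that $M$ is reconstructible from the collection of its rows and columns tends to an explicit constant, depending only on $c$, that is strictly between $0$ and $1$.
   Context: For an $n\times n$ binary matrix $M$, let $\mathcal{R}$ and $\mathcal{C}$ be the multisets of the $n$ binary strings of length $n$ that are the rows, respectively the columns, of $M$. The matrix $M$ is reconstructible (or weakly reconstructible) from the collection of its rows and columns if it is uniquely determined by $\mathcal{R}$ and $\mathcal{C}$, i.e. every $n\times n$ binary matrix $M'$ with the same multiset of rows and the same multiset of columns as $M$ equals $M$. An event $E=E_n$ happens with high probability if $\mathbb{P}(E_n)\to1$ as $n\to\infty$. Logarithms are natural. *)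

theory Defs
  imports "HOL-Probability.Probability" "Jordan_Normal_Form.Matrix"
begin

(* A binary matrix is a matrix over bool, with True as the entry 1 and False as the entry 0.
   HOL-Analysis also has constants named rows and row, hence the qualified names. *)

definition reconstructible :: "bool mat \<Rightarrow> bool" where
  "reconstructible A \<longleftrightarrow>
     (\<forall>B \<in> carrier_mat (dim_row A) (dim_col A).
        mset (Matrix.rows B) = mset (Matrix.rows A) \<and> mset (Matrix.cols B) = mset (Matrix.cols A)
        \<longrightarrow> B = A)"

definition num_ones :: "bool mat \<Rightarrow> nat" where
  "num_ones A = card {(i, j). i < dim_row A \<and> j < dim_col A \<and> A $$ (i, j)}"

(* Intended for p between 0 and 1; bernoulli_pmf truncates p to this interval. *)
definition random_mat :: "nat \<Rightarrow> real \<Rightarrow> bool mat pmf" where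
  "random_mat n p =
     map_pmf (Matrix.mat n n) (Pi_pmf ({..<n} \<times> {..<n}) False (\<lambda>_. bernoulli_pmf p))"

(* The probability that a Poisson variable with mean exp (-c) / 2 is at most 1. The variable is the
   limit of the number of entries 1 that are the only 1 in their row and in their column: two such
   entries in rows i, i' and columns j, j' can be replaced by ones at (i, j') and (i', j). *)
definition critical_prob :: "real \<Rightarrow> real" where
  "critical_prob c = (1 + exp (- c) / 2) * exp (- (exp (- c) / 2))"

end

theory Submission
  imports Defs "HOL-Combinatorics.Permutations" "HOL-Real_Asymp.Real_Asymp"
begin

text \<open>
  Rows and columns are the two sides of a bipartite graph whose edges are the ones of the matrix. A
  matrix with the same rows and the same columns corresponds to an automorphism of this graph that
  preserves the sides, and the matrix is reconstructible iff every such automorphism maps each row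
  to an equal row (\<open>reconstructible_iff_automorphism\<close>). Two isolated edges can be exchanged, so they are an obstruction
  (\<open>two_isolated_ones_not_reconstructible\<close>). The expected number of isolated edges is about
  \<open>n\<^sup>2 p exp (- 2 n p)\<close>, which is close to \<open>exp (- c) / 2\<close> when \<open>c\<close> is bounded. The theorem holds
  because with high probability there is no other obstruction as long as \<open>c\<close> is bounded below
  (\<open>prob_not_reconstructible_few_isolated_tendsto_0\<close>).

  To see this, take an automorphism that moves some row to a different row and moves as few vertices as possible. Then each
  moved vertex has a moved neighbour (\<open>not_reconstructible_minimal_automorphism\<close>). For \<open>p\<close> of order
  \<open>ln n / n\<close>, no three vertices of bounded degree lie in a tree on at most five vertices, with high
  probability (\<open>prob_low_cluster\<close>). If in addition there is at most one isolated edge, a positive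
  fraction of the moved vertices has large degree, and so the number of ones in moved rows and
  columns is at least a large multiple of the number of moved vertices (\<open>moved_ones_lower_bound\<close>). A pattern with
  so many ones is invariant under a given pair of permutations only with a tiny probability, because a
  third of these ones can be chosen so that their images are distinct from them and must be ones as well
  (\<open>prob_automorphism_many_ones\<close>). This probability is small enough for a union bound over all pairs of
  permutations (\<open>prob_exists_permutation_pair\<close>). For larger \<open>p\<close> the union bound over all pairs works
  without information on degrees (\<open>prob_not_reconstructible_dense\<close>).

  It remains to study the number of isolated ones. Its binomial moments have closed forms
  (\<open>binomial_moment_eq\<close>). If \<open>c\<close> tends to infinity, the mean tends to zero. If \<open>c\<close> converges, all binomial
  moments converge to those of a Poisson variable, and the Bonferroni inequalities give the probability
  of at most one isolated one (\<open>prob_at_most_one_isolated_tendsto\<close>). If \<open>c\<close> tends to minus infinity, then either \<open>p\<close> is so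
  small that no two ones share a row or column, which makes all ones isolated, or the mean tends to
  infinity and Chebyshev's inequality gives two isolated ones
  (\<open>prob_two_ones_and_reconstructible_tendsto_0\<close>).
\<close>

section \<open>Reconstruction and automorphisms\<close>

abbreviation cells :: "nat \<Rightarrow> (nat \<times> nat) set" where
  "cells n \<equiv> {..<n} \<times> {..<n}"

definition ones :: "nat \<Rightarrow> (nat \<times> nat \<Rightarrow> bool) \<Rightarrow> (nat \<times> nat) set" where
  "ones n f = {x \<in> cells n. f x}"

text \<open>
  The side-preserving automorphisms of the bipartite graph that joins row \<open>i\<close> to column \<open>j\<close> whenever
  the entry at \<open>(i, j)\<close> is 1.
\<close>

definition automorphism :: "nat \<Rightarrow> (nat \<times> nat \<Rightarrow> bool) \<Rightarrow> (nat \<Rightarrow> nat) \<Rightarrow> (nat \<Rightarrow> nat) \<Rightarrow> bool" where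
  "automorphism n f \<sigma> \<tau> \<longleftrightarrow> \<sigma> permutes {..<n} \<and> \<tau> permutes {..<n} \<and>
     (\<forall>i<n. \<forall>j<n. f (\<sigma> i, \<tau> j) = f (i, j))"

text \<open>
  A second matrix \<open>B\<close> with the same rows and columns is obtained from \<open>A\<close> both by a row permutation
  \<open>\<sigma>\<close> and by a column permutation \<open>\<rho>\<close>; then \<open>\<sigma>\<close> and the inverse of \<open>\<rho>\<close> together preserve \<open>A\<close>.
  So uniqueness says that every automorphism only exchanges equal rows.
\<close>

lemma reconstructible_iff_automorphism:
  "reconstructible (Matrix.mat n n f) \<longleftrightarrow>
     (\<forall>\<sigma> \<tau>. automorphism n f \<sigma> \<tau> \<longrightarrow> (\<forall>i<n. \<forall>j<n. f (\<sigma> i, j) = f (i, j)))" (is "?L \<longleftrightarrow> ?R")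
proof
  let ?A = "Matrix.mat n n f"
  assume L: ?L
  show ?R
  proof (intro allI impI)
    fix \<sigma> \<tau> i j assume aut: "automorphism n f \<sigma> \<tau>" and ij: "i < n" "j < n"
    have \<sigma>: "\<sigma> permutes {..<n}" and \<tau>: "\<tau> permutes {..<n}"
      and f: "\<And>i j. i < n \<Longrightarrow> j < n \<Longrightarrow> f (\<sigma> i, \<tau> j) = f (i, j)"
      using aut by (auto simp: automorphism_def)
    have \<sigma>_lt: "\<sigma> i < n \<longleftrightarrow> i < n" for i using permutes_in_image[OF \<sigma>] by auto
    have \<tau>': "inv_into UNIV \<tau> permutes {..<n}" using \<tau> by (rule permutes_inv)
    have \<tau>'_lt: "inv_into UNIV \<tau> i < n \<longleftrightarrow> i < n" for i using permutes_in_image[OF \<tau>'] by auto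
    define B where "B = Matrix.mat n n (\<lambda>(i, j). f (\<sigma> i, j))"
    have "Matrix.rows B = permute_list \<sigma> (Matrix.rows ?A)"
      by (rule nth_equalityI)
        (auto simp: B_def permute_list_def \<sigma>_lt intro!: eq_vecI)
    then have "mset (Matrix.rows B) = mset (Matrix.rows ?A)" using \<sigma> by simp
    moreover have "f (\<sigma> i, j) = f (i, inv_into UNIV \<tau> j)" if "i < n" "j < n" for i j
      using f[of i "inv_into UNIV \<tau> j"] that \<tau>'_lt \<tau> by (simp add: permutes_inverses)
    then have "Matrix.cols B = permute_list (inv_into UNIV \<tau>) (Matrix.cols ?A)"
      by (intro nth_equalityI)
        (auto simp: B_def permute_list_def \<tau>'_lt intro!: eq_vecI)
    then have "mset (Matrix.cols B) = mset (Matrix.cols ?A)" using \<tau>' by simp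
    moreover have "B \<in> carrier_mat (dim_row ?A) (dim_col ?A)" by (simp add: B_def)
    ultimately have "B = ?A" using L unfolding reconstructible_def by blast
    then have "B $$ (i, j) = ?A $$ (i, j)" by simp
    then show "f (\<sigma> i, j) = f (i, j)" using ij by (simp add: B_def)
  qed
next
  let ?A = "Matrix.mat n n f"
  assume R: ?R
  show ?L
    unfolding reconstructible_def
  proof (intro ballI impI, elim conjE)
    fix B :: "bool mat"
    assume B: "B \<in> carrier_mat (dim_row ?A) (dim_col ?A)"
      and r: "mset (Matrix.rows B) = mset (Matrix.rows ?A)" and c: "mset (Matrix.cols B) = mset (Matrix.cols ?A)"
    have dB [simp]: "dim_row B = n" "dim_col B = n" using B by auto
    obtain \<sigma> where \<sigma>: "\<sigma> permutes {..<n}" "permute_list \<sigma> (Matrix.rows ?A) = Matrix.rows B"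
      using mset_eq_permutation[OF r] by auto
    obtain \<rho> where \<rho>: "\<rho> permutes {..<n}" "permute_list \<rho> (Matrix.cols ?A) = Matrix.cols B"
      using mset_eq_permutation[OF c] by auto
    have \<sigma>_lt: "\<sigma> i < n \<longleftrightarrow> i < n" for i using permutes_in_image[OF \<sigma>(1)] by auto
    have \<rho>_lt: "\<rho> i < n \<longleftrightarrow> i < n" for i using permutes_in_image[OF \<rho>(1)] by auto
    have \<rho>': "inv_into UNIV \<rho> permutes {..<n}" using \<rho>(1) by (rule permutes_inv)
    have \<rho>'_lt: "inv_into UNIV \<rho> i < n \<longleftrightarrow> i < n" for i using permutes_in_image[OF \<rho>'] by auto
    have Br: "B $$ (i, j) = f (\<sigma> i, j)" if "i < n" "j < n" for i j
    proof -
      have "B $$ (i, j) = (Matrix.rows B ! i) $ j" using that by simp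
      also have "\<dots> = f (\<sigma> i, j)" using that by (simp add: \<sigma>(2)[symmetric] permute_list_def \<sigma>_lt)
      finally show ?thesis .
    qed
    have Bc: "B $$ (i, j) = f (i, \<rho> j)" if "i < n" "j < n" for i j
    proof -
      have "B $$ (i, j) = (Matrix.cols B ! j) $ i" using that by simp
      also have "\<dots> = f (i, \<rho> j)" using that by (simp add: \<rho>(2)[symmetric] permute_list_def \<rho>_lt)
      finally show ?thesis .
    qed
    have "f (\<sigma> i, inv_into UNIV \<rho> j) = f (i, j)" if "i < n" "j < n" for i j
      using Br[of i "inv_into UNIV \<rho> j"] Bc[of i "inv_into UNIV \<rho> j"] that \<rho>(1) by (simp add: \<rho>'_lt permutes_inverses)
    then have "automorphism n f \<sigma> (inv_into UNIV \<rho>)" using \<sigma>(1) \<rho>' by (simp add: automorphism_def)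
    then show "B = ?A" using R Br by (intro eq_matI) auto
  qed
qed

text \<open>
  These ones are the isolated edges of the bipartite graph.
\<close>

definition isolated_ones :: "nat \<Rightarrow> (nat \<times> nat \<Rightarrow> bool) \<Rightarrow> (nat \<times> nat) set" where
  "isolated_ones n f = {(i, j). (i, j) \<in> ones n f \<and>
     (\<forall>y\<in>ones n f. fst y = i \<or> snd y = j \<longrightarrow> y = (i, j))}"

lemma isolated_ones_subset: "isolated_ones n f \<subseteq> cells n"
  by (auto simp: isolated_ones_def ones_def)

lemma finite_isolated_ones [simp]: "finite (isolated_ones n f)"
  by (rule finite_subset[OF isolated_ones_subset]) simp

text \<open>
  Exchanging two isolated edges is an automorphism that moves a row to a different one.
\<close>

lemma two_isolated_ones_not_reconstructible:
  assumes "2 \<le> card (isolated_ones n f)"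
  shows "\<not> reconstructible (Matrix.mat n n f)"
proof -
  obtain x y where xy: "x \<in> isolated_ones n f" "y \<in> isolated_ones n f" "x \<noteq> y"
    using assms by (metis card_le_Suc0_iff_eq finite_isolated_ones not_less_eq_eq numeral_2_eq_2)
  obtain i j i' j' where ij: "x = (i, j)" "y = (i', j')" by (metis surj_pair)
  have lt: "i < n" "j < n" "i' < n" "j' < n" and f1: "f (i, j)" "f (i', j')"
    using xy by (auto simp: ij isolated_ones_def ones_def)
  have mem: "a = i \<and> b = j" if "f (a, b)" "a < n" "b < n" "a = i \<or> b = j" for a b
  proof -
    have "\<forall>y\<in>ones n f. fst y = i \<or> snd y = j \<longrightarrow> y = (i, j)"
      using xy(1) unfolding ij isolated_ones_def by blast
    from bspec[OF this, of "(a, b)"] show ?thesis using that by (simp add: ones_def)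
  qed
  have mem': "a = i' \<and> b = j'" if "f (a, b)" "a < n" "b < n" "a = i' \<or> b = j'" for a b
  proof -
    have "\<forall>y\<in>ones n f. fst y = i' \<or> snd y = j' \<longrightarrow> y = (i', j')"
      using xy(2) unfolding ij isolated_ones_def by blast
    from bspec[OF this, of "(a, b)"] show ?thesis using that by (simp add: ones_def)
  qed
  have iso: "f (i, l) \<longleftrightarrow> l = j" "f (l, j) \<longleftrightarrow> l = i"
      "f (i', l) \<longleftrightarrow> l = j'" "f (l, j') \<longleftrightarrow> l = i'" if "l < n" for l
    using mem[of i l] mem[of l j] mem'[of i' l] mem'[of l j'] lt f1 that by blast+
  have ne: "i \<noteq> i'" "j \<noteq> j'" using xy(3) mem[OF f1(2)] lt unfolding ij by auto
  let ?\<sigma> = "Transposition.transpose i i'" and ?\<tau> = "Transposition.transpose j j'"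
  have "automorphism n f ?\<sigma> ?\<tau>"
    unfolding automorphism_def using lt ne iso
    by (auto intro!: permutes_swap_id simp: Transposition.transpose_def)
  moreover have "f (?\<sigma> i, j) \<noteq> f (i, j)" using iso lt ne f1 by simp
  ultimately show ?thesis using lt unfolding reconstructible_iff_automorphism by blast
qed

text \<open>
  Rows are the left and columns the right summands, so that degrees, neighbours and the set of moved
  vertices can be treated without distinguishing the two sides.
\<close>

definition verts :: "nat \<Rightarrow> (nat + nat) set" where
  "verts n = {..<n} <+> {..<n}"

definition ends :: "nat \<times> nat \<Rightarrow> (nat + nat) set" where
  "ends x = {Inl (fst x), Inr (snd x)}"

definition moved :: "(nat \<Rightarrow> nat) \<Rightarrow> (nat \<Rightarrow> nat) \<Rightarrow> (nat + nat) set" where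
  "moved \<sigma> \<tau> = {v. map_sum \<sigma> \<tau> v \<noteq> v}"

lemma moved_eq: "moved \<sigma> \<tau> = {i. \<sigma> i \<noteq> i} <+> {j. \<tau> j \<noteq> j}"
proof -
  have "v \<in> moved \<sigma> \<tau> \<longleftrightarrow> v \<in> {i. \<sigma> i \<noteq> i} <+> {j. \<tau> j \<noteq> j}" for v
    by (cases v) (auto simp: moved_def)
  then show ?thesis by blast
qed

lemma ends_inj: "ends x = ends y \<Longrightarrow> x = y"
  by (cases x; cases y) (auto simp: ends_def doubleton_eq_iff)

lemma ends_image: "map_sum \<sigma> \<tau> ` ends x = ends (map_prod \<sigma> \<tau> x)"
  by (cases x) (auto simp: ends_def)

lemma finite_verts [simp]: "finite (verts n)"
  by (simp add: verts_def)

lemma card_verts: "card (verts n) = 2 * n"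
  by (simp add: verts_def card_Plus)

lemma moved_subset: "\<sigma> permutes {..<n} \<Longrightarrow> \<tau> permutes {..<n} \<Longrightarrow> moved \<sigma> \<tau> \<subseteq> verts n"
  unfolding moved_eq verts_def by (auto simp: permutes_def)

lemma card_moved:
  assumes "\<sigma> permutes {..<n}" "\<tau> permutes {..<n}"
  shows "card (moved \<sigma> \<tau>) = card {i. \<sigma> i \<noteq> i} + card {j. \<tau> j \<noteq> j}"
proof -
  have "finite {i. \<sigma> i \<noteq> i}" "finite {j. \<tau> j \<noteq> j}"
    using assms by (auto simp: permutes_def intro: finite_subset[of _ "{..<n}"])
  then show ?thesis unfolding moved_eq by (simp add: card_Plus)
qed

text \<open>
  Correcting \<open>\<sigma>\<close> by the transposition of \<open>i\<close> with its image fixes \<open>i\<close> and moves no new point. This is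
  the descent step for minimal automorphisms.
\<close>

lemma moved_transpose_comp:
  assumes "\<sigma> permutes {..<n}" "\<sigma> i \<noteq> i"
  shows "{k. (Transposition.transpose i (\<sigma> i) \<circ> \<sigma>) k \<noteq> k} \<subset> {k. \<sigma> k \<noteq> k}"
proof -
  have "\<sigma> (\<sigma> i) \<noteq> \<sigma> i" using assms by (metis permutes_inj injD)
  then have "{k. (Transposition.transpose i (\<sigma> i) \<circ> \<sigma>) k \<noteq> k} \<subseteq> {k. \<sigma> k \<noteq> k}"
    using assms(2) by (auto simp: Transposition.transpose_def split: if_splits)
  moreover have "i \<notin> {k. (Transposition.transpose i (\<sigma> i) \<circ> \<sigma>) k \<noteq> k}" by simp
  moreover have "i \<in> {k. \<sigma> k \<noteq> k}" using assms(2) by simp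
  ultimately show ?thesis by blast
qed

lemma transpose_comp_permutes:
  assumes "\<sigma> permutes {..<n}" "i < n"
  shows "Transposition.transpose i (\<sigma> i) \<circ> \<sigma> permutes {..<n}"
  using assms permutes_in_image[OF assms(1), of i]
  by (intro permutes_compose permutes_swap_id) auto

text \<open>
  An automorphism that moves some row to a different row and moves as few vertices as possible has no
  moved vertex without a moved neighbour. Indeed such a vertex would have the same neighbours as its
  image, and composing with the transposition of the two would give an automorphism with fewer moved
  vertices that still sends some row to a different one.
\<close>

lemma not_reconstructible_minimal_automorphism:
  assumes "\<not> reconstructible (Matrix.mat n n f)"
  obtains \<sigma> \<tau> where "automorphism n f \<sigma> \<tau>" "moved \<sigma> \<tau> \<noteq> {}"
    "\<And>v. v \<in> moved \<sigma> \<tau> \<Longrightarrow> \<exists>x\<in>ones n f. v \<in> ends x \<and> ends x \<subseteq> moved \<sigma> \<tau>"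
proof -
  define P where "P = (\<lambda>(\<sigma>, \<tau>). automorphism n f \<sigma> \<tau> \<and> (\<exists>i<n. \<exists>j<n. f (\<sigma> i, j) \<noteq> f (i, j)))"
  have "\<exists>z. P z" using assms by (auto simp: P_def reconstructible_iff_automorphism)
  then obtain z where z: "P z"
      and min: "\<And>y. P y \<Longrightarrow> card (case_prod moved z) \<le> card (case_prod moved y)"
    using exists_least_iff[of "\<lambda>m. \<exists>z. P z \<and> card (case_prod moved z) = m"]
    by (metis not_le)
  obtain \<sigma> \<tau> where z_def: "z = (\<sigma>, \<tau>)" by (cases z)
  have aut: "automorphism n f \<sigma> \<tau>" and nt: "\<exists>i<n. \<exists>j<n. f (\<sigma> i, j) \<noteq> f (i, j)"
    using z by (auto simp: P_def z_def)
  have \<sigma>: "\<sigma> permutes {..<n}" and \<tau>: "\<tau> permutes {..<n}"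
    and f: "\<And>i j. i < n \<Longrightarrow> j < n \<Longrightarrow> f (\<sigma> i, \<tau> j) = f (i, j)"
    using aut by (auto simp: automorphism_def)
  have lt: "\<sigma> i < n \<longleftrightarrow> i < n" "\<tau> i < n \<longleftrightarrow> i < n" for i
    using permutes_in_image[OF \<sigma>] permutes_in_image[OF \<tau>] by auto
  have min': "card (moved \<sigma> \<tau>) \<le> card (moved \<sigma>' \<tau>')" if "P (\<sigma>', \<tau>')" for \<sigma>' \<tau>'
    using min[OF that] by (simp add: z_def)
  have fin: "finite {i. \<sigma> i \<noteq> i}" "finite {j. \<tau> j \<noteq> j}"
    using \<sigma> \<tau> by (auto simp: permutes_def intro: finite_subset[of _ "{..<n}"])
  have row: "\<exists>j. \<tau> j \<noteq> j \<and> j < n \<and> f (i, j)" if i: "\<sigma> i \<noteq> i" for i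
  proof (rule ccontr)
    assume no: "\<not> ?thesis"
    have i_lt: "i < n" using \<sigma> i by (auto simp: permutes_def)
    \<comment> \<open>If every neighbour of \<open>i\<close> is fixed, then \<open>i\<close> and its image are equal rows.\<close>
    have twin: "f (\<sigma> i, j) = f (i, j)" if j: "j < n" for j
    proof (cases "f (i, j)")
      case True
      then have "\<tau> j = j" using no j by blast
      then show ?thesis using f[OF i_lt j] by simp
    next
      case False
      have "\<tau> (inv_into UNIV \<tau> j) = j" "inv_into UNIV \<tau> j < n"
        using \<tau> j permutes_in_image[OF permutes_inv[OF \<tau>]] by (auto simp: permutes_inverses)
      then have "f (\<sigma> i, j) = f (i, inv_into UNIV \<tau> j)" using f[OF i_lt, of "inv_into UNIV \<tau> j"] by simp
      moreover have "\<not> f (i, inv_into UNIV \<tau> j)"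
      proof
        assume *: "f (i, inv_into UNIV \<tau> j)"
        then have "\<tau> (inv_into UNIV \<tau> j) = inv_into UNIV \<tau> j" using no \<open>inv_into UNIV \<tau> j < n\<close> by blast
        then show False using * False \<open>\<tau> (inv_into UNIV \<tau> j) = j\<close> by simp
      qed
      ultimately show ?thesis using False by simp
    qed
    let ?\<sigma> = "Transposition.transpose i (\<sigma> i) \<circ> \<sigma>"
    have same: "f (?\<sigma> k, j) = f (\<sigma> k, j)" if "j < n" for k j
      using twin[OF that] by (auto simp: Transposition.transpose_def)
    have "automorphism n f ?\<sigma> \<tau>"
      using transpose_comp_permutes[OF \<sigma> i_lt] \<tau> same f lt by (auto simp: automorphism_def)
    then have "P (?\<sigma>, \<tau>)" using nt same by (auto simp: P_def)
    from min'[OF this] have "card {k. \<sigma> k \<noteq> k} \<le> card {k. ?\<sigma> k \<noteq> k}"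
      using card_moved[OF \<sigma> \<tau>] card_moved[OF transpose_comp_permutes[OF \<sigma> i_lt] \<tau>] by simp
    moreover have "card {k. ?\<sigma> k \<noteq> k} < card {k. \<sigma> k \<noteq> k}"
      by (rule psubset_card_mono[OF fin(1) moved_transpose_comp[OF \<sigma> i]])
    ultimately show False by simp
  qed
  have col: "\<exists>i. \<sigma> i \<noteq> i \<and> i < n \<and> f (i, j)" if j: "\<tau> j \<noteq> j" for j
  proof (rule ccontr)
    assume no: "\<not> ?thesis"
    have j_lt: "j < n" using \<tau> j by (auto simp: permutes_def)
    have twin: "f (i, \<tau> j) = f (i, j)" if i: "i < n" for i
    proof (cases "f (i, j)")
      case True
      then have "\<sigma> i = i" using no i by blast
      then show ?thesis using f[OF i j_lt] by simp
    next
      case False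
      have "\<sigma> (inv_into UNIV \<sigma> i) = i" "inv_into UNIV \<sigma> i < n"
        using \<sigma> i permutes_in_image[OF permutes_inv[OF \<sigma>]] by (auto simp: permutes_inverses)
      then have "f (i, \<tau> j) = f (inv_into UNIV \<sigma> i, j)" using f[OF _ j_lt, of "inv_into UNIV \<sigma> i"] by simp
      moreover have "\<not> f (inv_into UNIV \<sigma> i, j)"
      proof
        assume *: "f (inv_into UNIV \<sigma> i, j)"
        then have "\<sigma> (inv_into UNIV \<sigma> i) = inv_into UNIV \<sigma> i" using no \<open>inv_into UNIV \<sigma> i < n\<close> by blast
        then show False using * False \<open>\<sigma> (inv_into UNIV \<sigma> i) = i\<close> by simp
      qed
      ultimately show ?thesis using False by simp
    qed
    let ?\<tau> = "Transposition.transpose j (\<tau> j) \<circ> \<tau>"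
    have same: "f (i, ?\<tau> k) = f (i, \<tau> k)" if "i < n" for k i
      using twin[OF that] by (auto simp: Transposition.transpose_def)
    have "automorphism n f \<sigma> ?\<tau>"
      using transpose_comp_permutes[OF \<tau> j_lt] \<sigma> same f lt by (auto simp: automorphism_def)
    then have "P (\<sigma>, ?\<tau>)" using nt by (auto simp: P_def)
    from min'[OF this] have "card {k. \<tau> k \<noteq> k} \<le> card {k. ?\<tau> k \<noteq> k}"
      using card_moved[OF \<sigma> \<tau>] card_moved[OF \<sigma> transpose_comp_permutes[OF \<tau> j_lt]] by simp
    moreover have "card {k. ?\<tau> k \<noteq> k} < card {k. \<tau> k \<noteq> k}"
      by (rule psubset_card_mono[OF fin(2) moved_transpose_comp[OF \<tau> j]])
    ultimately show False by simp
  qed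
  show ?thesis
  proof (rule that[OF aut])
    obtain i j where "i < n" "j < n" "f (\<sigma> i, j) \<noteq> f (i, j)" using nt by blast
    then have "Inl i \<in> moved \<sigma> \<tau>" by (auto simp: moved_eq)
    then show "moved \<sigma> \<tau> \<noteq> {}" by blast
  next
    fix v assume v: "v \<in> moved \<sigma> \<tau>"
    show "\<exists>x\<in>ones n f. v \<in> ends x \<and> ends x \<subseteq> moved \<sigma> \<tau>"
    proof (cases v)
      case (Inl i)
      then have i: "\<sigma> i \<noteq> i" using v by (auto simp: moved_eq)
      obtain j where "\<tau> j \<noteq> j" "j < n" "f (i, j)" using row[OF i] by blast
      moreover have "i < n" using \<sigma> i by (auto simp: permutes_def)
      ultimately show ?thesis using i Inl by (intro bexI[of _ "(i, j)"]) (auto simp: ends_def ones_def moved_eq)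
    next
      case (Inr j)
      then have j: "\<tau> j \<noteq> j" using v by (auto simp: moved_eq)
      obtain i where "\<sigma> i \<noteq> i" "i < n" "f (i, j)" using col[OF j] by blast
      moreover have "j < n" using \<tau> j by (auto simp: permutes_def)
      ultimately show ?thesis using j Inr by (intro bexI[of _ "(i, j)"]) (auto simp: ends_def ones_def moved_eq)
    qed
  qed
qed

section \<open>Moved vertices of small degree\<close>

definition deg :: "nat \<Rightarrow> (nat \<times> nat \<Rightarrow> bool) \<Rightarrow> nat + nat \<Rightarrow> nat" where
  "deg n f v = card {x \<in> ones n f. v \<in> ends x}"

text \<open>
  Vertices of degree at most \<open>D\<close> are called low and all others high in the comments below.
  A low cluster consists of a set \<open>W\<close> of at most five vertices with at least as many edges as a tree
  on \<open>W\<close>, of which \<open>U\<close> selects exactly \<open>card W - 1\<close>, and of three low vertices \<open>L\<close> among them.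
  For \<open>p\<close> of order \<open>ln n / n\<close> there are about \<open>n\<close> times a power of \<open>ln n\<close> trees of this size, and each low
  vertex costs a factor of
  about the square root of \<open>n\<close>, so that three of them make a cluster unlikely while two would not.
\<close>

definition low_cluster ::
  "nat \<Rightarrow> nat \<Rightarrow> (nat \<times> nat \<Rightarrow> bool) \<Rightarrow> (nat + nat) set \<Rightarrow> (nat \<times> nat) set \<Rightarrow> (nat + nat) set \<Rightarrow> bool" where
  "low_cluster n D f W U L \<longleftrightarrow>
     W \<subseteq> verts n \<and> card W = Suc (card U) \<and> card W \<le> 5 \<and>
     U \<subseteq> ones n f \<and> (\<forall>x\<in>U. ends x \<subseteq> W) \<and> L \<subseteq> W \<and> card L = 3 \<and> (\<forall>v\<in>L. deg n f v \<le> D)"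

definition nbrs :: "nat \<Rightarrow> (nat \<times> nat \<Rightarrow> bool) \<Rightarrow> nat + nat \<Rightarrow> (nat + nat) set" where
  "nbrs n f v = {u. \<exists>x\<in>ones n f. ends x = {v, u}}"

lemma finite_ones [simp]: "finite (ones n f)"
  by (rule finite_subset[of _ "cells n"]) (auto simp: ones_def)

lemma ends_subset_verts: "x \<in> ones n f \<Longrightarrow> ends x \<subseteq> verts n"
  by (auto simp: ones_def ends_def verts_def)

lemma ends_pairD: "ends x = {u, v} \<Longrightarrow> isl u \<noteq> isl v"
  by (auto simp: ends_def doubleton_eq_iff)

lemma ends_obtain_other:
  assumes "v \<in> ends x"
  obtains u where "ends x = {v, u}"
  using assms by (auto simp: ends_def)

lemma nbrs_sym: "u \<in> nbrs n f v \<longleftrightarrow> v \<in> nbrs n f u"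
  by (simp add: nbrs_def insert_commute)

lemma nbrs_subset_verts: "nbrs n f v \<subseteq> verts n"
  using ends_subset_verts by (fastforce simp: nbrs_def)

lemma finite_nbrs [simp]: "finite (nbrs n f v)"
  by (rule finite_subset[OF nbrs_subset_verts]) simp

lemma isolated_ones_iff:
  "x \<in> isolated_ones n f \<longleftrightarrow> x \<in> ones n f \<and> (\<forall>y\<in>ones n f. ends y \<inter> ends x \<noteq> {} \<longrightarrow> y = x)"
proof -
  have "ends y \<inter> ends x \<noteq> {} \<longleftrightarrow> fst y = fst x \<or> snd y = snd x" for y
    by (auto simp: ends_def)
  then show ?thesis by (simp add: isolated_ones_def case_prod_beta)
qed

text \<open>
  A vertex with three low neighbours forms a star with them, which is a low cluster.
\<close>

lemma low_nbrs_le_2: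
  assumes nc: "\<And>W U L. \<not> low_cluster n D f W U L"
  shows "card {u \<in> nbrs n f v. deg n f u \<le> D} \<le> 2"
proof (rule ccontr)
  assume "\<not> ?thesis"
  then have "3 \<le> card {u \<in> nbrs n f v. deg n f u \<le> D}" by simp
  then obtain L where L: "L \<subseteq> {u \<in> nbrs n f v. deg n f u \<le> D}" "card L = 3"
    by (rule obtain_subset_with_card_n)
  have v: "v \<notin> L" using L(1) by (auto simp: nbrs_def dest!: ends_pairD)
  have finL: "finite L" using L(2) card.infinite by fastforce
  have "\<exists>x\<in>ones n f. ends x = {v, u}" if "u \<in> L" for u using L(1) that by (auto simp: nbrs_def)
  then obtain e where e: "\<And>u. u \<in> L \<Longrightarrow> e u \<in> ones n f \<and> ends (e u) = {v, u}" by metis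
  have "inj_on e L"
    by (rule inj_onI) (metis e doubleton_eq_iff)
  then have card: "card (e ` L) = 3" using L(2) by (simp add: card_image)
  have "{v, u} \<subseteq> verts n" if "u \<in> L" for u using ends_subset_verts[of "e u" n f] e[OF that] by simp
  moreover have "L \<noteq> {}" using L(2) by auto
  ultimately have vv: "v \<in> verts n" "L \<subseteq> verts n" by auto
  have "low_cluster n D f (insert v L) (e ` L) L"
    unfolding low_cluster_def using L vv e v card finL by (auto simp: card_insert_disjoint)
  then show False using nc by blast
qed

text \<open>
  Two edges at a common vertex with only low ends form a path on three low vertices.
\<close>

lemma no_low_path:
  assumes nc: "\<And>W U L. \<not> low_cluster n D f W U L"
    and x: "x \<in> ones n f" "ends x = {v, u}" and y: "y \<in> ones n f" "ends y = {v, w}"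
    and low: "deg n f v \<le> D" "deg n f u \<le> D" "deg n f w \<le> D"
  shows "u = w"
proof (rule ccontr)
  assume uw: "u \<noteq> w"
  have ne: "v \<noteq> u" "v \<noteq> w" using ends_pairD[OF x(2)] ends_pairD[OF y(2)] by auto
  have xy: "x \<noteq> y" using x y uw by (metis doubleton_eq_iff)
  have "low_cluster n D f {v, u, w} {x, y} {v, u, w}"
    unfolding low_cluster_def using x y low ne uw xy ends_subset_verts[OF x(1)] ends_subset_verts[OF y(1)]
    by auto
  then show False using nc by blast
qed

lemma automorphism_ones:
  assumes "automorphism n f \<sigma> \<tau>"
  shows "map_prod \<sigma> \<tau> ` ones n f = ones n f"
proof
  have \<sigma>: "\<sigma> permutes {..<n}" and \<tau>: "\<tau> permutes {..<n}"
    and f: "\<And>i j. i < n \<Longrightarrow> j < n \<Longrightarrow> f (\<sigma> i, \<tau> j) = f (i, j)"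
    using assms by (auto simp: automorphism_def)
  have lt: "\<sigma> i < n \<longleftrightarrow> i < n" "\<tau> i < n \<longleftrightarrow> i < n" for i
    using permutes_in_image[OF \<sigma>] permutes_in_image[OF \<tau>] by auto
  show "map_prod \<sigma> \<tau> ` ones n f \<subseteq> ones n f" using f lt by (auto simp: ones_def)
  show "ones n f \<subseteq> map_prod \<sigma> \<tau> ` ones n f"
  proof
    fix x assume x: "x \<in> ones n f"
    obtain i j where ij: "x = (\<sigma> i, \<tau> j)"
      by (metis surj_pair permutes_surj[OF \<sigma>] permutes_surj[OF \<tau>] surjD)
    then have "(i, j) \<in> ones n f" using x f lt by (auto simp: ones_def)
    then show "x \<in> map_prod \<sigma> \<tau> ` ones n f" using ij by force
  qed
qed

lemma deg_automorphism:
  assumes aut: "automorphism n f \<sigma> \<tau>"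
  shows "deg n f (map_sum \<sigma> \<tau> v) = deg n f v"
proof -
  have inj: "inj \<sigma>" "inj \<tau>" using aut by (auto simp: automorphism_def permutes_inj)
  have inj_s: "map_sum \<sigma> \<tau> a = map_sum \<sigma> \<tau> b \<longleftrightarrow> a = b" for a b
    using inj by (cases a; cases b) (auto dest: injD)
  have "{x \<in> ones n f. map_sum \<sigma> \<tau> v \<in> ends x} = map_prod \<sigma> \<tau> ` {x \<in> ones n f. v \<in> ends x}"
  proof -
    have "{x \<in> ones n f. map_sum \<sigma> \<tau> v \<in> ends x} = {x \<in> map_prod \<sigma> \<tau> ` ones n f. map_sum \<sigma> \<tau> v \<in> ends x}"
      by (simp add: automorphism_ones[OF aut])
    also have "\<dots> = map_prod \<sigma> \<tau> ` {x \<in> ones n f. map_sum \<sigma> \<tau> v \<in> ends (map_prod \<sigma> \<tau> x)}"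
      by (rule Compr_image_eq)
    also have "{x \<in> ones n f. map_sum \<sigma> \<tau> v \<in> ends (map_prod \<sigma> \<tau> x)} = {x \<in> ones n f. v \<in> ends x}"
      by (auto simp: ends_image[symmetric] inj_s)
    finally show ?thesis .
  qed
  moreover have "inj_on (map_prod \<sigma> \<tau>) {x \<in> ones n f. v \<in> ends x}"
    by (rule inj_on_subset[OF prod.inj_map[OF inj] subset_UNIV])
  ultimately show ?thesis by (simp add: deg_def card_image)
qed

text \<open>
  Every edge has only two ends.
\<close>

lemma sum_deg_le:
  assumes "finite S"
  shows "(\<Sum>v\<in>S. deg n f v) \<le> 2 * card {x \<in> ones n f. ends x \<inter> S \<noteq> {}}"
proof -
  have "(\<Sum>v\<in>S. deg n f v) = (\<Sum>v\<in>S. \<Sum>x\<in>ones n f. if v \<in> ends x then 1 else 0)"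
    by (simp add: deg_def sum.If_cases Int_def)
  also have "\<dots> = (\<Sum>x\<in>ones n f. \<Sum>v\<in>S. if v \<in> ends x then 1 else 0)"
    by (rule sum.swap)
  also have "\<dots> = (\<Sum>x\<in>ones n f. card (S \<inter> ends x))"
    using assms by (simp add: sum.If_cases)
  also have "\<dots> = (\<Sum>x\<in>{x \<in> ones n f. ends x \<inter> S \<noteq> {}}. card (S \<inter> ends x))"
    by (rule sum.mono_neutral_right) (auto simp: Int_commute)
  also have "\<dots> \<le> (\<Sum>x\<in>{x \<in> ones n f. ends x \<inter> S \<noteq> {}}. 2)"
  proof (rule sum_mono)
    fix x
    have "card (S \<inter> ends x) \<le> card (ends x)" by (rule card_mono) (auto simp: ends_def)
    also have "\<dots> \<le> 2" by (simp add: ends_def)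
    finally show "card (S \<inter> ends x) \<le> 2" .
  qed
  also have "\<dots> = 2 * card {x \<in> ones n f. ends x \<inter> S \<noteq> {}}" by simp
  finally show ?thesis .
qed

text \<open>
  If a moved low vertex \<open>v\<close> has no high vertex this close, then by the absence of low paths \<open>v\<close> and
  its only moved neighbour \<open>u\<close> form a component \<open>{v, u}\<close> of the graph on the moved vertices, and the
  automorphism carries it to another such component. If \<open>{v, u}\<close> is even a component of the whole graph,
  there are two isolated ones. Otherwise some fixed vertex \<open>w\<close> is adjacent to \<open>{v, u}\<close>, hence also to
  the image, and these five vertices form a low cluster.
\<close>

lemma moved_low_near_high:
  assumes aut: "automorphism n f \<sigma> \<tau>"
    and cover: "\<And>v. v \<in> moved \<sigma> \<tau> \<Longrightarrow> \<exists>x\<in>ones n f. v \<in> ends x \<and> ends x \<subseteq> moved \<sigma> \<tau>"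
    and nc: "\<And>W U L. \<not> low_cluster n D f W U L"
    and iso: "card (isolated_ones n f) \<le> 1"
    and v: "v \<in> moved \<sigma> \<tau>" "deg n f v \<le> D"
  shows "\<exists>h\<in>moved \<sigma> \<tau>. D < deg n f h \<and>
           (h \<in> nbrs n f v \<or> (\<exists>u\<in>nbrs n f v. deg n f u \<le> D \<and> h \<in> nbrs n f u))"
proof (rule ccontr)
  assume no: "\<not> ?thesis"
  let ?S = "moved \<sigma> \<tau>" and ?\<pi> = "map_sum \<sigma> \<tau>" and ?\<phi> = "map_prod \<sigma> \<tau>"
  have inj: "inj \<sigma>" "inj \<tau>" using aut by (auto simp: automorphism_def permutes_inj)
  have \<pi>_inj: "?\<pi> a = ?\<pi> b \<longleftrightarrow> a = b" for a b
    using inj by (cases a; cases b) (auto dest: injD)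
  have \<pi>_isl: "isl (?\<pi> a) = isl a" for a by (cases a) auto
  have \<pi>_S: "?\<pi> a \<in> ?S \<longleftrightarrow> a \<in> ?S" for a by (simp add: moved_def \<pi>_inj)
  have \<phi>_ones: "?\<phi> x \<in> ones n f" if "x \<in> ones n f" for x
    using automorphism_ones[OF aut] that by blast
  have sub: "?S \<subseteq> verts n" using aut unfolding automorphism_def by (intro moved_subset) auto
  obtain x where x: "x \<in> ones n f" "v \<in> ends x" "ends x \<subseteq> ?S" using cover[OF v(1)] by blast
  obtain u where xu: "ends x = {v, u}" using x(2) by (rule ends_obtain_other)
  have u: "u \<in> ?S" using x xu by auto
  have isl: "isl v \<noteq> isl u" using ends_pairD[OF xu] .
  have u_low: "deg n f u \<le> D"
    using no u x(1) xu by (auto simp: nbrs_def not_less[symmetric])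
  \<comment> \<open>The edge \<open>x\<close> is a component of the graph on the moved vertices.\<close>
  have only: "y = x" if y: "y \<in> ones n f" "z \<in> ends y" "z \<in> {v, u}" "ends y \<subseteq> ?S" for y z
  proof -
    obtain w where yw: "ends y = {z, w}" using y(2) by (rule ends_obtain_other)
    have w: "w \<in> ?S" using y(4) yw by auto
    consider "z = v" | "z = u" using y(3) by auto
    then show ?thesis
    proof cases
      case 1
      then have "w \<in> nbrs n f v" using y(1) yw by (auto simp: nbrs_def)
      then have "deg n f w \<le> D" using no w by (meson not_less)
      then have "u = w" using no_low_path[OF nc x(1) xu y(1)] yw 1 v(2) u_low by simp
      then show ?thesis using 1 yw xu ends_inj by metis
    next
      case 2
      then have "w \<in> nbrs n f u" "u \<in> nbrs n f v" using x(1) xu y(1) yw by (auto simp: nbrs_def)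
      then have "deg n f w \<le> D" using no w u_low by (meson not_less)
      then have "v = w"
        using no_low_path[OF nc x(1) _ y(1), of u v w] yw 2 xu v(2) u_low by (simp add: insert_commute)
      then show ?thesis using 2 yw xu ends_inj by (metis insert_commute)
    qed
  qed
  have x': "?\<phi> x \<in> ones n f" "ends (?\<phi> x) = {?\<pi> v, ?\<pi> u}"
    using \<phi>_ones[OF x(1)] by (simp_all add: ends_image[symmetric] xu)
  have ne: "?\<pi> v \<noteq> v" "?\<pi> u \<noteq> u" using v(1) u by (auto simp: moved_def)
  have ne': "v \<noteq> u" "?\<pi> v \<noteq> u" "?\<pi> u \<noteq> v" "?\<pi> v \<noteq> ?\<pi> u" using isl \<pi>_isl by metis+
  have xx': "x \<noteq> ?\<phi> x" using x'(2) xu ne ne' by (auto simp: doubleton_eq_iff)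
  show False
  proof (cases "\<exists>y\<in>ones n f. y \<noteq> x \<and> ends y \<inter> ends x \<noteq> {}")
    case True
    then obtain y z where y: "y \<in> ones n f" "y \<noteq> x" "z \<in> ends y" "z \<in> {v, u}" using xu by auto
    obtain w where yw: "ends y = {z, w}" using y(3) by (rule ends_obtain_other)
    have z: "z \<in> ?S" using y(4) u v(1) by auto
    \<comment> \<open>So \<open>w\<close> is fixed, and the automorphism maps its edge to \<open>z\<close> to an edge to the image of \<open>z\<close>.\<close>
    have "w \<notin> ?S" using only[OF y(1,3,4)] y(2) z yw by auto
    then have \<pi>w: "?\<pi> w = w" and ww: "w \<noteq> v" "w \<noteq> u" "w \<noteq> ?\<pi> v" "w \<noteq> ?\<pi> u"
      using v(1) u \<pi>_S by (auto simp: moved_def)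
    have y': "?\<phi> y \<in> ones n f" "ends (?\<phi> y) = {?\<pi> z, w}"
      using \<phi>_ones[OF y(1)] \<pi>w by (simp_all add: ends_image[symmetric] yw)
    have z': "?\<pi> z \<in> {?\<pi> v, ?\<pi> u}" using y(4) by auto
    have zz: "z \<noteq> ?\<pi> z" using z by (auto simp: moved_def)
    have dist: "?\<phi> x \<noteq> y" "?\<phi> x \<noteq> ?\<phi> y" "x \<noteq> ?\<phi> y" "y \<noteq> ?\<phi> y"
    proof -
      have "w \<notin> ends x" "w \<notin> ends (?\<phi> x)" "w \<in> ends y" "w \<in> ends (?\<phi> y)"
        using ww xu x' yw y' by auto
      then show "?\<phi> x \<noteq> y" "?\<phi> x \<noteq> ?\<phi> y" "x \<noteq> ?\<phi> y" by metis+
      have "{z, w} \<noteq> {?\<pi> z, w}" using zz by (metis doubleton_eq_iff)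
      then show "y \<noteq> ?\<phi> y" using yw y'(2) by metis
    qed
    let ?W = "{w, v, u, ?\<pi> v, ?\<pi> u}"
    have "low_cluster n D f ?W {x, ?\<phi> x, y, ?\<phi> y} {v, u, ?\<pi> v}"
      unfolding low_cluster_def
    proof (intro conjI)
      show "?W \<subseteq> verts n" using sub v(1) u \<pi>_S ends_subset_verts[OF y(1)] yw by auto
      have c1: "card ?W = 5" using ww ne ne' by auto
      have c2: "card {x, ?\<phi> x, y, ?\<phi> y} = 4" using xx' dist y(2) by auto
      show "card ?W = Suc (card {x, ?\<phi> x, y, ?\<phi> y})" "card ?W \<le> 5" using c1 c2 by simp_all
      show "{x, ?\<phi> x, y, ?\<phi> y} \<subseteq> ones n f" using x(1) x'(1) y(1) y'(1) by simp
      show "\<forall>x\<in>{x, ?\<phi> x, y, ?\<phi> y}. ends x \<subseteq> ?W" using xu x'(2) yw y'(2) y(4) z' by auto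
      show "{v, u, ?\<pi> v} \<subseteq> ?W" by auto
      show "card {v, u, ?\<pi> v} = 3" using ne ne' by auto
      show "\<forall>v\<in>{v, u, ?\<pi> v}. deg n f v \<le> D" using v(2) u_low deg_automorphism[OF aut] by simp
    qed
    then show False using nc by blast
  next
    case False
    then have x_iso: "x \<in> isolated_ones n f" using x(1) by (auto simp: isolated_ones_iff)
    have "y = ?\<phi> x" if y: "y \<in> ones n f" "ends y \<inter> ends (?\<phi> x) \<noteq> {}" for y
    proof -
      have "y \<in> ?\<phi> ` ones n f" by (subst automorphism_ones[OF aut]) (rule y(1))
      then obtain y0 where y0: "y = ?\<phi> y0" "y0 \<in> ones n f" by (rule imageE)
      have "ends y0 \<inter> ends x \<noteq> {}"
        using y(2) by (auto simp: y0(1) ends_image[symmetric] \<pi>_inj)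
      then have "y0 = x" using False y0(2) by blast
      then show ?thesis using y0(1) by simp
    qed
    then have "?\<phi> x \<in> isolated_ones n f" using x'(1) by (simp add: isolated_ones_iff)
    then have "card {x, ?\<phi> x} \<le> card (isolated_ones n f)" using x_iso by (intro card_mono) auto
    then show False using xx' iso by simp
  qed
qed

text \<open>
  Each high vertex has at most two low neighbours and at most four low vertices behind those, so at
  least one seventh of the moved vertices are high. Their degrees force many ones in moved rows and
  columns.
\<close>

lemma moved_ones_lower_bound:
  assumes aut: "automorphism n f \<sigma> \<tau>"
    and cover: "\<And>v. v \<in> moved \<sigma> \<tau> \<Longrightarrow> \<exists>x\<in>ones n f. v \<in> ends x \<and> ends x \<subseteq> moved \<sigma> \<tau>"
    and nc: "\<And>W U L. \<not> low_cluster n D f W U L"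
    and iso: "card (isolated_ones n f) \<le> 1"
  shows "Suc D * card (moved \<sigma> \<tau>) \<le> 14 * card {x \<in> ones n f. ends x \<inter> moved \<sigma> \<tau> \<noteq> {}}"
proof -
  let ?S = "moved \<sigma> \<tau>" and ?N = "nbrs n f"
  define High where "High = {v \<in> ?S. D < deg n f v}"
  define Low where "Low = {v \<in> ?S. deg n f v \<le> D}"
  define Nl where "Nl v = {u \<in> ?N v. deg n f u \<le> D}" for v
  have "?S \<subseteq> verts n" using aut unfolding automorphism_def by (intro moved_subset) auto
  then have fin: "finite ?S" by (rule finite_subset) simp
  have finH: "finite High" "finite Low" using fin by (auto simp: High_def Low_def)
  have Nl: "card (Nl v) \<le> 2" "finite (Nl v)" for v
    unfolding Nl_def using low_nbrs_le_2[OF nc] by simp_all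
  have six: "card (Nl h \<union> (\<Union>u\<in>Nl h. Nl u)) \<le> 6" for h
  proof -
    have "card (\<Union>u\<in>Nl h. Nl u) \<le> (\<Sum>u\<in>Nl h. card (Nl u))" by (rule card_UN_le) (rule Nl)
    also have "\<dots> \<le> (\<Sum>u\<in>Nl h. 2)" by (rule sum_mono) (rule Nl)
    also have "\<dots> \<le> 4" using Nl(1)[of h] by simp
    finally show ?thesis using card_Un_le[of "Nl h" "\<Union>u\<in>Nl h. Nl u"] Nl(1)[of h] by linarith
  qed
  have "Low \<subseteq> (\<Union>h\<in>High. Nl h \<union> (\<Union>u\<in>Nl h. Nl u))"
  proof
    fix v assume v: "v \<in> Low"
    obtain h where h: "h \<in> ?S" "D < deg n f h"
       "h \<in> ?N v \<or> (\<exists>u\<in>?N v. deg n f u \<le> D \<and> h \<in> ?N u)"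
      using moved_low_near_high[OF aut cover nc iso, of v] v by (auto simp: Low_def)
    then have "v \<in> Nl h \<or> (\<exists>u\<in>Nl h. v \<in> Nl u)"
      using v nbrs_sym unfolding Nl_def Low_def by blast
    then show "v \<in> (\<Union>h\<in>High. Nl h \<union> (\<Union>u\<in>Nl h. Nl u))" using h by (auto simp: High_def)
  qed
  then have "card Low \<le> card (\<Union>h\<in>High. Nl h \<union> (\<Union>u\<in>Nl h. Nl u))"
    by (rule card_mono[rotated]) (use finH Nl in auto)
  also have "\<dots> \<le> (\<Sum>h\<in>High. card (Nl h \<union> (\<Union>u\<in>Nl h. Nl u)))" by (rule card_UN_le) (rule finH)
  also have "\<dots> \<le> (\<Sum>h\<in>High. 6)" by (rule sum_mono) (rule six)
  finally have "card Low \<le> 6 * card High" by simp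
  moreover have "?S = High \<union> Low" "High \<inter> Low = {}" by (auto simp: High_def Low_def)
  ultimately have S: "card ?S \<le> 7 * card High" using finH by (simp add: card_Un_disjoint)
  have "Suc D * card High = (\<Sum>v\<in>High. Suc D)" by simp
  also have "\<dots> \<le> (\<Sum>v\<in>High. deg n f v)" by (rule sum_mono) (auto simp: High_def)
  also have "\<dots> \<le> (\<Sum>v\<in>?S. deg n f v)" by (rule sum_mono2[OF fin]) (auto simp: High_def)
  also have "\<dots> \<le> 2 * card {x \<in> ones n f. ends x \<inter> ?S \<noteq> {}}" by (rule sum_deg_le[OF fin])
  finally have "Suc D * card High \<le> 2 * card {x \<in> ones n f. ends x \<inter> ?S \<noteq> {}}" .
  moreover have "Suc D * card ?S \<le> Suc D * (7 * card High)" using S by (rule mult_le_mono2)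
  ultimately show ?thesis by (simp add: algebra_simps)
qed

section \<open>Probabilities of patterns of cells\<close>

abbreviation cell_pmf :: "nat \<Rightarrow> real \<Rightarrow> (nat \<times> nat \<Rightarrow> bool) pmf" where
  "cell_pmf n p \<equiv> Pi_pmf (cells n) False (\<lambda>_. bernoulli_pmf p)"

lemma prob_random_mat:
  "measure_pmf.prob (random_mat n p) {A. P A} = measure_pmf.prob (cell_pmf n p) {f. P (Matrix.mat n n f)}"
  by (simp add: random_mat_def vimage_def)

text \<open>
  These are the only probabilities that are computed exactly. Everything else follows from them by union
  bounds and from the moments of the number of isolated ones.
\<close>

lemma prob_cylinder:
  assumes "U \<subseteq> cells n" "Z \<subseteq> cells n" "U \<inter> Z = {}" "0 \<le> p" "p \<le> 1"
  shows "measure_pmf.prob (cell_pmf n p) {f. (\<forall>x\<in>U. f x) \<and> (\<forall>x\<in>Z. \<not> f x)} = p ^ card U * (1 - p) ^ card Z"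
proof -
  let ?B = "\<lambda>x. if x \<in> U then {True} else if x \<in> Z then {False} else UNIV"
  have "{f. (\<forall>x\<in>U. f x) \<and> (\<forall>x\<in>Z. \<not> f x)} = Pi (cells n) ?B"
  proof (intro equalityI subsetI)
    fix f assume f: "f \<in> Pi (cells n) ?B"
    have "f x" if "x \<in> U" for x using Pi_mem[OF f subsetD[OF assms(1) that]] that by simp
    moreover have "\<not> f x" if "x \<in> Z" for x
    proof -
      have "x \<notin> U" using that assms(3) by blast
      then show ?thesis using Pi_mem[OF f subsetD[OF assms(2) that]] that by simp
    qed
    ultimately show "f \<in> {f. (\<forall>x\<in>U. f x) \<and> (\<forall>x\<in>Z. \<not> f x)}" by blast
  qed (auto simp: Pi_def)
  then have "measure_pmf.prob (cell_pmf n p) {f. (\<forall>x\<in>U. f x) \<and> (\<forall>x\<in>Z. \<not> f x)} =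
      (\<Prod>x\<in>cells n. measure_pmf.prob (bernoulli_pmf p) (?B x))"
    by (simp add: measure_Pi_pmf_Pi)
  also have "\<dots> = (\<Prod>x\<in>cells n. (if x \<in> U then p else 1) * (if x \<in> Z then 1 - p else 1))"
    using assms(3-5) by (intro prod.cong) (auto simp: measure_pmf_single)
  also have "\<dots> = (\<Prod>x\<in>cells n \<inter> U. p) * (\<Prod>x\<in>cells n \<inter> Z. 1 - p)"
    by (simp add: prod.distrib prod.inter_restrict[symmetric])
  also have "\<dots> = p ^ card U * (1 - p) ^ card Z"
    using assms(1,2) by (simp add: Int_absorb1)
  finally show ?thesis .
qed

lemma prob_union_bound:
  assumes "finite I" "\<And>f. P f \<Longrightarrow> \<exists>i\<in>I. Q i f"
  shows "measure_pmf.prob M {f. P f} \<le> (\<Sum>i\<in>I. measure_pmf.prob M {f. Q i f})"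
proof -
  have "measure_pmf.prob M {f. P f} \<le> measure_pmf.prob M (\<Union>i\<in>I. {f. Q i f})"
    using assms(2) by (intro measure_pmf.finite_measure_mono) auto
  also have "\<dots> \<le> (\<Sum>i\<in>I. measure_pmf.prob M {f. Q i f})"
    using assms(1) by (intro measure_pmf.finite_measure_subadditive_finite) auto
  finally show ?thesis .
qed

lemma prob_mono: "(\<And>f. P f \<Longrightarrow> Q f) \<Longrightarrow> measure_pmf.prob M {f. P f} \<le> measure_pmf.prob M {f. Q f}"
  by (intro measure_pmf.finite_measure_mono) auto

lemma sum_Pow_powers:
  fixes a b :: real
  assumes "finite Z"
  shows "(\<Sum>T\<in>Pow Z. a ^ card T * b ^ card (Z - T)) = (a + b) ^ card Z"
  using prod_add[OF assms, of "\<lambda>_. a" "\<lambda>_. b"] by simp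

lemma finite_cells_subset: "Z \<subseteq> cells n \<Longrightarrow> finite Z"
  by (erule finite_subset) simp

text \<open>
  A Chernoff bound for the lower tail, with free parameter \<open>x\<close>: weighting every one in \<open>Z\<close> by \<open>x\<close> loses
  at most a factor \<open>x ^ k\<close> if there are at most \<open>k\<close> ones, and the weighted sum over all patterns on \<open>Z\<close>
  factorises.
\<close>

lemma prob_ones_and_few_ones:
  assumes U: "U \<subseteq> cells n" and Z: "Z \<subseteq> cells n" and UZ: "U \<inter> Z = {}" and p: "0 \<le> p" "p \<le> 1"
    and x: "0 < x" "x \<le> 1"
  shows "measure_pmf.prob (cell_pmf n p) {f. (\<forall>y\<in>U. f y) \<and> card {y\<in>Z. f y} \<le> k}
           \<le> p ^ card U * ((1 / x) ^ k * (p * x + (1 - p)) ^ card Z)"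
proof -
  define I where "I = {T \<in> Pow Z. card T \<le> k}"
  have finZ: "finite Z" and finU: "finite U" using finite_cells_subset U Z by auto
  have finI: "finite I" using finZ by (simp add: I_def)
  have "measure_pmf.prob (cell_pmf n p) {f. (\<forall>y\<in>U. f y) \<and> card {y\<in>Z. f y} \<le> k}
      \<le> (\<Sum>T\<in>I. measure_pmf.prob (cell_pmf n p) {f. (\<forall>y\<in>U \<union> T. f y) \<and> (\<forall>y\<in>Z - T. \<not> f y)})"
  proof (rule prob_union_bound[OF finI])
    fix f assume "(\<forall>y\<in>U. f y) \<and> card {y\<in>Z. f y} \<le> k"
    then show "\<exists>T\<in>I. (\<forall>y\<in>U \<union> T. f y) \<and> (\<forall>y\<in>Z - T. \<not> f y)"
      by (intro bexI[of _ "{y\<in>Z. f y}"]) (auto simp: I_def)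
  qed
  also have "\<dots> \<le> (\<Sum>T\<in>I. p ^ card U * (1 / x) ^ k * ((p * x) ^ card T * (1 - p) ^ card (Z - T)))"
  proof (rule sum_mono)
    fix T assume "T \<in> I"
    then have T: "T \<subseteq> Z" "card T \<le> k" by (auto simp: I_def)
    have "measure_pmf.prob (cell_pmf n p) {f. (\<forall>y\<in>U \<union> T. f y) \<and> (\<forall>y\<in>Z - T. \<not> f y)}
        = p ^ card (U \<union> T) * (1 - p) ^ card (Z - T)"
      using T U Z UZ p by (intro prob_cylinder) auto
    also have "card (U \<union> T) = card U + card T"
      using finZ finU T UZ by (intro card_Un_disjoint) (auto intro: finite_subset)
    also have "p ^ (card U + card T) * (1 - p) ^ card (Z - T)
        = (p ^ card U * p ^ card T * (1 - p) ^ card (Z - T)) * 1" by (simp add: power_add)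
    also have "\<dots> \<le> (p ^ card U * p ^ card T * (1 - p) ^ card (Z - T)) * ((1 / x) ^ k * x ^ card T)"
    proof (rule mult_left_mono)
      have "x ^ k \<le> x ^ card T" using T(2) x by (intro power_decreasing) auto
      then show "1 \<le> (1 / x) ^ k * x ^ card T" using x by (simp add: power_one_over field_simps)
    qed (use p in simp)
    finally show "measure_pmf.prob (cell_pmf n p) {f. (\<forall>y\<in>U \<union> T. f y) \<and> (\<forall>y\<in>Z - T. \<not> f y)}
        \<le> p ^ card U * (1 / x) ^ k * ((p * x) ^ card T * (1 - p) ^ card (Z - T))"
      by (simp add: power_mult_distrib mult_ac)
  qed
  also have "\<dots> \<le> (\<Sum>T\<in>Pow Z. p ^ card U * (1 / x) ^ k * ((p * x) ^ card T * (1 - p) ^ card (Z - T)))"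
    using finZ p x by (intro sum_mono2) (auto simp: I_def)
  also have "\<dots> = p ^ card U * ((1 / x) ^ k * (p * x + (1 - p)) ^ card Z)"
    using sum_Pow_powers[OF finZ] by (simp add: sum_distrib_left[symmetric] mult_ac)
  finally show ?thesis .
qed

text \<open>
  The cells in \<open>R\<close> and their images are distinct, so the pattern on \<open>R\<close> is copied to an independent
  place. Weighting every one in \<open>R\<close> by \<open>w\<close> makes the sum over the patterns factorise, as in the lower tail
  bound. Small \<open>p\<close> will use \<open>w = 1 / p\<close>, large \<open>p\<close> will use \<open>w = 1\<close>.
\<close>

lemma prob_invariant_with_many_ones:
  assumes R: "R \<subseteq> cells n" and \<phi>: "inj_on \<phi> R" "\<phi> ` R \<subseteq> cells n" "R \<inter> \<phi> ` R = {}"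
    and p: "0 \<le> p" "p \<le> 1" and w: "1 \<le> w"
  shows "measure_pmf.prob (cell_pmf n p) {f. (\<forall>y\<in>R. f (\<phi> y) = f y) \<and> k \<le> card {y\<in>R. f y}}
           \<le> (1 / w) ^ k * (p\<^sup>2 * w + (1 - p)\<^sup>2) ^ card R"
proof -
  define I where "I = {T \<in> Pow R. k \<le> card T}"
  have finR: "finite R" by (rule finite_cells_subset[OF R])
  have finI: "finite I" using finR by (simp add: I_def)
  have "measure_pmf.prob (cell_pmf n p) {f. (\<forall>y\<in>R. f (\<phi> y) = f y) \<and> k \<le> card {y\<in>R. f y}}
      \<le> (\<Sum>T\<in>I. measure_pmf.prob (cell_pmf n p)
           {f. (\<forall>y\<in>T \<union> \<phi> ` T. f y) \<and> (\<forall>y\<in>(R - T) \<union> \<phi> ` (R - T). \<not> f y)})"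
  proof (rule prob_union_bound[OF finI])
    fix f assume f: "(\<forall>y\<in>R. f (\<phi> y) = f y) \<and> k \<le> card {y\<in>R. f y}"
    let ?T = "{y\<in>R. f y}"
    have inv: "f (\<phi> y) \<longleftrightarrow> f y" if "y \<in> R" for y using f that by blast
    show "\<exists>T\<in>I. (\<forall>y\<in>T \<union> \<phi> ` T. f y) \<and> (\<forall>y\<in>(R - T) \<union> \<phi> ` (R - T). \<not> f y)"
    proof (intro bexI[of _ ?T] conjI ballI)
      fix y assume "y \<in> ?T \<union> \<phi> ` ?T"
      then show "f y" by (elim UnE imageE) (simp_all add: inv)
    next
      fix y assume "y \<in> (R - ?T) \<union> \<phi> ` (R - ?T)"
      then show "\<not> f y" by (elim UnE imageE) (simp_all add: inv)
    next
      show "?T \<in> I" using f by (simp add: I_def)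
    qed
  qed
  also have "\<dots> \<le> (\<Sum>T\<in>I. (1 / w) ^ k * ((p\<^sup>2 * w) ^ card T * ((1 - p)\<^sup>2) ^ card (R - T)))"
  proof (rule sum_mono)
    fix T assume "T \<in> I"
    then have T: "T \<subseteq> R" "k \<le> card T" by (auto simp: I_def)
    have dbl: "card (S \<union> \<phi> ` S) = 2 * card S" if "S \<subseteq> R" for S
    proof -
      have "finite S" using that finR by (rule finite_subset)
      moreover have "S \<inter> \<phi> ` S = {}" using that \<phi>(3) by blast
      moreover have "card (\<phi> ` S) = card S" by (rule card_image[OF inj_on_subset[OF \<phi>(1) that]])
      ultimately show ?thesis by (simp add: card_Un_disjoint)
    qed
    have "measure_pmf.prob (cell_pmf n p) {f. (\<forall>y\<in>T \<union> \<phi> ` T. f y) \<and> (\<forall>y\<in>(R - T) \<union> \<phi> ` (R - T). \<not> f y)}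
        = p ^ card (T \<union> \<phi> ` T) * (1 - p) ^ card ((R - T) \<union> \<phi> ` (R - T))"
    proof (rule prob_cylinder)
      show "(T \<union> \<phi> ` T) \<inter> ((R - T) \<union> \<phi> ` (R - T)) = {}"
      proof (intro equals0I, elim IntE UnE imageE)
        fix a x y assume "a = \<phi> x" "a = \<phi> y" "x \<in> T" "y \<in> R - T"
        then show False using inj_onD[OF \<phi>(1), of x y] T(1) by auto
      qed (use T(1) \<phi>(3) in blast)+
    qed (use T R \<phi> p in auto)
    also have "\<dots> = (p\<^sup>2) ^ card T * ((1 - p)\<^sup>2) ^ card (R - T) * 1"
      using dbl[OF T(1)] dbl[of "R - T"] by (simp add: power_mult)
    also have "\<dots> \<le> (p\<^sup>2) ^ card T * ((1 - p)\<^sup>2) ^ card (R - T) * ((1 / w) ^ k * w ^ card T)"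
    proof (rule mult_left_mono)
      have "w ^ k \<le> w ^ card T" using T(2) w by (intro power_increasing) auto
      then show "1 \<le> (1 / w) ^ k * w ^ card T" using w by (simp add: power_one_over field_simps)
    qed simp
    finally show "measure_pmf.prob (cell_pmf n p) {f. (\<forall>y\<in>T \<union> \<phi> ` T. f y) \<and> (\<forall>y\<in>(R - T) \<union> \<phi> ` (R - T). \<not> f y)}
        \<le> (1 / w) ^ k * ((p\<^sup>2 * w) ^ card T * ((1 - p)\<^sup>2) ^ card (R - T))"
      by (simp add: power_mult_distrib mult_ac)
  qed
  also have "\<dots> \<le> (\<Sum>T\<in>Pow R. (1 / w) ^ k * ((p\<^sup>2 * w) ^ card T * ((1 - p)\<^sup>2) ^ card (R - T)))"
    using finR p w by (intro sum_mono2) (auto simp: I_def)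
  also have "\<dots> = (1 / w) ^ k * (p\<^sup>2 * w + (1 - p)\<^sup>2) ^ card R"
    using sum_Pow_powers[OF finR] by (simp add: sum_distrib_left[symmetric])
  finally show ?thesis .
qed

section \<open>Union bounds over pairs of permutations\<close>

text \<open>
  The graph of a map that is injective and has no fixed points consists of paths and of cycles of
  length at least two, and cycles are 3-colourable.
\<close>

lemma three_colouring:
  assumes "finite W" "inj_on \<phi> W" "\<And>x. x \<in> W \<Longrightarrow> \<phi> x \<noteq> x"
  shows "\<exists>col. (\<forall>x\<in>W. col x < (3::nat)) \<and> (\<forall>x\<in>W. \<phi> x \<in> W \<longrightarrow> col (\<phi> x) \<noteq> col x)"
  using assms
proof (induction W rule: finite_induct)
  case (insert x W)
  have "inj_on \<phi> W" using insert.prems(1) by (rule inj_on_subset) auto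
  then obtain col where col: "\<forall>x\<in>W. col x < (3::nat)" "\<forall>x\<in>W. \<phi> x \<in> W \<longrightarrow> col (\<phi> x) \<noteq> col x"
    using insert.IH insert.prems(2) by blast
  \<comment> \<open>Only the image and the preimage of \<open>x\<close> forbid a colour.\<close>
  define bad where "bad = {col (\<phi> x), col (THE y. y \<in> W \<and> \<phi> y = x)}"
  have "\<not> {..<3::nat} \<subseteq> bad"
  proof
    assume "{..<3::nat} \<subseteq> bad"
    then have "card {..<3::nat} \<le> card bad" by (rule card_mono[rotated]) (simp add: bad_def)
    also have "\<dots> \<le> 2" by (simp add: bad_def card_insert_le_m1)
    finally show False by simp
  qed
  then obtain c where c: "c < 3" "c \<notin> bad" by auto
  have pre: "(THE y. y \<in> W \<and> \<phi> y = x) = y" if "y \<in> W" "\<phi> y = x" for y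
    using that insert.prems(1) by (intro the_equality) (auto dest: inj_onD)
  have "(col(x := c)) (\<phi> y) \<noteq> (col(x := c)) y" if y: "y \<in> insert x W" "\<phi> y \<in> insert x W" for y
  proof (cases "y = x")
    case True
    then show ?thesis using c(2) insert.prems(2)[of x] by (auto simp: bad_def)
  next
    case False
    then have yW: "y \<in> W" using y(1) by simp
    show ?thesis
    proof (cases "\<phi> y = x")
      case True
      then show ?thesis using c(2) pre[OF yW] False by (auto simp: bad_def)
    next
      case False
      then show ?thesis using col(2) yW y(2) \<open>y \<noteq> x\<close> by auto
    qed
  qed
  then show ?case using c(1) col(1) by (intro exI[of _ "col(x := c)"]) auto
qed simp

text \<open>
  The colour classes are disjoint from their images, and each set has a third of its elements in one of
  them. They are chosen before the set, that is, independently of the random matrix.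
\<close>

lemma disjoint_image_cover:
  assumes "finite W" "inj_on \<phi> W" "\<And>x. x \<in> W \<Longrightarrow> \<phi> x \<noteq> x"
  obtains R :: "nat \<Rightarrow> 'a set" where
    "\<And>c. R c \<subseteq> W" "\<And>c. R c \<inter> \<phi> ` R c = {}"
    "\<And>E. E \<subseteq> W \<Longrightarrow> \<exists>c<3. card E \<le> 3 * card (E \<inter> R c)"
proof -
  obtain col where col: "\<forall>x\<in>W. col x < (3::nat)" "\<forall>x\<in>W. \<phi> x \<in> W \<longrightarrow> col (\<phi> x) \<noteq> col x"
    using three_colouring[OF assms] by blast
  define R where "R c = {x \<in> W. col x = c}" for c
  have cov: "\<exists>c<3. card E \<le> 3 * card (E \<inter> R c)" if E: "E \<subseteq> W" for E
  proof (rule ccontr)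
    assume no: "\<not> ?thesis"
    have "finite E" using E assms(1) by (rule finite_subset)
    have "E = (E \<inter> R 0) \<union> (E \<inter> R 1) \<union> (E \<inter> R 2)"
    proof -
      have "col x = 0 \<or> col x = 1 \<or> col x = 2" if "x \<in> E" for x
      proof -
        have "col x < 3" using that E col(1) by auto
        then show ?thesis by linarith
      qed
      then show ?thesis using E by (auto simp: R_def)
    qed
    from arg_cong[OF this, of card] have "card E \<le> card (E \<inter> R 0) + card (E \<inter> R 1) + card (E \<inter> R 2)"
      using card_Un_le[of "E \<inter> R 0 \<union> E \<inter> R 1" "E \<inter> R 2"] card_Un_le[of "E \<inter> R 0" "E \<inter> R 1"]
      by linarith
    moreover have "3 * card (E \<inter> R 0) < card E" "3 * card (E \<inter> R 1) < card E" "3 * card (E \<inter> R 2) < card E"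
      using no by (auto simp: not_le)
    ultimately show False by linarith
  qed
  show ?thesis
    by (rule that[of R]) (use col cov in \<open>auto simp: R_def\<close>)
qed

text \<open>
  Enlarging the sum from permutations to all functions makes it a product over the points: each point
  is either fixed, or has fewer than \<open>n\<close> other images of weight \<open>y\<close>. This avoids counting permutations
  by the number of points that they move.
\<close>

lemma sum_permutes_power_le:
  fixes y :: real
  assumes "0 \<le> y"
  shows "(\<Sum>\<sigma> | \<sigma> permutes {..<n}. y ^ card {i. \<sigma> i \<noteq> i}) \<le> (1 + real n * y) ^ n"
proof -
  let ?w = "\<lambda>i k. if k = i then 1 else y"
  let ?P = "{\<sigma>. \<sigma> permutes {..<n}}" and ?F = "PiE {..<n} (\<lambda>_. {..<n})"
  have inj: "inj_on (\<lambda>\<sigma>. restrict \<sigma> {..<n}) ?P"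
  proof (rule inj_onI)
    fix \<sigma> \<tau> assume \<sigma>: "\<sigma> \<in> ?P" and \<tau>: "\<tau> \<in> ?P" and eq: "restrict \<sigma> {..<n} = restrict \<tau> {..<n}"
    show "\<sigma> = \<tau>"
    proof
      fix i show "\<sigma> i = \<tau> i"
      proof (cases "i < n")
        case True then show ?thesis using fun_cong[OF eq, of i] by simp
      next
        case False then show ?thesis using \<sigma> \<tau> by (simp add: permutes_def)
      qed
    qed
  qed
  have "(\<Sum>\<sigma>\<in>?P. y ^ card {i. \<sigma> i \<noteq> i}) = (\<Sum>\<sigma>\<in>?P. \<Prod>i<n. ?w i (restrict \<sigma> {..<n} i))"
  proof (rule sum.cong)
    fix \<sigma> assume "\<sigma> \<in> ?P"
    then have "{i. \<sigma> i \<noteq> i} = {i \<in> {..<n}. \<sigma> i \<noteq> i}" by (auto simp: permutes_def)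
    then have "y ^ card {i. \<sigma> i \<noteq> i} = (\<Prod>i\<in>{i \<in> {..<n}. \<sigma> i \<noteq> i}. y)" by simp
    also have "\<dots> = (\<Prod>i<n. if \<sigma> i \<noteq> i then y else 1)" by (rule prod.inter_filter) simp
    also have "\<dots> = (\<Prod>i<n. ?w i (restrict \<sigma> {..<n} i))" by (rule prod.cong) auto
    finally show "y ^ card {i. \<sigma> i \<noteq> i} = (\<Prod>i<n. ?w i (restrict \<sigma> {..<n} i))" .
  qed simp
  also have "\<dots> = (\<Sum>g\<in>(\<lambda>\<sigma>. restrict \<sigma> {..<n}) ` ?P. \<Prod>i<n. ?w i (g i))"
    by (simp add: sum.reindex[OF inj])
  also have "\<dots> \<le> (\<Sum>g\<in>?F. \<Prod>i<n. ?w i (g i))"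
  proof (rule sum_mono2)
    show "finite ?F" by (intro finite_PiE) auto
    show "(\<lambda>\<sigma>. restrict \<sigma> {..<n}) ` ?P \<subseteq> ?F"
    proof (intro image_subsetI)
      fix \<sigma> assume "\<sigma> \<in> ?P"
      then have "\<sigma> i < n" if "i < n" for i using permutes_in_image[of \<sigma> "{..<n}" i] that by simp
      then show "restrict \<sigma> {..<n} \<in> ?F" by auto
    qed
  qed (use assms in \<open>auto intro!: prod_nonneg\<close>)
  also have "\<dots> = (\<Prod>i<n. \<Sum>k<n. ?w i k)" by (rule prod_sum_PiE[symmetric]) auto
  also have "\<dots> \<le> (\<Prod>i<n. 1 + real n * y)"
  proof (rule prod_mono)
    fix i assume i: "i \<in> {..<n}"
    have "(\<Sum>k<n. ?w i k) = 1 + (\<Sum>k\<in>{..<n} - {i}. y)"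
      using i by (subst sum.remove[of _ i]) (auto intro!: sum.cong)
    also have "\<dots> \<le> 1 + real n * y"
      using assms i by (auto intro!: mult_right_mono)
    finally show "0 \<le> (\<Sum>k<n. ?w i k) \<and> (\<Sum>k<n. ?w i k) \<le> 1 + real n * y"
      using assms by (auto intro!: sum_nonneg)
  qed
  also have "\<dots> = (1 + real n * y) ^ n" by simp
  finally show ?thesis .
qed

text \<open>
  It is enough to bound the event for one pair by a power \<open>y\<close> for every moved vertex with \<open>y\<close> much smaller than
  \<open>1 / n\<^sup>2\<close>; below, \<open>y\<close> is \<open>1 / n ^ 3\<close>.
\<close>

lemma prob_exists_permutation_pair:
  fixes y K :: real
  assumes y: "0 \<le> y" and K: "0 \<le> K"
    and Q: "\<And>\<sigma> \<tau>. \<sigma> permutes {..<n} \<Longrightarrow> \<tau> permutes {..<n} \<Longrightarrow> moved \<sigma> \<tau> \<noteq> {} \<Longrightarrow>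
              measure_pmf.prob M {f. Q \<sigma> \<tau> f} \<le> K * y ^ card (moved \<sigma> \<tau>)"
  shows "measure_pmf.prob M {f. \<exists>\<sigma> \<tau>. \<sigma> permutes {..<n} \<and> \<tau> permutes {..<n} \<and> moved \<sigma> \<tau> \<noteq> {} \<and> Q \<sigma> \<tau> f}
           \<le> K * ((1 + real n * y) ^ (2 * n) - 1)"
proof -
  let ?P = "{\<sigma>. \<sigma> permutes {..<n}}"
  let ?I = "?P \<times> ?P - {(id, id)}"
  have finP: "finite ?P" by (rule finite_permutations) simp
  have moved_id: "moved \<sigma> \<tau> \<noteq> {} \<longleftrightarrow> (\<sigma>, \<tau>) \<noteq> (id, id)" for \<sigma> \<tau>
    by (auto simp: moved_eq fun_eq_iff)
  have cm: "y ^ card (moved \<sigma> \<tau>) = y ^ card {i. \<sigma> i \<noteq> i} * y ^ card {i. \<tau> i \<noteq> i}"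
    if "\<sigma> \<in> ?P" "\<tau> \<in> ?P" for \<sigma> \<tau> using card_moved[of \<sigma> n \<tau>] that by (simp add: power_add)
  have "measure_pmf.prob M {f. \<exists>\<sigma> \<tau>. \<sigma> permutes {..<n} \<and> \<tau> permutes {..<n} \<and> moved \<sigma> \<tau> \<noteq> {} \<and> Q \<sigma> \<tau> f}
      \<le> (\<Sum>z\<in>?I. measure_pmf.prob M {f. Q (fst z) (snd z) f})"
  proof (rule prob_union_bound)
    show "finite ?I" using finP by simp
    fix f assume "\<exists>\<sigma> \<tau>. \<sigma> permutes {..<n} \<and> \<tau> permutes {..<n} \<and> moved \<sigma> \<tau> \<noteq> {} \<and> Q \<sigma> \<tau> f"
    then obtain \<sigma> \<tau> where "\<sigma> \<in> ?P" "\<tau> \<in> ?P" "(\<sigma>, \<tau>) \<noteq> (id, id)" "Q \<sigma> \<tau> f"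
      using moved_id by blast
    then show "\<exists>z\<in>?I. Q (fst z) (snd z) f" by (intro bexI[of _ "(\<sigma>, \<tau>)"]) auto
  qed
  also have "\<dots> \<le> (\<Sum>z\<in>?I. K * y ^ card (moved (fst z) (snd z)))"
  proof (rule sum_mono)
    fix z assume "z \<in> ?I"
    then have "fst z permutes {..<n}" "snd z permutes {..<n}" "(fst z, snd z) \<noteq> (id, id)" by auto
    then show "measure_pmf.prob M {f. Q (fst z) (snd z) f} \<le> K * y ^ card (moved (fst z) (snd z))"
      by (intro Q) (simp_all only: moved_id, simp)
  qed
  also have "\<dots> = K * ((\<Sum>z\<in>?P \<times> ?P. y ^ card (moved (fst z) (snd z))) - 1)"
  proof -
    have "(id, id) \<in> ?P \<times> ?P" by (simp add: permutes_id)
    moreover have "moved id id = {}" using moved_id by blast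
    ultimately have "(\<Sum>z\<in>?P \<times> ?P. y ^ card (moved (fst z) (snd z))) =
        1 + (\<Sum>z\<in>?I. y ^ card (moved (fst z) (snd z)))"
      using finP by (subst sum.remove[of _ "(id, id)"]) auto
    then show ?thesis by (simp add: sum_distrib_left)
  qed
  also have "(\<Sum>z\<in>?P \<times> ?P. y ^ card (moved (fst z) (snd z))) =
      (\<Sum>\<sigma>\<in>?P. \<Sum>\<tau>\<in>?P. y ^ card {i. \<sigma> i \<noteq> i} * y ^ card {i. \<tau> i \<noteq> i})"
    unfolding sum.cartesian_product by (rule sum.cong) (auto simp: cm)
  also have "\<dots> = (\<Sum>\<sigma>\<in>?P. y ^ card {i. \<sigma> i \<noteq> i})\<^sup>2"
    by (simp add: sum_product power2_eq_square)
  also have "K * (\<dots> - 1) \<le> K * (((1 + real n * y) ^ n)\<^sup>2 - 1)"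
    using sum_permutes_power_le[OF y, of n] y K
    by (intro mult_left_mono diff_right_mono power_mono sum_nonneg) auto
  also have "((1 + real n * y) ^ n)\<^sup>2 = (1 + real n * y) ^ (2 * n)"
    by (simp add: power_mult[symmetric] mult.commute)
  finally show ?thesis .
qed

section \<open>The probability of a cluster of vertices of small degree\<close>

lemma card_ends_le: "card {x. v \<in> ends x \<and> ends x \<subseteq> W} \<le> card W" if "finite W"
proof -
  have "{x. v \<in> ends x \<and> ends x \<subseteq> W} \<subseteq> (\<lambda>u. (projl (if isl v then v else u), projr (if isl v then u else v))) ` W"
  proof
    fix x assume x: "x \<in> {x. v \<in> ends x \<and> ends x \<subseteq> W}"
    then consider "v = Inl (fst x)" "Inr (snd x) \<in> W" | "v = Inr (snd x)" "Inl (fst x) \<in> W"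
      by (auto simp: ends_def)
    then show "x \<in> (\<lambda>u. (projl (if isl v then v else u), projr (if isl v then u else v))) ` W"
      by cases (force simp: image_iff)+
  qed
  then show ?thesis using that by (rule surj_card_le[rotated])
qed

lemma card_incident_cells:
  assumes "v \<in> verts n"
  shows "card {x \<in> cells n. v \<in> ends x} = n"
proof (cases v)
  case (Inl i)
  then have "{x \<in> cells n. v \<in> ends x} = {i} \<times> {..<n}" using assms by (auto simp: verts_def ends_def)
  then show ?thesis by simp
next
  case (Inr j)
  then have "{x \<in> cells n. v \<in> ends x} = {..<n} \<times> {j}" using assms by (auto simp: verts_def ends_def)
  then show ?thesis by simp
qed

text \<open>
  Outside \<open>W\<close>, the three low vertices are incident to disjoint sets of about \<open>n\<close> cells. The union of
  these sets holds at most \<open>3 D\<close> ones, and the lower tail bound applies with \<open>x = 1 / (n p)\<close>.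
\<close>

lemma prob_low_cluster_at:
  assumes W: "W \<subseteq> verts n" "card W \<le> 5" and U: "U \<subseteq> cells n" "\<And>x. x \<in> U \<Longrightarrow> ends x \<subseteq> W"
    and L: "L \<subseteq> W" "card L = 3" and p: "0 < p" "p \<le> 1" and np: "1 \<le> real n * p"
  shows "measure_pmf.prob (cell_pmf n p) {f. U \<subseteq> ones n f \<and> (\<forall>v\<in>L. deg n f v \<le> D)}
           \<le> p ^ card U * ((real n * p) ^ (3 * D) * exp (18 - 3 * (real n * p)))"
proof -
  define B where "B v = {x \<in> cells n. v \<in> ends x \<and> \<not> ends x \<subseteq> W}" for v
  define Z where "Z = (\<Union>v\<in>L. B v)"
  have finW: "finite W" using W(1) by (rule finite_subset) simp
  have finL: "finite L" using L(1) finW by (rule finite_subset)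
  have finB: "finite (B v)" for v by (rule finite_cells_subset[of _ n]) (auto simp: B_def)
  have n0: "0 < n" using np by (cases n) auto
  have cB: "n - 5 \<le> card (B v)" "card (B v) \<le> n" if v: "v \<in> L" for v
  proof -
    have vn: "v \<in> verts n" using v L W by blast
    have "finite {x. v \<in> ends x \<and> ends x \<subseteq> W}"
      by (rule finite_subset[of _ "(\<lambda>(a, b). (projl a, projr b)) ` (W \<times> W)"])
         (use finW in \<open>force simp: ends_def image_iff\<close>)+
    then have "card {x \<in> cells n. v \<in> ends x \<and> ends x \<subseteq> W} \<le> 5"
      using card_mono[of "{x. v \<in> ends x \<and> ends x \<subseteq> W}" "{x \<in> cells n. v \<in> ends x \<and> ends x \<subseteq> W}"]
        card_ends_le[OF finW, of v] W(2) by fastforce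
    moreover have "B v = {x \<in> cells n. v \<in> ends x} - {x \<in> cells n. v \<in> ends x \<and> ends x \<subseteq> W}"
      by (auto simp: B_def)
    then have "card (B v) = card {x \<in> cells n. v \<in> ends x} - card {x \<in> cells n. v \<in> ends x \<and> ends x \<subseteq> W}"
      by (simp only:) (rule card_Diff_subset, auto intro: finite_cells_subset[of _ n])
    ultimately show "n - 5 \<le> card (B v)" "card (B v) \<le> n"
      using card_incident_cells[OF vn] by simp_all
  qed
  have disj: "B u \<inter> B v = {}" if uv: "u \<in> L" "v \<in> L" "u \<noteq> v" for u v
  proof (rule equals0I)
    fix x assume "x \<in> B u \<inter> B v"
    then have x: "u \<in> ends x" "v \<in> ends x" "\<not> ends x \<subseteq> W" by (auto simp: B_def)
    then have "ends x = {u, v}" using uv(3) by (auto simp: ends_def)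
    moreover have "{u, v} \<subseteq> W" using uv L(1) by blast
    ultimately show False using x(3) by simp
  qed
  have cZ: "card Z = (\<Sum>v\<in>L. card (B v))"
    unfolding Z_def using finL finB disj by (intro card_UN_disjoint) auto
  have cZ_ge: "3 * (n - 5) \<le> card Z"
  proof -
    have "(\<Sum>v\<in>L. n - 5) \<le> card Z" unfolding cZ by (rule sum_mono) (rule cB)
    then show ?thesis using L(2) by simp
  qed
  have "measure_pmf.prob (cell_pmf n p) {f. U \<subseteq> ones n f \<and> (\<forall>v\<in>L. deg n f v \<le> D)}
     \<le> measure_pmf.prob (cell_pmf n p) {f. (\<forall>y\<in>U. f y) \<and> card {y\<in>Z. f y} \<le> 3 * D}"
  proof (rule prob_mono, intro conjI ballI)
    fix f assume f: "U \<subseteq> ones n f \<and> (\<forall>v\<in>L. deg n f v \<le> D)"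
    show "f y" if "y \<in> U" for y using f that by (auto simp: ones_def)
    have "{y\<in>Z. f y} = (\<Union>v\<in>L. {y \<in> B v. f y})" by (auto simp: Z_def)
    then have "card {y\<in>Z. f y} = card (\<Union>v\<in>L. {y \<in> B v. f y})" by (rule arg_cong)
    also have "\<dots> \<le> (\<Sum>v\<in>L. card {y \<in> B v. f y})" by (rule card_UN_le[OF finL])
    also have "\<dots> \<le> (\<Sum>v\<in>L. D)"
    proof (rule sum_mono)
      fix v assume v: "v \<in> L"
      have "card {y \<in> B v. f y} \<le> deg n f v"
        unfolding deg_def by (rule card_mono) (auto simp: B_def ones_def)
      then show "card {y \<in> B v. f y} \<le> D" using f v by fastforce
    qed
    finally show "card {y\<in>Z. f y} \<le> 3 * D" using L(2) by simp
  qed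
  also have "\<dots> \<le> p ^ card U * ((1 / (1 / (n * p))) ^ (3 * D) * (p * (1 / (n * p)) + (1 - p)) ^ card Z)"
    using U W L p np n0
    by (intro prob_ones_and_few_ones) (auto simp: Z_def B_def field_simps)
  also have "\<dots> \<le> p ^ card U * ((n * p) ^ (3 * D) * exp (18 - 3 * (n * p)))"
  proof -
    have base: "p * (1 / (n * p)) + (1 - p) = 1 + (1 / n - p)" using p n0 by (simp add: field_simps)
    have "1 / n - p \<le> 0" using np n0 by (simp add: field_simps)
    have "0 \<le> 1 / real n" by simp
    then have b0: "0 \<le> 1 + (1 / n - p)" using p by linarith
    have "(1 + (1 / n - p)) ^ card Z \<le> (1 + (1 / n - p)) ^ (3 * (n - 5))"
      using cZ_ge b0 \<open>1 / n - p \<le> 0\<close> by (intro power_decreasing) auto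
    also have "\<dots> \<le> (exp (1 / n - p)) ^ (3 * (n - 5))"
      using b0 exp_ge_add_one_self[of "1 / n - p"] by (intro power_mono) auto
    also have "\<dots> = exp (real (3 * (n - 5)) * (1 / n - p))" by (simp only: exp_of_nat_mult)
    also have "\<dots> \<le> exp (18 - 3 * (n * p))"
    proof -
      have "real (3 * (n - 5)) * (1 / n - p) \<le> (3 * real n - 15) * (1 / n - p)"
        using \<open>1 / n - p \<le> 0\<close> by (intro mult_right_mono_neg) auto
      also have "\<dots> = 3 - 3 * (n * p) - 15 / n + 15 * p" using n0 by (simp add: field_simps)
      also have "\<dots> \<le> 18 - 3 * (n * p)"
      proof -
        have "0 \<le> 15 / real n" by simp
        then show ?thesis using p by linarith
      qed
      finally show ?thesis by simp
    qed
    finally show ?thesis unfolding base using p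
      by (intro mult_left_mono) (auto intro!: mult_left_mono)
  qed
  finally show ?thesis .
qed

text \<open>
  There are at most \<open>(2 n) ^ (h + 1)\<close> sets \<open>W\<close> and at most \<open>2 ^ 25 * 2 ^ 5\<close> choices of \<open>U\<close> and \<open>L\<close> in
  each of them. Together with \<open>p ^ h\<close> for the edges in \<open>U\<close>, one factor \<open>n\<close> remains besides powers of \<open>n p\<close>.
\<close>

lemma prob_low_cluster_card:
  assumes p: "0 < p" "p \<le> 1" and np: "1 \<le> real n * p" and h: "h \<le> 4"
  shows "measure_pmf.prob (cell_pmf n p) {f. \<exists>W U L. card U = h \<and> low_cluster n D f W U L}
           \<le> 2 ^ 35 * (n * (n * p) ^ (4 + 3 * D) * exp (18 - 3 * (n * p)))"
proof -
  let ?Ws = "{W. W \<subseteq> verts n \<and> card W = Suc h}"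
  let ?C = "\<lambda>W. {x \<in> cells n. ends x \<subseteq> W}"
  define J where "J W = {U. U \<subseteq> ?C W \<and> card U = h} \<times> {L. L \<subseteq> W \<and> card L = 3}" for W
  have n0: "0 < n" using np by (cases n) auto
  have finWs: "finite ?Ws" by (rule finite_subset[of _ "Pow (verts n)"]) auto
  have finW: "finite W" if "W \<in> ?Ws" for W using that by (auto intro: finite_subset)
  have finJ: "finite (J W)" if "W \<in> ?Ws" for W
    unfolding J_def using finW[OF that] by (intro finite_SigmaI) (auto intro: finite_subset[of _ "Pow (cells n)"])
  have cardJ: "card (J W) \<le> 2 ^ 25 * 2 ^ 5" if W: "W \<in> ?Ws" for W
  proof -
    have "?C W \<subseteq> (\<lambda>(a, b). (projl a, projr b)) ` (W \<times> W)"
      by (force simp: ends_def image_iff)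
    then have "card (?C W) \<le> card (W \<times> W)" using finW[OF W] by (intro surj_card_le) auto
    also have "\<dots> = Suc h * Suc h" using W by (simp add: card_cartesian_product)
    also have "\<dots> \<le> 5 * 5" using h by (intro mult_le_mono) auto
    finally have c25: "card (?C W) \<le> 25" by simp
    have "card {U. U \<subseteq> ?C W \<and> card U = h} \<le> card (Pow (?C W))"
      by (rule card_mono) auto
    also have "\<dots> = 2 ^ card (?C W)" by (rule card_Pow) simp
    also have "\<dots> \<le> 2 ^ 25" using c25 by (intro power_increasing) auto
    finally have c1: "card {U. U \<subseteq> ?C W \<and> card U = h} \<le> 2 ^ 25" .
    have "card {L. L \<subseteq> W \<and> card L = 3} \<le> card (Pow W)" using finW[OF W] by (intro card_mono) auto
    also have "\<dots> = 2 ^ card W" using finW[OF W] by (simp add: card_Pow)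
    also have "\<dots> \<le> 2 ^ 5" using W h by (intro power_increasing) auto
    finally have c2: "card {L. L \<subseteq> W \<and> card L = 3} \<le> 2 ^ 5" .
    show ?thesis unfolding J_def card_cartesian_product by (rule mult_le_mono[OF c1 c2])
  qed
  let ?b = "p ^ h * ((n * p) ^ (3 * D) * exp (18 - 3 * (n * p)))"
  have "measure_pmf.prob (cell_pmf n p) {f. \<exists>W U L. card U = h \<and> low_cluster n D f W U L}
      \<le> (\<Sum>W\<in>?Ws. measure_pmf.prob (cell_pmf n p)
            {f. \<exists>z\<in>J W. fst z \<subseteq> ones n f \<and> (\<forall>v\<in>snd z. deg n f v \<le> D)})"
  proof (rule prob_union_bound[OF finWs])
    fix f assume "\<exists>W U L. card U = h \<and> low_cluster n D f W U L"
    then obtain W U L where c: "card U = h" "low_cluster n D f W U L" by blast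
    then have W: "W \<in> ?Ws" and z: "(U, L) \<in> J W" and low: "U \<subseteq> ones n f" "\<forall>v\<in>L. deg n f v \<le> D"
      by (auto simp: low_cluster_def J_def ones_def)
    show "\<exists>W\<in>?Ws. \<exists>z\<in>J W. fst z \<subseteq> ones n f \<and> (\<forall>v\<in>snd z. deg n f v \<le> D)"
      using low by (intro bexI[OF _ W] bexI[OF _ z]) simp
  qed
  also have "\<dots> \<le> (\<Sum>W\<in>?Ws. \<Sum>z\<in>J W. measure_pmf.prob (cell_pmf n p)
            {f. fst z \<subseteq> ones n f \<and> (\<forall>v\<in>snd z. deg n f v \<le> D)})"
    using finJ by (intro sum_mono prob_union_bound) auto
  also have "\<dots> \<le> (\<Sum>W\<in>?Ws. \<Sum>z\<in>J W. ?b)"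
  proof (intro sum_mono)
    fix W z assume W: "W \<in> ?Ws" and z: "z \<in> J W"
    have "measure_pmf.prob (cell_pmf n p) {f. fst z \<subseteq> ones n f \<and> (\<forall>v\<in>snd z. deg n f v \<le> D)}
        \<le> p ^ card (fst z) * ((n * p) ^ (3 * D) * exp (18 - 3 * (n * p)))"
      by (rule prob_low_cluster_at[of W]) (use W z h p np in \<open>auto simp: J_def\<close>)
    then show "measure_pmf.prob (cell_pmf n p) {f. fst z \<subseteq> ones n f \<and> (\<forall>v\<in>snd z. deg n f v \<le> D)} \<le> ?b"
      using z by (auto simp: J_def)
  qed
  also have "\<dots> \<le> (\<Sum>W\<in>?Ws. 2 ^ 30 * ?b)"
  proof (rule sum_mono)
    fix W assume "W \<in> ?Ws"
    then have "real (card (J W)) \<le> real (2 ^ 25 * 2 ^ 5)" using cardJ by (intro of_nat_mono) blast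
    then have "real (card (J W)) * ?b \<le> 2 ^ 30 * ?b" using p by (intro mult_right_mono) auto
    then show "(\<Sum>z\<in>J W. ?b) \<le> 2 ^ 30 * ?b" by simp
  qed
  also have "\<dots> = card ?Ws * (2 ^ 30 * ?b)" by simp
  also have "\<dots> \<le> (2 * n) ^ Suc h * (2 ^ 30 * ?b)"
  proof (intro mult_right_mono)
    have "card ?Ws = (2 * n) choose Suc h" using n_subsets[OF finite_verts, of n "Suc h"] by (simp add: card_verts)
    also have "\<dots> \<le> (2 * n) ^ Suc h"
      by (cases "Suc h \<le> 2 * n") (rule binomial_le_pow, assumption, simp add: binomial_eq_0)
    finally show "real (card ?Ws) \<le> real ((2 * n) ^ Suc h)" by (rule of_nat_mono)
  qed (use p in auto)
  also have "\<dots> = 2 ^ Suc h * (2 ^ 30 * (n * (n * p) ^ h * ((n * p) ^ (3 * D) * exp (18 - 3 * (n * p)))))"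
    by (simp add: power_mult_distrib mult_ac)
  also have "\<dots> \<le> 2 ^ 5 * (2 ^ 30 * (n * (n * p) ^ 4 * ((n * p) ^ (3 * D) * exp (18 - 3 * (n * p)))))"
  proof (rule mult_mono)
    show "(2::real) ^ Suc h \<le> 2 ^ 5" using h by (intro power_increasing) auto
    have "(n * p) ^ h \<le> (n * p) ^ 4" using np h by (intro power_increasing) auto
    then show "2 ^ 30 * (n * (n * p) ^ h * ((n * p) ^ (3 * D) * exp (18 - 3 * (n * p))))
       \<le> 2 ^ 30 * (n * (n * p) ^ 4 * ((n * p) ^ (3 * D) * exp (18 - 3 * (n * p))))"
      using p by (intro mult_left_mono mult_right_mono) auto
  qed (use p in auto)
  also have "\<dots> = 2 ^ 35 * (n * (n * p) ^ (4 + 3 * D) * exp (18 - 3 * (n * p)))"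
    by (simp add: power_add mult_ac)
  finally show ?thesis .
qed

lemma prob_low_cluster:
  assumes p: "0 < p" "p \<le> 1" and np: "1 \<le> real n * p"
  shows "measure_pmf.prob (cell_pmf n p) {f. \<exists>W U L. low_cluster n D f W U L}
           \<le> 5 * (2 ^ 35 * (n * (n * p) ^ (4 + 3 * D) * exp (18 - 3 * (n * p))))"
proof -
  have "measure_pmf.prob (cell_pmf n p) {f. \<exists>W U L. low_cluster n D f W U L}
     \<le> (\<Sum>h\<in>{..4}. measure_pmf.prob (cell_pmf n p) {f. \<exists>W U L. card U = h \<and> low_cluster n D f W U L})"
  proof (rule prob_union_bound)
    fix f assume "\<exists>W U L. low_cluster n D f W U L"
    then obtain W U L where c: "low_cluster n D f W U L" by blast
    then have "card U \<in> {..4}" by (simp add: low_cluster_def)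
    then show "\<exists>h\<in>{..4}. \<exists>W U L. card U = h \<and> low_cluster n D f W U L" using c by blast
  qed simp
  also have "\<dots> \<le> (\<Sum>h\<in>{..4::nat}. 2 ^ 35 * (n * (n * p) ^ (4 + 3 * D) * exp (18 - 3 * (n * p))))"
    by (intro sum_mono prob_low_cluster_card p np) auto
  finally show ?thesis by simp
qed

section \<open>Automorphisms are unlikely\<close>

lemma moved_cells:
  "map_prod \<sigma> \<tau> x \<noteq> x \<longleftrightarrow> ends x \<inter> moved \<sigma> \<tau> \<noteq> {}"
  by (cases x) (auto simp: ends_def moved_def)

text \<open>
  The moved cells contain all cells of the moved rows and all cells of the moved columns, and one of
  these two sets is at least half as large as their sum.
\<close>

lemma card_moved_cells:
  assumes \<sigma>: "\<sigma> permutes {..<n}" and \<tau>: "\<tau> permutes {..<n}"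
  shows "n * card (moved \<sigma> \<tau>) \<le> 2 * card {x \<in> cells n. map_prod \<sigma> \<tau> x \<noteq> x}"
proof -
  let ?W = "{x \<in> cells n. map_prod \<sigma> \<tau> x \<noteq> x}" and ?A = "{i. \<sigma> i \<noteq> i}" and ?B = "{j. \<tau> j \<noteq> j}"
  have sub: "?A \<subseteq> {..<n}" "?B \<subseteq> {..<n}" using \<sigma> \<tau> by (auto simp: permutes_def)
  have fin: "finite ?W" by (rule finite_cells_subset[of _ n]) auto
  have "card (?A \<times> {..<n}) \<le> card ?W" "card ({..<n} \<times> ?B) \<le> card ?W"
    using sub by (auto intro!: card_mono[OF fin])
  then show ?thesis unfolding card_moved[OF \<sigma> \<tau>] by (simp add: card_cartesian_product algebra_simps)
qed

lemma automorphism_invariant: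
  assumes "automorphism n f \<sigma> \<tau>" "x \<in> cells n"
  shows "f (map_prod \<sigma> \<tau> x) = f x"
  using assms by (cases x) (auto simp: automorphism_def)

lemma moved_cells_cover:
  assumes \<sigma>: "\<sigma> permutes {..<n}" and \<tau>: "\<tau> permutes {..<n}"
  obtains R :: "nat \<Rightarrow> (nat \<times> nat) set" where
    "\<And>c. R c \<subseteq> cells n" "\<And>c. inj_on (map_prod \<sigma> \<tau>) (R c)" "\<And>c. map_prod \<sigma> \<tau> ` R c \<subseteq> cells n"
    "\<And>c. R c \<inter> map_prod \<sigma> \<tau> ` R c = {}"
    "\<And>E. E \<subseteq> {x \<in> cells n. map_prod \<sigma> \<tau> x \<noteq> x} \<Longrightarrow> \<exists>c<3. card E \<le> 3 * card (E \<inter> R c)"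
proof -
  let ?\<phi> = "map_prod \<sigma> \<tau>"
  let ?W = "{x \<in> cells n. ?\<phi> x \<noteq> x}"
  have inj: "inj ?\<phi>" using \<sigma> \<tau> by (intro prod.inj_map permutes_inj)
  have lt: "\<sigma> i < n \<longleftrightarrow> i < n" "\<tau> i < n \<longleftrightarrow> i < n" for i
    using permutes_in_image[OF \<sigma>] permutes_in_image[OF \<tau>] by auto
  have fin: "finite ?W" by (rule finite_cells_subset[of _ n]) auto
  have injW: "inj_on ?\<phi> ?W" by (rule inj_on_subset[OF inj subset_UNIV])
  have ne: "\<And>x. x \<in> ?W \<Longrightarrow> ?\<phi> x \<noteq> x" by blast
  show ?thesis
  proof (rule disjoint_image_cover[OF fin injW ne])
    fix R :: "nat \<Rightarrow> (nat \<times> nat) set"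
    assume R: "\<And>c. R c \<subseteq> ?W" "\<And>c. R c \<inter> ?\<phi> ` R c = {}"
      "\<And>E. E \<subseteq> ?W \<Longrightarrow> \<exists>c<3. card E \<le> 3 * card (E \<inter> R c)"
    show ?thesis
    proof (rule that[of R])
      show "R c \<subseteq> cells n" for c using R(1)[of c] by blast
      show "inj_on ?\<phi> (R c)" for c by (rule inj_on_subset[OF inj subset_UNIV])
      show "?\<phi> ` R c \<subseteq> cells n" for c using R(1)[of c] lt by force
    qed (use R in auto)
  qed
qed

text \<open>
  With weight \<open>w = 1 / p\<close> the factor for each cell in \<open>prob_invariant_with_many_ones\<close> becomes
  \<open>1 - p (1 - p)\<close>, which is at most 1, and only the factor \<open>p\<close> for every one is left.
\<close>

lemma prob_automorphism_many_ones:
  assumes \<sigma>: "\<sigma> permutes {..<n}" and \<tau>: "\<tau> permutes {..<n}" and p: "0 < p" "p \<le> 1"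
  shows "measure_pmf.prob (cell_pmf n p)
           {f. automorphism n f \<sigma> \<tau> \<and> 3 * k \<le> card {x \<in> ones n f. ends x \<inter> moved \<sigma> \<tau> \<noteq> {}}} \<le> 3 * p ^ k"
proof -
  let ?\<phi> = "map_prod \<sigma> \<tau>"
  obtain R where R: "\<And>c. R c \<subseteq> cells n" "\<And>c. inj_on ?\<phi> (R c)" "\<And>c. ?\<phi> ` R c \<subseteq> cells n"
    "\<And>c. R c \<inter> ?\<phi> ` R c = {}"
    "\<And>E. E \<subseteq> {x \<in> cells n. ?\<phi> x \<noteq> x} \<Longrightarrow> \<exists>c<(3::nat). card E \<le> 3 * card (E \<inter> R c)"
    using moved_cells_cover[OF \<sigma> \<tau>] by blast
  have "measure_pmf.prob (cell_pmf n p)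
      {f. automorphism n f \<sigma> \<tau> \<and> 3 * k \<le> card {x \<in> ones n f. ends x \<inter> moved \<sigma> \<tau> \<noteq> {}}}
     \<le> (\<Sum>c\<in>{..<3}. measure_pmf.prob (cell_pmf n p) {f. (\<forall>y\<in>R c. f (?\<phi> y) = f y) \<and> k \<le> card {y\<in>R c. f y}})"
  proof (rule prob_union_bound)
    fix f assume f: "automorphism n f \<sigma> \<tau> \<and> 3 * k \<le> card {x \<in> ones n f. ends x \<inter> moved \<sigma> \<tau> \<noteq> {}}"
    let ?E = "{x \<in> ones n f. ends x \<inter> moved \<sigma> \<tau> \<noteq> {}}"
    have "?E \<subseteq> {x \<in> cells n. ?\<phi> x \<noteq> x}" unfolding moved_cells ones_def by blast
    from R(5)[OF this] obtain c where c: "c < 3" "card ?E \<le> 3 * card (?E \<inter> R c)" by blast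
    have "card (?E \<inter> R c) \<le> card {y \<in> R c. f y}"
      by (rule card_mono) (auto simp: ones_def intro: finite_subset[OF _ finite_cells_subset[OF R(1)]])
    then have "k \<le> card {y \<in> R c. f y}" using c f by linarith
    moreover have "\<forall>y\<in>R c. f (?\<phi> y) = f y"
      using automorphism_invariant[OF conjunct1[OF f] subsetD[OF R(1)]] by (intro ballI)
    ultimately show "\<exists>c\<in>{..<3}. (\<forall>y\<in>R c. f (?\<phi> y) = f y) \<and> k \<le> card {y\<in>R c. f y}" using c(1) by blast
  qed simp
  also have "\<dots> \<le> (\<Sum>c\<in>{..<3::nat}. p ^ k)"
  proof (rule sum_mono)
    fix c
    have "measure_pmf.prob (cell_pmf n p) {f. (\<forall>y\<in>R c. f (?\<phi> y) = f y) \<and> k \<le> card {y\<in>R c. f y}}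
        \<le> (1 / (1 / p)) ^ k * (p\<^sup>2 * (1 / p) + (1 - p)\<^sup>2) ^ card (R c)"
      using R p by (intro prob_invariant_with_many_ones) auto
    also have "p\<^sup>2 * (1 / p) + (1 - p)\<^sup>2 = 1 - p * (1 - p)" using p by (simp add: power2_eq_square field_simps)
    also have "(1 / (1 / p)) ^ k * (1 - p * (1 - p)) ^ card (R c) \<le> p ^ k * 1"
      using p by (intro mult_mono power_le_one) (auto simp: mult_le_one)
    finally show "measure_pmf.prob (cell_pmf n p) {f. (\<forall>y\<in>R c. f (?\<phi> y) = f y) \<and> k \<le> card {y\<in>R c. f y}} \<le> p ^ k"
      by simp
  qed
  finally show ?thesis by simp
qed

text \<open>
  Without information on the number of ones, every pair of a cell and its image still agrees only with
  probability \<open>1 - 2 p (1 - p)\<close>.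
\<close>

lemma prob_automorphism:
  assumes \<sigma>: "\<sigma> permutes {..<n}" and \<tau>: "\<tau> permutes {..<n}" and p: "0 \<le> p" "p \<le> 1 / 2"
  shows "measure_pmf.prob (cell_pmf n p) {f. automorphism n f \<sigma> \<tau>} \<le> exp (- (n * p / 6)) ^ card (moved \<sigma> \<tau>)"
proof -
  let ?\<phi> = "map_prod \<sigma> \<tau>"
  let ?W = "{x \<in> cells n. ?\<phi> x \<noteq> x}"
  obtain R where R: "\<And>c. R c \<subseteq> cells n" "\<And>c. inj_on ?\<phi> (R c)" "\<And>c. ?\<phi> ` R c \<subseteq> cells n"
    "\<And>c. R c \<inter> ?\<phi> ` R c = {}"
    "\<And>E. E \<subseteq> ?W \<Longrightarrow> \<exists>c<(3::nat). card E \<le> 3 * card (E \<inter> R c)"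
    using moved_cells_cover[OF \<sigma> \<tau>] by blast
  obtain c where c: "card ?W \<le> 3 * card (?W \<inter> R c)" using R(5)[OF subset_refl] by blast
  have "card (?W \<inter> R c) \<le> card (R c)" by (rule card_mono[OF finite_cells_subset[OF R(1)]]) auto
  then have cR: "n * card (moved \<sigma> \<tau>) \<le> 6 * card (R c)" using c card_moved_cells[OF \<sigma> \<tau>] by linarith
  have "measure_pmf.prob (cell_pmf n p) {f. automorphism n f \<sigma> \<tau>}
     \<le> measure_pmf.prob (cell_pmf n p) {f. (\<forall>y\<in>R c. f (?\<phi> y) = f y) \<and> 0 \<le> card {y\<in>R c. f y}}"
    using automorphism_invariant[OF _ subsetD[OF R(1)]] by (intro prob_mono) simp
  also have "\<dots> \<le> (1 / 1) ^ 0 * (p\<^sup>2 * 1 + (1 - p)\<^sup>2) ^ card (R c)"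
    using R p by (intro prob_invariant_with_many_ones) auto
  also have "\<dots> = (1 - 2 * p * (1 - p)) ^ card (R c)" by (simp add: power2_eq_square algebra_simps)
  also have "\<dots> \<le> exp (- p) ^ card (R c)"
  proof (rule power_mono)
    have "1 - 2 * p * (1 - p) = (1 - p) - p * (1 - 2 * p)" by (simp add: algebra_simps)
    also have "\<dots> \<le> 1 + (- p)" using p by simp
    also have "\<dots> \<le> exp (- p)" by (rule exp_ge_add_one_self)
    finally show "1 - 2 * p * (1 - p) \<le> exp (- p)" .
    have "2 * p * (1 - p) \<le> 1 * 1" using p by (intro mult_mono) auto
    then show "0 \<le> 1 - 2 * p * (1 - p)" by simp
  qed
  also have "\<dots> = exp (- (p * card (R c)))" by (simp add: exp_of_nat_mult[symmetric] mult.commute)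
  also have "\<dots> \<le> exp (- (p * (n * card (moved \<sigma> \<tau>) / 6)))"
  proof -
    have "real (n * card (moved \<sigma> \<tau>)) \<le> real (6 * card (R c))" using cR by (rule of_nat_mono)
    then have "p * (n * card (moved \<sigma> \<tau>) / 6) \<le> p * card (R c)" using p by (intro mult_left_mono) auto
    then show ?thesis by simp
  qed
  also have "\<dots> = exp (- (n * p / 6)) ^ card (moved \<sigma> \<tau>)"
    by (simp add: exp_of_nat_mult[symmetric] field_simps)
  finally show ?thesis .
qed

text \<open>
  For such \<open>p\<close> the union bound over all automorphisms is enough: each moved vertex
  contributes a factor of at most \<open>1 / n ^ 3\<close>. For smaller \<open>p\<close> the expected number of automorphisms is
  dominated by rare matrices with few ones.
\<close>

lemma prob_not_reconstructible_dense:
  assumes n: "0 < n" and p: "p \<le> 1 / 2" and np: "18 * ln n \<le> n * p"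
  shows "measure_pmf.prob (cell_pmf n p) {f. \<not> reconstructible (Matrix.mat n n f)}
           \<le> (1 + 1 / real n ^ 2) ^ (2 * n) - 1"
proof -
  have "0 \<le> 18 * ln n" using n by simp
  then have "0 \<le> n * p" using np by linarith
  then have p0: "0 \<le> p" using n by (simp add: zero_le_mult_iff)
  have "measure_pmf.prob (cell_pmf n p) {f. \<not> reconstructible (Matrix.mat n n f)}
     \<le> measure_pmf.prob (cell_pmf n p)
        {f. \<exists>\<sigma> \<tau>. \<sigma> permutes {..<n} \<and> \<tau> permutes {..<n} \<and> moved \<sigma> \<tau> \<noteq> {} \<and> automorphism n f \<sigma> \<tau>}"
  proof (rule prob_mono)
    fix f assume "\<not> reconstructible (Matrix.mat n n f)"
    then obtain \<sigma> \<tau> where "automorphism n f \<sigma> \<tau>" "moved \<sigma> \<tau> \<noteq> {}"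
      by (rule not_reconstructible_minimal_automorphism)
    then show "\<exists>\<sigma> \<tau>. \<sigma> permutes {..<n} \<and> \<tau> permutes {..<n} \<and> moved \<sigma> \<tau> \<noteq> {} \<and> automorphism n f \<sigma> \<tau>"
      unfolding automorphism_def by blast
  qed
  also have "\<dots> \<le> 1 * ((1 + real n * (1 / real n ^ 3)) ^ (2 * n) - 1)"
  proof (rule prob_exists_permutation_pair)
    fix \<sigma> \<tau> assume perm: "\<sigma> permutes {..<n}" "\<tau> permutes {..<n}"
    have "exp (- (n * p / 6)) \<le> exp (- (3 * ln n))" using np by simp
    also have "\<dots> = 1 / real n ^ 3" using n by (simp add: exp_minus exp_of_nat_mult[of 3, simplified] field_simps)
    finally have "exp (- (n * p / 6)) ^ card (moved \<sigma> \<tau>) \<le> (1 / real n ^ 3) ^ card (moved \<sigma> \<tau>)"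
      by (rule power_mono) simp
    then show "measure_pmf.prob (cell_pmf n p) {f. automorphism n f \<sigma> \<tau>} \<le> 1 * (1 / real n ^ 3) ^ card (moved \<sigma> \<tau>)"
      using prob_automorphism[OF perm p0 p] by linarith
  qed (use n in auto)
  also have "real n * (1 / real n ^ 3) = 1 / real n ^ 2" using n by (simp add: power3_eq_cube power2_eq_square)
  finally show ?thesis by simp
qed

text \<open>
  Either there is a low cluster, or some minimal automorphism with \<open>s\<close> moved vertices preserves a matrix
  with at least \<open>18 s\<close> ones in the moved rows and columns. The latter has probability at most
  \<open>3 * p ^ (6 * s)\<close> for each pair of permutations, and \<open>p ^ 6\<close> is at most \<open>1 / n ^ 3\<close>.
\<close>

lemma prob_not_reconstructible_sparse:
  assumes p: "0 < p" "p \<le> 1" and np: "1 \<le> real n * p" and np2: "n * p\<^sup>2 \<le> 1"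
  shows "measure_pmf.prob (cell_pmf n p)
           {f. card (isolated_ones n f) \<le> 1 \<and> \<not> reconstructible (Matrix.mat n n f)}
           \<le> 5 * (2 ^ 35 * (n * (n * p) ^ 757 * exp (18 - 3 * (n * p)))) + 3 * ((1 + 1 / real n ^ 2) ^ (2 * n) - 1)"
proof -
  have n0: "0 < n" using np by (cases n) auto
  \<comment> \<open>The value \<open>251\<close> makes \<open>Suc ?D = 14 * 18\<close>, so that there are at least 18 ones for every moved vertex.\<close>
  let ?D = "251"
  let ?Q = "\<lambda>\<sigma> \<tau> f. automorphism n f \<sigma> \<tau> \<and>
      3 * (6 * card (moved \<sigma> \<tau>)) \<le> card {x \<in> ones n f. ends x \<inter> moved \<sigma> \<tau> \<noteq> {}}"
  let ?E1 = "{f. \<exists>W U L. low_cluster n ?D f W U L}"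
  let ?E2 = "{f. \<exists>\<sigma> \<tau>. \<sigma> permutes {..<n} \<and> \<tau> permutes {..<n} \<and> moved \<sigma> \<tau> \<noteq> {} \<and> ?Q \<sigma> \<tau> f}"
  have "measure_pmf.prob (cell_pmf n p)
           {f. card (isolated_ones n f) \<le> 1 \<and> \<not> reconstructible (Matrix.mat n n f)}
     \<le> measure_pmf.prob (cell_pmf n p) (?E1 \<union> ?E2)"
  proof (intro measure_pmf.finite_measure_mono subsetI)
    fix f assume "f \<in> {f. card (isolated_ones n f) \<le> 1 \<and> \<not> reconstructible (Matrix.mat n n f)}"
    then have iso: "card (isolated_ones n f) \<le> 1" and nr: "\<not> reconstructible (Matrix.mat n n f)" by auto
    show "f \<in> ?E1 \<union> ?E2"
    proof (rule ccontr)
      assume not: "f \<notin> ?E1 \<union> ?E2"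
      obtain \<sigma> \<tau> where aut: "automorphism n f \<sigma> \<tau>" "moved \<sigma> \<tau> \<noteq> {}"
        and cover: "\<And>v. v \<in> moved \<sigma> \<tau> \<Longrightarrow> \<exists>x\<in>ones n f. v \<in> ends x \<and> ends x \<subseteq> moved \<sigma> \<tau>"
        using not_reconstructible_minimal_automorphism[OF nr] by blast
      have "\<not> low_cluster n ?D f W U L" for W U L using not by blast
      from moved_ones_lower_bound[OF aut(1) cover this iso]
      have "252 * card (moved \<sigma> \<tau>) \<le> 14 * card {x \<in> ones n f. ends x \<inter> moved \<sigma> \<tau> \<noteq> {}}" by simp
      then have "?Q \<sigma> \<tau> f" using aut(1) by linarith
      moreover have "\<sigma> permutes {..<n}" "\<tau> permutes {..<n}" using aut(1) by (auto simp: automorphism_def)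
      ultimately have "f \<in> ?E2" using aut(2) by blast
      then show False using not by blast
    qed
  qed simp
  also have "\<dots> \<le> measure_pmf.prob (cell_pmf n p) ?E1 + measure_pmf.prob (cell_pmf n p) ?E2"
    by (rule measure_Un_le) auto
  also have "measure_pmf.prob (cell_pmf n p) ?E1 \<le> 5 * (2 ^ 35 * (n * (n * p) ^ 757 * exp (18 - 3 * (n * p))))"
    using prob_low_cluster[OF p np, of ?D] by simp
  also have "measure_pmf.prob (cell_pmf n p) ?E2 \<le> 3 * ((1 + real n * (1 / real n ^ 3)) ^ (2 * n) - 1)"
  proof (rule prob_exists_permutation_pair)
    fix \<sigma> \<tau> assume perm: "\<sigma> permutes {..<n}" "\<tau> permutes {..<n}"
    have "p ^ 6 = (p\<^sup>2) ^ 3" by simp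
    also have "\<dots> \<le> (1 / n) ^ 3" using np2 n0 by (intro power_mono) (auto simp: field_simps)
    finally have "(p ^ 6) ^ card (moved \<sigma> \<tau>) \<le> ((1 / n) ^ 3) ^ card (moved \<sigma> \<tau>)"
      using p by (intro power_mono) auto
    then show "measure_pmf.prob (cell_pmf n p) {f. ?Q \<sigma> \<tau> f} \<le> 3 * (1 / real n ^ 3) ^ card (moved \<sigma> \<tau>)"
      using prob_automorphism_many_ones[OF perm p, of "6 * card (moved \<sigma> \<tau>)"]
      by (simp add: power_mult power_one_over)
  qed auto
  also have "real n * (1 / real n ^ 3) = 1 / real n ^ 2" using n0 by (simp add: power3_eq_cube power2_eq_square)
  finally show ?thesis by simp
qed

section \<open>Moments of the number of isolated ones\<close>

text \<open>
  The sets of cells that can all be isolated ones are those with no two cells in a row or a column.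
\<close>

definition matchings :: "nat \<Rightarrow> nat \<Rightarrow> (nat \<times> nat) set set" where
  "matchings n r = {T. T \<subseteq> cells n \<and> card T = r \<and> inj_on fst T \<and> inj_on snd T}"

lemma finite_matchings: "finite (matchings n r)"
  by (rule finite_subset[of _ "Pow (cells n)"]) (auto simp: matchings_def)

lemma finite_set_cell_pmf: "finite (set_pmf (cell_pmf n p))"
  by (auto simp: set_Pi_pmf)

lemma integrable_cell_pmf: "integrable (measure_pmf (cell_pmf n p)) (g :: _ \<Rightarrow> real)"
  by (rule integrable_measure_pmf_finite[OF finite_set_cell_pmf])

lemma subset_isolated_ones_iff:
  assumes "T \<subseteq> cells n"
  shows "T \<subseteq> isolated_ones n f \<longleftrightarrow> inj_on fst T \<and> inj_on snd T \<and> (\<forall>x\<in>T. f x) \<and>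
           (\<forall>x\<in>{x \<in> cells n. fst x \<in> fst ` T \<or> snd x \<in> snd ` T} - T. \<not> f x)" (is "?L \<longleftrightarrow> ?R")
proof
  assume L: ?L
  have uniq: "y = x" if "x \<in> T" "y \<in> cells n" "f y" "fst y = fst x \<or> snd y = snd x" for x y
  proof -
    have "x \<in> isolated_ones n f" using L that(1) by blast
    then have "\<forall>y\<in>ones n f. fst y = fst x \<or> snd y = snd x \<longrightarrow> y = x"
      unfolding isolated_ones_def by (cases x) simp
    from bspec[OF this, of y] show ?thesis using that by (simp add: ones_def)
  qed
  have fT: "f x" if "x \<in> T" for x
    using L that unfolding isolated_ones_def ones_def by blast
  have "inj_on fst T" "inj_on snd T"
    using uniq fT assms by (meson inj_onI subsetD)+
  moreover have "\<not> f x" if x: "x \<in> {x \<in> cells n. fst x \<in> fst ` T \<or> snd x \<in> snd ` T} - T" for x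
  proof
    assume fx: "f x"
    have "x \<in> cells n" "fst x \<in> fst ` T \<or> snd x \<in> snd ` T" "x \<notin> T" using x by simp_all
    then obtain y where "y \<in> T" "fst x = fst y \<or> snd x = snd y" by auto
    then show False using uniq[of y x] fx \<open>x \<in> cells n\<close> \<open>x \<notin> T\<close> by simp
  qed
  ultimately show ?R using fT by blast
next
  assume R: ?R
  show ?L
  proof
    fix x assume x: "x \<in> T"
    have "y = x" if y: "y \<in> ones n f" "fst y = fst x \<or> snd y = snd x" for y
    proof -
      have "y \<in> T" using R y x by (auto simp: ones_def)
      then show ?thesis using R x y(2) by (auto dest: inj_onD)
    qed
    then show "x \<in> isolated_ones n f"
      using R x assms unfolding isolated_ones_def ones_def by (cases x) auto
  qed
qed

text \<open>
  The rows and columns through \<open>T\<close> contain \<open>r * (2 * n - r)\<close> cells, of which exactly those in \<open>T\<close> are ones.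
\<close>

lemma prob_subset_isolated_ones:
  assumes T: "T \<in> matchings n r" and p: "0 \<le> p" "p \<le> 1"
  shows "measure_pmf.prob (cell_pmf n p) {f. T \<subseteq> isolated_ones n f} = p ^ r * (1 - p) ^ (r * (2 * n - r - 1))"
proof -
  have sub: "T \<subseteq> cells n" and cT: "card T = r" and inj: "inj_on fst T" "inj_on snd T"
    using T by (auto simp: matchings_def)
  have finT: "finite T" using sub by (rule finite_cells_subset)
  let ?Z = "{x \<in> cells n. fst x \<in> fst ` T \<or> snd x \<in> snd ` T}"
  have im: "fst ` T \<subseteq> {..<n}" "snd ` T \<subseteq> {..<n}" "card (fst ` T) = r" "card (snd ` T) = r"
    using sub cT inj by (auto simp: card_image)
  have rn: "r \<le> n" using card_mono[OF _ im(1)] im(3) by simp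
  have Z_eq: "?Z = cells n - ({..<n} - fst ` T) \<times> ({..<n} - snd ` T)"
  proof -
    have "x \<in> ?Z \<longleftrightarrow> x \<in> cells n - ({..<n} - fst ` T) \<times> ({..<n} - snd ` T)" for x
      by (simp only: mem_Times_iff mem_Collect_eq Diff_iff) blast
    then show ?thesis by (rule Set.set_eqI)
  qed
  have "card (?Z - T) = card ?Z - r"
    using sub cT finT by (subst card_Diff_subset) auto
  also have "card ?Z = n * n - (n - r) * (n - r)"
  proof -
    have "card (({..<n} - fst ` T) \<times> ({..<n} - snd ` T)) = (n - r) * (n - r)"
      using im finT by (simp add: card_cartesian_product card_Diff_subset)
    moreover have "card (cells n) = n * n" by (simp add: card_cartesian_product)
    ultimately show ?thesis unfolding Z_eq by (subst card_Diff_subset) auto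
  qed
  also have "n * n - (n - r) * (n - r) - r = r * (2 * n - r - 1)"
  proof -
    obtain m where m: "n = r + m" using rn by (metis le_add_diff_inverse)
    show ?thesis unfolding m by (cases "r = 0") (simp_all add: algebra_simps)
  qed
  finally have card: "card (?Z - T) = r * (2 * n - r - 1)" .
  have "{f. T \<subseteq> isolated_ones n f} = {f. (\<forall>x\<in>T. f x) \<and> (\<forall>x\<in>?Z - T. \<not> f x)}"
    unfolding subset_isolated_ones_iff[OF sub] using inj by blast
  moreover have "?Z - T \<subseteq> cells n" "T \<inter> (?Z - T) = {}" by blast+
  then have "measure_pmf.prob (cell_pmf n p) {f. (\<forall>x\<in>T. f x) \<and> (\<forall>x\<in>?Z - T. \<not> f x)}
      = p ^ r * (1 - p) ^ (r * (2 * n - r - 1))"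
    using prob_cylinder[OF sub _ _ p] by (simp only: card cT)
  ultimately show ?thesis by (simp only:)
qed

lemma prob_subset_isolated_ones_nonmatching:
  assumes "T \<subseteq> cells n" "T \<notin> matchings n (card T)"
  shows "measure_pmf.prob (cell_pmf n p) {f. T \<subseteq> isolated_ones n f} = 0"
proof -
  have "{f. T \<subseteq> isolated_ones n f} = {}"
    using assms subset_isolated_ones_iff[OF assms(1)] by (auto simp: matchings_def)
  then show ?thesis by simp
qed

text \<open>
  Count the pairs of a matching with \<open>r + 1\<close> cells and one of its cells, which can also be
  chosen last, in one of the \<open>n - r\<close> free rows and \<open>n - r\<close> free columns.
\<close>

lemma card_matchings_Suc: "Suc r * card (matchings n (Suc r)) = (n - r)\<^sup>2 * card (matchings n r)"
proof -
  let ?A = "SIGMA T:matchings n (Suc r). T"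
  let ?B = "SIGMA T:matchings n r. ({..<n} - fst ` T) \<times> ({..<n} - snd ` T)"
  have "bij_betw (\<lambda>(T, x). (T - {x}, x)) ?A ?B"
  proof (rule bij_betw_byWitness[where f' = "\<lambda>(T, x). (insert x T, x)"])
    show "\<forall>z\<in>?A. (case (case z of (T, x) \<Rightarrow> (T - {x}, x)) of (T, x) \<Rightarrow> (insert x T, x)) = z"
      by auto
    show "\<forall>z\<in>?B. (case (case z of (T, x) \<Rightarrow> (insert x T, x)) of (T, x) \<Rightarrow> (T - {x}, x)) = z"
    proof
      fix z assume "z \<in> ?B"
      then obtain T x where "x \<in> ({..<n} - fst ` T) \<times> ({..<n} - snd ` T)" "z = (T, x)" by (rule SigmaE)
      moreover from this(1) have "x \<notin> T" by (auto simp: mem_Times_iff)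
      ultimately show "(case (case z of (T, x) \<Rightarrow> (insert x T, x)) of (T, x) \<Rightarrow> (T - {x}, x)) = z" by simp
    qed
    show "(\<lambda>(T, x). (T - {x}, x)) ` ?A \<subseteq> ?B"
    proof (intro image_subsetI)
      fix z assume "z \<in> ?A"
      then obtain T x where T: "T \<in> matchings n (Suc r)" and x: "x \<in> T" and z: "z = (T, x)"
        by (rule SigmaE)
      have sub: "T \<subseteq> cells n" and inj: "inj_on fst T" "inj_on snd T" and c: "card T = Suc r"
        using T by (auto simp: matchings_def)
      have "finite T" using sub by (rule finite_cells_subset)
      then have "T - {x} \<in> matchings n r"
        using sub inj c x by (auto simp: matchings_def intro: inj_on_subset)
      moreover have "fst x \<notin> fst ` (T - {x})" "snd x \<notin> snd ` (T - {x})"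
        using inj x by (auto dest: inj_onD)
      ultimately show "(case z of (T, x) \<Rightarrow> (T - {x}, x)) \<in> ?B"
        using x sub by (auto simp: z mem_Times_iff)
    qed
    show "(\<lambda>(T, x). (insert x T, x)) ` ?B \<subseteq> ?A"
    proof (intro image_subsetI)
      fix z assume "z \<in> ?B"
      then obtain T x where T: "T \<in> matchings n r"
        and "x \<in> ({..<n} - fst ` T) \<times> ({..<n} - snd ` T)" and z: "z = (T, x)" by (rule SigmaE)
      then have x: "fst x \<in> {..<n} - fst ` T" "snd x \<in> {..<n} - snd ` T" by (simp_all add: mem_Times_iff)
      have sub: "T \<subseteq> cells n" and inj: "inj_on fst T" "inj_on snd T" and c: "card T = r"
        using T by (auto simp: matchings_def)
      have "finite T" "x \<notin> T" using sub x by (auto intro: finite_cells_subset)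
      then have "insert x T \<in> matchings n (Suc r)"
        using sub inj c x by (auto simp: matchings_def mem_Times_iff)
      then show "(case z of (T, x) \<Rightarrow> (insert x T, x)) \<in> ?A" by (simp add: z)
    qed
  qed
  then have "card ?A = card ?B" by (rule bij_betw_same_card)
  moreover have "card ?A = (\<Sum>T\<in>matchings n (Suc r). card T)"
    by (rule card_SigmaI) (auto simp: finite_matchings matchings_def intro: finite_cells_subset)
  moreover have "\<dots> = (\<Sum>T\<in>matchings n (Suc r). Suc r)" by (rule sum.cong) (auto simp: matchings_def)
  moreover have "card ?B = (\<Sum>T\<in>matchings n r. card (({..<n} - fst ` T) \<times> ({..<n} - snd ` T)))"
    by (rule card_SigmaI) (auto simp: finite_matchings)
  moreover have "\<dots> = (\<Sum>T\<in>matchings n r. (n - r)\<^sup>2)"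
  proof (rule sum.cong)
    fix T assume "T \<in> matchings n r"
    then have "fst ` T \<subseteq> {..<n}" "snd ` T \<subseteq> {..<n}" "card (fst ` T) = r" "card (snd ` T) = r" "finite T"
      by (auto simp: matchings_def card_image intro: finite_cells_subset)
    then show "card (({..<n} - fst ` T) \<times> ({..<n} - snd ` T)) = (n - r)\<^sup>2"
      by (simp add: card_cartesian_product card_Diff_subset power2_eq_square)
  qed simp
  ultimately show ?thesis by (simp add: mult.commute)
qed

definition binomial_moment :: "nat \<Rightarrow> real \<Rightarrow> nat \<Rightarrow> real" where
  "binomial_moment n p r =
     measure_pmf.expectation (cell_pmf n p) (\<lambda>f. real (card (isolated_ones n f) choose r))"

lemma binomial_moment_eq:
  fixes p :: real
  assumes p: "0 \<le> p" "p \<le> 1"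
  shows "binomial_moment n p r = card (matchings n r) * (p ^ r * (1 - p) ^ (r * (2 * n - r - 1)))"
proof -
  let ?M = "measure_pmf (cell_pmf n p)"
  let ?I = "{T. T \<subseteq> cells n \<and> card T = r}"
  have finI: "finite ?I" by (rule finite_subset[of _ "Pow (cells n)"]) auto
  have "real (card (isolated_ones n f) choose r) = (\<Sum>T\<in>?I. indicator {f. T \<subseteq> isolated_ones n f} f)" for f
  proof -
    have "card (isolated_ones n f) choose r = card {T. T \<subseteq> isolated_ones n f \<and> card T = r}"
      by (rule n_subsets[symmetric]) simp
    also have "{T. T \<subseteq> isolated_ones n f \<and> card T = r} = {T \<in> ?I. T \<subseteq> isolated_ones n f}"
      using isolated_ones_subset by blast
    finally show ?thesis using finI by (simp add: indicator_def sum.If_cases Int_def)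
  qed
  then have "binomial_moment n p r = (\<integral>f. (\<Sum>T\<in>?I. indicator {f. T \<subseteq> isolated_ones n f} f) \<partial>?M)"
    unfolding binomial_moment_def by simp
  also have "\<dots> = (\<Sum>T\<in>?I. \<integral>f. indicator {f. T \<subseteq> isolated_ones n f} f \<partial>?M)"
    by (rule Bochner_Integration.integral_sum) (rule integrable_cell_pmf)
  also have "\<dots> = (\<Sum>T\<in>?I. measure_pmf.prob (cell_pmf n p) {f. T \<subseteq> isolated_ones n f})" by simp
  also have "\<dots> = (\<Sum>T\<in>matchings n r. measure_pmf.prob (cell_pmf n p) {f. T \<subseteq> isolated_ones n f})"
    by (rule sum.mono_neutral_right[OF finI])
      (auto simp: matchings_def intro!: prob_subset_isolated_ones_nonmatching)
  also have "\<dots> = (\<Sum>T\<in>matchings n r. p ^ r * (1 - p) ^ (r * (2 * n - r - 1)))"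
    by (intro sum.cong prob_subset_isolated_ones p) auto
  finally show ?thesis by simp
qed

lemma binomial_moment_0: "0 \<le> p \<Longrightarrow> p \<le> 1 \<Longrightarrow> binomial_moment n p 0 = 1"
  by (simp add: binomial_moment_def)

text \<open>
  The quotient of consecutive moments is all that the limits below need.
\<close>

lemma binomial_moment_Suc:
  assumes p: "0 \<le> p" "p \<le> 1" and r: "r < n"
  shows "binomial_moment n p (Suc r)
       = binomial_moment n p r * ((real (n - r))\<^sup>2 * p * (1 - p) ^ (2 * (n - r - 1))) / Suc r"
proof -
  obtain m where m: "n = Suc r + m" using less_imp_Suc_add[OF r] by auto
  have e: "Suc r * (2 * n - Suc r - 1) = r * (2 * n - r - 1) + 2 * (n - r - 1)"
    unfolding m by (simp add: algebra_simps)
  have "real (Suc r * card (matchings n (Suc r))) = real ((n - r)\<^sup>2 * card (matchings n r))"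
    by (simp only: card_matchings_Suc)
  then have "real (Suc r) * real (card (matchings n (Suc r))) = (real (n - r))\<^sup>2 * real (card (matchings n r))"
    by (simp only: of_nat_mult of_nat_power)
  then have "real (card (matchings n (Suc r))) = (real (n - r))\<^sup>2 * card (matchings n r) / Suc r"
    by (simp add: eq_divide_eq mult.commute del: of_nat_Suc)
  then show ?thesis
    unfolding binomial_moment_eq[OF p] e power_add by (simp add: mult_ac)
qed

lemma binomial_moment_nonneg: "0 \<le> binomial_moment n p r"
  unfolding binomial_moment_def by (intro integral_nonneg_AE) auto

lemma alternating_binomial_sum: "(\<Sum>r\<le>K. (-1) ^ r * real (Suc y choose r)) = (-1) ^ K * real (y choose K)"
  by (induction K) (simp_all add: algebra_simps)

lemma alternating_weighted_binomial_sum: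
  "(\<Sum>r\<le>Suc K. (-1) ^ r * (real r * real (Suc (Suc z) choose r))) = - (real (Suc (Suc z)) * ((-1) ^ K * real (z choose K)))"
proof -
  have "(\<Sum>r\<le>Suc K. (-1) ^ r * (real r * real (Suc (Suc z) choose r)))
      = (\<Sum>r\<le>K. (-1) ^ Suc r * (real (Suc r) * real (Suc (Suc z) choose Suc r)))"
    by (subst sum.atMost_Suc_shift) simp
  also have "\<dots> = (\<Sum>r\<le>K. - (real (Suc (Suc z)) * ((-1) ^ r * real (Suc z choose r))))"
  proof (rule sum.cong)
    fix r
    have "real (Suc r) * real (Suc (Suc z) choose Suc r) = real (Suc (Suc z)) * real (Suc z choose r)"
      using Suc_times_binomial[of r "Suc z"] by (metis of_nat_mult)
    then show "(-1) ^ Suc r * (real (Suc r) * real (Suc (Suc z) choose Suc r))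
       = - (real (Suc (Suc z)) * ((-1) ^ r * real (Suc z choose r)))" by (simp del: binomial_Suc_Suc)
  qed simp
  also have "\<dots> = - (real (Suc (Suc z)) * ((-1) ^ K * real (z choose K)))"
    by (simp only: sum_negf sum_distrib_left[symmetric] alternating_binomial_sum)
  finally show ?thesis .
qed

text \<open>
  The number of elements of an \<open>x\<close>-element set being at most one has the inclusion-exclusion expansion
  with coefficients \<open>(-1) ^ r * (1 - r)\<close>, as the sum of the expansions for being zero and for being one. Truncating
  each of them leaves a single binomial coefficient.
\<close>

lemma bonferroni_at_most_one:
  assumes "0 < K"
  shows "\<bar>of_bool (x \<le> 1) - (\<Sum>r\<le>K. (-1) ^ r * (1 - real r) * real (x choose r))\<bar>
           \<le> real (Suc K) * real (x choose K)"
proof -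
  have split: "(\<Sum>r\<le>K. (-1) ^ r * (1 - real r) * real (x choose r)) =
      (\<Sum>r\<le>K. (-1) ^ r * real (x choose r)) - (\<Sum>r\<le>K. (-1) ^ r * (real r * real (x choose r)))"
    by (simp add: algebra_simps sum_subtractf)
  obtain k where k: "K = Suc k" using assms by (cases K) auto
  consider "x = 0" | "x = 1" | z where "x = Suc (Suc z)" by (metis One_nat_def not0_implies_Suc)
  then show ?thesis
  proof cases
    case 1
    then have "(\<Sum>r\<le>K. (-1) ^ r * (1 - real r) * real (x choose r)) = 1"
      unfolding k by (subst sum.atMost_Suc_shift) simp
    then show ?thesis using 1 by simp
  next
    case 2
    then have "(\<Sum>r\<le>K. (-1) ^ r * (1 - real r) * real (x choose r)) = 1 + (\<Sum>r\<le>k. 0)"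
      unfolding k by (subst sum.atMost_Suc_shift) (auto intro!: sum.neutral simp: binomial_eq_0_iff)
    then show ?thesis using 2 by simp
  next
    case 3
    have "\<bar>(-1) ^ K * real (Suc z choose K) + real x * ((-1) ^ k * real (z choose k))\<bar>
        \<le> real (Suc z choose K) + real x * real (z choose k)"
      by (rule order_trans[OF abs_triangle_ineq]) (simp add: abs_mult power_abs)
    also have "\<dots> \<le> real (x choose K) + real x * real (Suc z choose k)"
      using 3 by (intro add_mono mult_left_mono of_nat_mono) (simp_all add: k, cases k, simp_all)
    also have "real x * real (Suc z choose k) = real K * real (x choose K)"
      using Suc_times_binomial[of k "Suc z"] unfolding k 3 by (metis of_nat_mult)
    finally show ?thesis
      unfolding split using 3 alternating_binomial_sum[of "Suc z" K] alternating_weighted_binomial_sum[of z k]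
      by (simp add: k algebra_simps del: binomial_Suc_Suc sum.atMost_Suc power_Suc)
  qed
qed

lemma prob_eq_expectation: "measure_pmf.prob M {f. P f} = measure_pmf.expectation M (\<lambda>f. of_bool (P f))"
proof -
  have "(\<lambda>f. of_bool (P f) :: real) = indicator {f. P f}" by (auto simp: indicator_def)
  then show ?thesis by simp
qed

lemma prob_at_most_one_isolated_bonferroni:
  assumes "0 < K"
  shows "\<bar>measure_pmf.prob (cell_pmf n p) {f. card (isolated_ones n f) \<le> 1} -
            (\<Sum>r\<le>K. (-1) ^ r * (1 - real r) * binomial_moment n p r)\<bar> \<le> real (Suc K) * binomial_moment n p K"
proof -
  let ?M = "measure_pmf (cell_pmf n p)" and ?X = "\<lambda>f. card (isolated_ones n f)"
  let ?g = "\<lambda>f. of_bool (?X f \<le> 1) - (\<Sum>r\<le>K. (-1) ^ r * (1 - real r) * real (?X f choose r))"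
  have "measure_pmf.prob (cell_pmf n p) {f. ?X f \<le> 1} - (\<Sum>r\<le>K. (-1) ^ r * (1 - real r) * binomial_moment n p r)
      = (\<integral>f. of_bool (?X f \<le> 1) \<partial>?M) - (\<Sum>r\<le>K. \<integral>f. (-1) ^ r * (1 - real r) * real (?X f choose r) \<partial>?M)"
    unfolding binomial_moment_def prob_eq_expectation by simp
  also have "\<dots> = (\<integral>f. ?g f \<partial>?M)"
    by (subst Bochner_Integration.integral_sum[symmetric], rule integrable_cell_pmf,
        rule Bochner_Integration.integral_diff[symmetric]; rule integrable_cell_pmf)
  finally have eq: "measure_pmf.prob (cell_pmf n p) {f. ?X f \<le> 1}
      - (\<Sum>r\<le>K. (-1) ^ r * (1 - real r) * binomial_moment n p r) = (\<integral>f. ?g f \<partial>?M)" .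
  have "\<bar>\<integral>f. ?g f \<partial>?M\<bar> \<le> (\<integral>f. \<bar>?g f\<bar> \<partial>?M)" by (rule integral_abs_bound)
  also have "\<dots> \<le> (\<integral>f. real (Suc K) * real (?X f choose K) \<partial>?M)"
    by (rule Bochner_Integration.integral_mono[OF integrable_cell_pmf integrable_cell_pmf])
      (rule bonferroni_at_most_one[OF assms])
  also have "\<dots> = real (Suc K) * binomial_moment n p K" by (simp add: binomial_moment_def)
  finally show ?thesis unfolding eq .
qed

lemma prob_isolated_one_le: "1 - measure_pmf.prob (cell_pmf n p) {f. card (isolated_ones n f) \<le> 1} \<le> binomial_moment n p 1"
proof -
  have "1 - measure_pmf.prob (cell_pmf n p) {f. card (isolated_ones n f) \<le> 1}
      = (\<integral>f. 1 - of_bool (card (isolated_ones n f) \<le> 1) \<partial>measure_pmf (cell_pmf n p))"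
    by (subst Bochner_Integration.integral_diff) (auto simp: prob_eq_expectation integrable_cell_pmf)
  also have "\<dots> \<le> binomial_moment n p 1"
    unfolding binomial_moment_def by (intro integral_mono integrable_cell_pmf) auto
  finally show ?thesis .
qed

text \<open>
  Chebyshev's inequality: the variance is \<open>2 * binomial_moment n p 2 + \<mu> - \<mu>\<^sup>2\<close>.
\<close>

lemma prob_at_most_one_isolated_chebyshev:
  assumes "1 < binomial_moment n p 1"
  defines "\<mu> \<equiv> binomial_moment n p 1"
  shows "measure_pmf.prob (cell_pmf n p) {f. card (isolated_ones n f) \<le> 1}
           \<le> (2 * binomial_moment n p 2 + \<mu> - \<mu>\<^sup>2) / (\<mu> - 1)\<^sup>2"
proof -
  let ?M = "measure_pmf (cell_pmf n p)" and ?X = "\<lambda>f. card (isolated_ones n f)"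
  have \<mu>: "1 < \<mu>" using assms by simp
  have pt: "of_bool (x \<le> 1) * (\<mu> - 1)\<^sup>2 \<le> 2 * real (x choose 2) + (1 - 2 * \<mu>) * real (x choose 1) + \<mu>\<^sup>2" for x :: nat
  proof -
    have "2 * real (x choose 2) = real x * (real x - 1)"
      by (cases x) (simp_all add: choose_two[of "Suc _"] real_of_nat_div algebra_simps)
    then have "2 * real (x choose 2) + (1 - 2 * \<mu>) * real (x choose 1) + \<mu>\<^sup>2 = (\<mu> - real x)\<^sup>2"
      by (simp add: power2_eq_square algebra_simps)
    moreover have "of_bool (x \<le> 1) * (\<mu> - 1)\<^sup>2 \<le> (\<mu> - real x)\<^sup>2"
      using \<mu> by (cases "x \<le> 1") (auto intro!: power_mono)
    ultimately show ?thesis by simp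
  qed
  have "measure_pmf.prob (cell_pmf n p) {f. ?X f \<le> 1} * (\<mu> - 1)\<^sup>2 = (\<integral>f. of_bool (?X f \<le> 1) * (\<mu> - 1)\<^sup>2 \<partial>?M)"
    unfolding prob_eq_expectation by simp
  also have "\<dots> \<le> (\<integral>f. 2 * real (?X f choose 2) + (1 - 2 * \<mu>) * real (?X f choose 1) + \<mu>\<^sup>2 \<partial>?M)"
    by (intro integral_mono integrable_cell_pmf pt)
  also have "\<dots> = 2 * binomial_moment n p 2 + (1 - 2 * \<mu>) * binomial_moment n p 1 + \<mu>\<^sup>2"
    unfolding binomial_moment_def by (simp add: integrable_cell_pmf)
  also have "\<dots> = 2 * binomial_moment n p 2 + \<mu> - \<mu>\<^sup>2"
    unfolding \<mu>_def by (simp add: power2_eq_square algebra_simps)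
  finally show ?thesis using \<mu> by (simp add: field_simps)
qed

lemma num_ones_eq: "num_ones (Matrix.mat n n f) = card (ones n f)"
proof -
  have "{(i, j). i < dim_row (Matrix.mat n n f) \<and> j < dim_col (Matrix.mat n n f) \<and> Matrix.mat n n f $$ (i, j)} = ones n f"
    by (auto simp: ones_def)
  then show ?thesis unfolding num_ones_def by (rule arg_cong)
qed

text \<open>
  If no two ones share a row or a column, then all ones are isolated.
\<close>

lemma reconstructible_two_ones_in_line:
  assumes "reconstructible (Matrix.mat n n f)" "2 \<le> num_ones (Matrix.mat n n f)"
  shows "\<exists>x\<in>ones n f. \<exists>y\<in>ones n f. x \<noteq> y \<and> (fst x = fst y \<or> snd x = snd y)"
proof (rule ccontr)
  assume no: "\<not> ?thesis"
  have "ones n f \<subseteq> isolated_ones n f"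
  proof
    fix x assume x: "x \<in> ones n f"
    then have "\<forall>y\<in>ones n f. fst y = fst x \<or> snd y = snd x \<longrightarrow> y = x" using no by blast
    then show "x \<in> isolated_ones n f" using x by (simp add: isolated_ones_def case_prod_beta)
  qed
  then have "card (ones n f) \<le> card (isolated_ones n f)" by (intro card_mono) auto
  then show False using assms two_isolated_ones_not_reconstructible by (force simp: num_ones_eq)
qed

lemma prob_two_ones_in_line:
  assumes p: "0 \<le> p" "p \<le> 1"
  shows "measure_pmf.prob (cell_pmf n p)
     {f. \<exists>x\<in>ones n f. \<exists>y\<in>ones n f. x \<noteq> y \<and> (fst x = fst y \<or> snd x = snd y)} \<le> 2 * real n ^ 3 * p\<^sup>2"
proof -
  let ?I = "{(x, y). x \<in> cells n \<and> y \<in> cells n \<and> x \<noteq> y \<and> (fst x = fst y \<or> snd x = snd y)}"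
  have finI: "finite ?I" by (rule finite_subset[of _ "cells n \<times> cells n"]) auto
  have "?I \<subseteq> (\<lambda>((i, j), k). ((i, j), (i, k))) ` (cells n \<times> {..<n}) \<union> (\<lambda>((i, j), k). ((i, j), (k, j))) ` (cells n \<times> {..<n})"
    by (force simp: image_iff)
  then have "card ?I \<le> card ((\<lambda>((i, j), k). ((i, j), (i, k))) ` (cells n \<times> {..<n}) \<union> (\<lambda>((i, j), k). ((i, j), (k, j))) ` (cells n \<times> {..<n}))"
    by (rule card_mono[rotated]) simp
  also have "\<dots> \<le> card ((\<lambda>((i, j), k). ((i, j), (i, k))) ` (cells n \<times> {..<n})) + card ((\<lambda>((i, j), k). ((i, j), (k, j))) ` (cells n \<times> {..<n}))"
    by (rule card_Un_le)
  also have "\<dots> \<le> card (cells n \<times> {..<n}) + card (cells n \<times> {..<n})"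
    by (intro add_mono card_image_le) auto
  also have "\<dots> = 2 * n ^ 3" by (simp add: card_cartesian_product power3_eq_cube)
  finally have cI: "card ?I \<le> 2 * n ^ 3" .
  have "measure_pmf.prob (cell_pmf n p)
     {f. \<exists>x\<in>ones n f. \<exists>y\<in>ones n f. x \<noteq> y \<and> (fst x = fst y \<or> snd x = snd y)}
     \<le> (\<Sum>z\<in>?I. measure_pmf.prob (cell_pmf n p) {f. (\<forall>x\<in>{fst z, snd z}. f x) \<and> (\<forall>x\<in>{}. \<not> f x)})"
  proof (rule prob_union_bound[OF finI])
    fix f assume "\<exists>x\<in>ones n f. \<exists>y\<in>ones n f. x \<noteq> y \<and> (fst x = fst y \<or> snd x = snd y)"
    then obtain x y where xy: "x \<in> ones n f" "y \<in> ones n f" "x \<noteq> y" "fst x = fst y \<or> snd x = snd y" by blast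
    then have "(x, y) \<in> ?I" "f x" "f y" by (simp_all add: ones_def)
    then show "\<exists>z\<in>?I. (\<forall>x\<in>{fst z, snd z}. f x) \<and> (\<forall>x\<in>{}. \<not> f x)" by (intro bexI[of _ "(x, y)"]) simp_all
  qed
  also have "\<dots> = (\<Sum>z\<in>?I. p\<^sup>2)"
  proof (rule sum.cong)
    fix z assume z: "z \<in> ?I"
    have "measure_pmf.prob (cell_pmf n p) {f. (\<forall>x\<in>{fst z, snd z}. f x) \<and> (\<forall>x\<in>{}. \<not> f x)}
        = p ^ card {fst z, snd z} * (1 - p) ^ card ({} :: (nat \<times> nat) set)"
      using z p by (intro prob_cylinder) auto
    moreover have "fst z \<noteq> snd z" using z by (simp add: case_prod_beta)
    then have "card {fst z, snd z} = 2" by simp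
    ultimately show "measure_pmf.prob (cell_pmf n p) {f. (\<forall>x\<in>{fst z, snd z}. f x) \<and> (\<forall>x\<in>{}. \<not> f x)} = p\<^sup>2" by simp
  qed simp
  also have "\<dots> = card ?I * p\<^sup>2" by simp
  also have "\<dots> \<le> 2 * real n ^ 3 * p\<^sup>2"
    using of_nat_mono[OF cI, where 'a = real] by (intro mult_right_mono) simp_all
  finally show ?thesis .
qed

section \<open>Limits\<close>

text \<open>
  A lower bound on \<open>c\<close> suffices. The matrix is dense if \<open>n p\<close> is at least \<open>18 ln n\<close>. In the sparse case the
  bound \<open>exp (- 3 n p)\<close> is at most of order \<open>(n ln n) powr (-3/2)\<close>, against which the number of possible clusters, \<open>n\<close>
  up to logarithms, is negligible.
\<close>

lemma prob_not_reconstructible_few_isolated_tendsto_0: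
  fixes p c :: "nat \<Rightarrow> real"
  assumes p_eq: "\<And>n. n \<ge> 2 \<Longrightarrow> p n = 1 / (2 * real n) * (ln (real n) + ln (ln (real n)) + c n)"
    and p_bounds: "\<And>n. n \<ge> 2 \<Longrightarrow> 0 \<le> p n \<and> p n \<le> 1 / 2"
    and c: "eventually (\<lambda>n. - C \<le> c n) sequentially"
  shows "(\<lambda>n. measure_pmf.prob (cell_pmf n (p n))
           {f. card (isolated_ones n f) \<le> 1 \<and> \<not> reconstructible (Matrix.mat n n f)}) \<longlonglongrightarrow> 0"
proof -
  \<comment> \<open>The exponent \<open>757\<close> is \<open>4 + 3 * 251\<close>. Naming it keeps the power from being multiplied out.\<close>
  define k :: nat where "k = 757"
  note sparse = prob_not_reconstructible_sparse[folded k_def]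
  define A where "A k n = real n * (18 * ln n) ^ k * exp (- (3 / 2) * (ln n + ln (ln n)))" for k n
  define B where "B n = (1 + 1 / real n ^ 2) ^ (2 * n) - 1" for n
  define G where "G n = 5 * 2 ^ 35 * exp (18 + 3 / 2 * C) * A k n + 3 * B n" for n
  let ?P = "\<lambda>n. measure_pmf.prob (cell_pmf n (p n))
           {f. card (isolated_ones n f) \<le> 1 \<and> \<not> reconstructible (Matrix.mat n n f)}"
  have A_lim: "A k \<longlonglongrightarrow> 0" for k
    unfolding A_def by real_asymp
  have B_lim: "B \<longlonglongrightarrow> 0"
    unfolding B_def by real_asymp
  have "G \<longlonglongrightarrow> 5 * 2 ^ 35 * exp (18 + 3 / 2 * C) * 0 + 3 * 0"
    unfolding G_def by (intro tendsto_add tendsto_mult tendsto_const A_lim B_lim)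
  then have G_lim: "G \<longlonglongrightarrow> 0" by simp
  have e1: "eventually (\<lambda>n::nat. 1 \<le> (ln n + ln (ln n) - C) / 2) sequentially" by real_asymp
  have e2: "eventually (\<lambda>n::nat. 324 * (ln n)\<^sup>2 / n \<le> 1) sequentially" by real_asymp
  have "eventually (\<lambda>n. ?P n \<le> G n) sequentially"
    using c e1 e2 eventually_ge_at_top[of 3]
  proof eventually_elim
    case (elim n)
    let ?a = "real n * p n"
    have p: "0 \<le> p n" "p n \<le> 1 / 2" using p_bounds[of n] elim(4) by auto
    have a: "?a = (ln n + ln (ln n) + c n) / 2" using p_eq[of n] elim(4) by (simp add: field_simps)
    have a1: "1 \<le> ?a" using a elim(1,2) by simp
    then have p0: "0 < p n" using p by (cases "p n = 0") auto
    have B0: "0 \<le> B n" unfolding B_def by (simp add: one_le_power)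
    have ln0: "0 \<le> ln (real n)" using elim(4) by simp
    have A0: "0 \<le> A k n" unfolding A_def using ln0 by simp
    show ?case
    proof (cases "18 * ln n \<le> ?a")
      case True
      have "?P n \<le> measure_pmf.prob (cell_pmf n (p n)) {f. \<not> reconstructible (Matrix.mat n n f)}"
        by (rule prob_mono) simp
      also have "\<dots> \<le> B n"
        unfolding B_def by (rule prob_not_reconstructible_dense) (use elim(4) p True in auto)
      also have "\<dots> \<le> G n" using B0 A0 by (simp add: G_def)
      finally show ?thesis .
    next
      case False
      then have a18: "?a \<le> 18 * ln n" by simp
      have "?a ^ 2 \<le> (18 * ln n) ^ 2" using a18 a1 by (intro power_mono) auto
      also have "\<dots> \<le> n" using elim(3,4) by (simp add: field_simps power_mult_distrib)
      finally have np2: "n * (p n)\<^sup>2 \<le> 1"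
        using elim(4) by (simp add: power_mult_distrib power2_eq_square mult_ac)
      have "?P n \<le> 5 * (2 ^ 35 * (n * ?a ^ k * exp (18 - 3 * ?a))) + 3 * B n"
        unfolding B_def by (rule sparse) (use p0 p a1 np2 in auto)
      also have "\<dots> \<le> 5 * (2 ^ 35 * (n * (18 * ln n) ^ k *
          (exp (18 + 3 / 2 * C) * exp (- (3 / 2) * (ln n + ln (ln n)))))) + 3 * B n"
      proof (intro add_right_mono mult_left_mono mult_mono)
        show "?a ^ k \<le> (18 * ln n) ^ k" using a18 a1 by (intro power_mono) auto
        have "18 - 3 * ?a \<le> (18 + 3 / 2 * C) + (- (3 / 2) * (ln n + ln (ln n)))"
          unfolding a using elim(1) by (simp add: field_simps)
        then show "exp (18 - 3 * ?a) \<le> exp (18 + 3 / 2 * C) * exp (- (3 / 2) * (ln n + ln (ln n)))"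
          by (simp only: exp_add[symmetric] exp_le_cancel_iff)
      qed (use ln0 a1 in auto)
      also have "\<dots> = G n" by (simp add: G_def A_def mult_ac)
      finally show ?thesis .
    qed
  qed
  then show ?thesis
    by (intro tendsto_sandwich[OF _ _ tendsto_const G_lim]) auto
qed

text \<open>
  A reconstructible matrix has at most one isolated one.
\<close>

lemma prob_reconstructible_split:
  "measure_pmf.prob (random_mat n p) {A. reconstructible A} =
     measure_pmf.prob (cell_pmf n p) {f. card (isolated_ones n f) \<le> 1} -
     measure_pmf.prob (cell_pmf n p) {f. card (isolated_ones n f) \<le> 1 \<and> \<not> reconstructible (Matrix.mat n n f)}"
proof -
  let ?E = "{f. card (isolated_ones n f) \<le> 1}" and ?N = "{f. card (isolated_ones n f) \<le> 1 \<and> \<not> reconstructible (Matrix.mat n n f)}"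
  have "{f. reconstructible (Matrix.mat n n f)} = ?E - ?N"
    using two_isolated_ones_not_reconstructible[of n] by force
  then have "measure_pmf.prob (cell_pmf n p) {f. reconstructible (Matrix.mat n n f)} =
      measure_pmf.prob (cell_pmf n p) (?E - ?N)" by simp
  also have "\<dots> = measure_pmf.prob (cell_pmf n p) ?E - measure_pmf.prob (cell_pmf n p) ?N"
    by (rule measure_pmf.finite_measure_Diff) auto
  finally show ?thesis by (simp add: prob_random_mat)
qed

lemma expected_isolated_ones:
  assumes "0 \<le> p" "p \<le> 1" "0 < n"
  shows "binomial_moment n p 1 = (real n)\<^sup>2 * p * (1 - p) ^ (2 * (n - 1))"
  using binomial_moment_Suc[OF assms(1,2), of 0 n] assms by (simp add: binomial_moment_0)

text \<open>
  This is the expected number of isolated ones up to a factor that tends to one when \<open>n p\<^sup>2\<close> tends to zero.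
\<close>

lemma n_squared_p_exp:
  fixes p c :: "nat \<Rightarrow> real"
  assumes p_eq: "\<And>n. n \<ge> 2 \<Longrightarrow> p n = 1 / (2 * real n) * (ln (real n) + ln (ln (real n)) + c n)" and n: "3 \<le> n"
  shows "(real n)\<^sup>2 * p n * exp (- (2 * real n * p n)) = (ln n + ln (ln n)) / (2 * ln n) * exp (- c n) + 1 / (2 * ln n) * (c n * exp (- c n))"
proof -
  have ln1: "0 < ln (real n)" using n by simp
  have np: "2 * real n * p n = ln n + ln (ln n) + c n" using p_eq[of n] n by (simp add: field_simps)
  have "exp (- (2 * real n * p n)) = exp (- ln n) * exp (- ln (ln n)) * exp (- c n)"
    unfolding np by (simp add: exp_add[symmetric])
  also have "\<dots> = exp (- c n) / (n * ln n)" using n ln1 by (simp add: exp_minus field_simps)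
  finally have "(real n)\<^sup>2 * p n * exp (- (2 * real n * p n)) = (2 * real n * p n) * exp (- c n) / (2 * ln n)"
    using n ln1 by (simp add: power2_eq_square field_simps)
  also have "\<dots> = (ln n + ln (ln n) + c n) * exp (- c n) / (2 * ln n)" by (simp only: np)
  also have "\<dots> = (ln n + ln (ln n)) / (2 * ln n) * exp (- c n) + 1 / (2 * ln n) * (c n * exp (- c n))"
    using ln1 by (simp add: field_simps)
  finally show ?thesis .
qed

text \<open>
  Since \<open>p\<close> may be as large as \<open>1 / 2\<close>, only the upper bound \<open>1 - p \<le> exp (- p)\<close> is used here, at the
  price of a constant factor.
\<close>

lemma expected_isolated_ones_tendsto_0:
  fixes p c :: "nat \<Rightarrow> real"
  assumes p_eq: "\<And>n. n \<ge> 2 \<Longrightarrow> p n = 1 / (2 * real n) * (ln (real n) + ln (ln (real n)) + c n)"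
    and p_bounds: "\<And>n. n \<ge> 2 \<Longrightarrow> 0 \<le> p n \<and> p n \<le> 1 / 2"
    and c: "filterlim c at_top sequentially"
  shows "(\<lambda>n. binomial_moment n (p n) 1) \<longlonglongrightarrow> 0"
proof -
  let ?G = "\<lambda>n. exp 1 * ((ln n + ln (ln n)) / (2 * ln n) * exp (- c n) + 1 / (2 * ln n) * (c n * exp (- c n)))"
  have l1: "(\<lambda>n::nat. (ln n + ln (ln n)) / (2 * ln n)) \<longlonglongrightarrow> 1 / 2" by real_asymp
  have l2: "(\<lambda>n::nat. 1 / (2 * ln n)) \<longlonglongrightarrow> 0" by real_asymp
  have "((\<lambda>x::real. exp (- x)) \<longlongrightarrow> 0) at_top" "((\<lambda>x::real. x * exp (- x)) \<longlongrightarrow> 0) at_top"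
    by real_asymp+
  from this[THEN filterlim_compose, OF c]
  have l3: "(\<lambda>n. exp (- c n)) \<longlonglongrightarrow> 0" "(\<lambda>n. c n * exp (- c n)) \<longlonglongrightarrow> 0" .
  have "?G \<longlonglongrightarrow> exp 1 * (1 / 2 * 0 + 0 * 0)"
    by (intro tendsto_intros l1 l2 l3)
  then have G: "?G \<longlonglongrightarrow> 0" by simp
  have "eventually (\<lambda>n. binomial_moment n (p n) 1 \<le> ?G n) sequentially"
    using eventually_ge_at_top[of 3]
  proof eventually_elim
    case (elim n)
    have p: "0 \<le> p n" "p n \<le> 1 / 2" using p_bounds[of n] elim by auto
    have "(1 - p n) ^ (2 * (n - 1)) \<le> exp (- p n) ^ (2 * (n - 1))"
      using p exp_ge_add_one_self[of "- p n"] by (intro power_mono) auto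
    also have "\<dots> = exp (2 * p n) * exp (- (2 * real n * p n))"
      using elim by (simp add: exp_of_nat_mult[symmetric] exp_add[symmetric] of_nat_diff algebra_simps)
    also have "\<dots> \<le> exp 1 * exp (- (2 * real n * p n))" using p by (intro mult_right_mono) auto
    finally have "(real n)\<^sup>2 * p n * (1 - p n) ^ (2 * (n - 1)) \<le> (real n)\<^sup>2 * p n * (exp 1 * exp (- (2 * real n * p n)))"
      using p by (intro mult_left_mono) auto
    then show ?case
      using expected_isolated_ones[of "p n" n] p elim n_squared_p_exp[OF p_eq elim] by (simp add: mult_ac)
  qed
  then show ?thesis
    by (intro tendsto_sandwich[OF _ _ tendsto_const G]) (auto simp: binomial_moment_nonneg)
qed

text \<open>
  The limits are the binomial moments of the Poisson distribution with mean \<open>exp (- c0) / 2\<close>. The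
  quotient of two consecutive moments is split into the square of \<open>(n - r) / n\<close>, the expression of
  \<open>n_squared_p_exp\<close>, and a factor that tends to one.
\<close>

lemma binomial_moment_tendsto:
  fixes p c :: "nat \<Rightarrow> real"
  assumes p_eq: "\<And>n. n \<ge> 2 \<Longrightarrow> p n = 1 / (2 * real n) * (ln (real n) + ln (ln (real n)) + c n)"
    and p_bounds: "\<And>n. n \<ge> 2 \<Longrightarrow> 0 \<le> p n \<and> p n \<le> 1 / 2"
    and c: "c \<longlonglongrightarrow> c0"
  shows "(\<lambda>n. binomial_moment n (p n) r) \<longlonglongrightarrow> (exp (- c0) / 2) ^ r / fact r"
proof (induction r)
  case 0
  have "eventually (\<lambda>n. binomial_moment n (p n) 0 = 1) sequentially"
    using eventually_ge_at_top[of 2]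
  proof eventually_elim
    case (elim n)
    then show ?case using p_bounds[of n] by (intro binomial_moment_0) auto
  qed
  then show ?case by (simp add: tendsto_eventually)
next
  case (Suc r)
  let ?u = "\<lambda>n. (ln n + ln (ln n)) / (2 * ln n) * exp (- c n) + 1 / (2 * ln n) * (c n * exp (- c n))"
  let ?e = "\<lambda>n. real (2 * (n - r - 1)) * ln (1 - p n) + 2 * real n * p n"
  have l1: "(\<lambda>n::nat. (ln n + ln (ln n)) / (2 * ln n)) \<longlonglongrightarrow> 1 / 2" by real_asymp
  have l2: "(\<lambda>n::nat. 1 / (2 * ln n)) \<longlonglongrightarrow> 0" by real_asymp
  have l3: "(\<lambda>n::nat. real (n - r) / real n) \<longlonglongrightarrow> 1" by real_asymp
  have l4: "(\<lambda>n::nat. (ln n + ln (ln n)) / (2 * sqrt n)) \<longlonglongrightarrow> 0" by real_asymp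
  have l5: "(\<lambda>n::nat. 1 / (2 * sqrt n)) \<longlonglongrightarrow> 0" by real_asymp
  have l6: "(\<lambda>n::nat. 1 / sqrt n) \<longlonglongrightarrow> 0" by real_asymp
  have u: "?u \<longlonglongrightarrow> 1 / 2 * exp (- c0) + 0 * (c0 * exp (- c0))"
    by (intro tendsto_intros l1 l2 c)
  \<comment> \<open>Both \<open>n p\<^sup>2\<close> and \<open>p\<close> vanish, because already \<open>p \<surd>n\<close> does.\<close>
  have "(\<lambda>n. (ln n + ln (ln n)) / (2 * sqrt n) + 1 / (2 * sqrt n) * c n) \<longlonglongrightarrow> 0 + 0 * c0"
    by (intro tendsto_intros l4 l5 c)
  moreover have "eventually (\<lambda>n. (ln n + ln (ln n)) / (2 * sqrt n) + 1 / (2 * sqrt n) * c n = p n * sqrt n) sequentially"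
    using eventually_ge_at_top[of 2]
  proof eventually_elim
    case (elim n)
    have np: "2 * real n * p n = ln n + ln (ln n) + c n" using p_eq[of n] elim by (simp add: field_simps)
    have "p n * sqrt n = p n * (n / sqrt n)" by (simp add: real_div_sqrt)
    also have "\<dots> = (2 * real n * p n) / (2 * sqrt n)" by simp
    also have "\<dots> = (ln n + ln (ln n) + c n) / (2 * sqrt n)" by (simp only: np)
    finally have "p n * sqrt n = (ln n + ln (ln n) + c n) / (2 * sqrt n)" .
    then show ?case by (simp add: add_divide_distrib)
  qed
  ultimately have s: "(\<lambda>n. p n * sqrt n) \<longlonglongrightarrow> 0" by (auto intro: Lim_transform_eventually)
  have "(\<lambda>n. (p n * sqrt n)\<^sup>2) \<longlonglongrightarrow> 0\<^sup>2" by (intro tendsto_intros s)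
  then have np2: "(\<lambda>n. real n * (p n)\<^sup>2) \<longlonglongrightarrow> 0" by (simp add: power_mult_distrib mult.commute)
  have "(\<lambda>n. p n * sqrt n * (1 / sqrt n)) \<longlonglongrightarrow> 0 * 0" by (intro tendsto_mult s l6)
  moreover have "eventually (\<lambda>n. p n * sqrt n * (1 / sqrt n) = p n) sequentially"
    using eventually_gt_at_top[of 0] by eventually_elim simp
  ultimately have p_lim: "p \<longlonglongrightarrow> 0" by (auto intro: Lim_transform_eventually)
  have "(\<lambda>n. 4 * (real n * (p n)\<^sup>2) + 4 * real (Suc r) * p n) \<longlonglongrightarrow> 4 * 0 + 4 * real (Suc r) * 0"
    by (intro tendsto_intros np2 p_lim)
  then have bound_lim: "(\<lambda>n. 4 * (real n * (p n)\<^sup>2) + 4 * real (Suc r) * p n) \<longlonglongrightarrow> 0" by simp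
  have e_lim: "?e \<longlonglongrightarrow> 0"
  proof (rule Lim_null_comparison[OF _ bound_lim])
    show "eventually (\<lambda>n. norm (?e n) \<le> 4 * (real n * (p n)\<^sup>2) + 4 * real (Suc r) * p n) sequentially"
      using eventually_ge_at_top[of "r + 2"]
    proof eventually_elim
      case (elim n)
      have p: "0 \<le> p n" "p n \<le> 1 / 2" using p_bounds[of n] elim by auto
      define m where "m = real (n - r - 1)"
      have m: "m = real n - real (Suc r)" using elim by (simp add: m_def of_nat_diff)
      have m0: "0 \<le> m" "m \<le> n" using m by (auto simp: m_def)
      define d where "d = ln (1 - p n) + p n"
      have "- p n - 2 * (p n)\<^sup>2 \<le> ln (1 - p n)" using p by (intro ln_one_minus_pos_lower_bound) auto
      moreover have "ln (1 - p n) \<le> - p n" using ln_add_one_self_le_self2[of "- p n"] p by simp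
      ultimately have d: "- (2 * (p n)\<^sup>2) \<le> d" "d \<le> 0" by (auto simp: d_def)
      have e: "?e n = 2 * (m * d) + 2 * real (Suc r) * p n"
      proof -
        have nm: "real n = m + real (Suc r)" using m by simp
        show ?thesis unfolding m_def[symmetric] d_def of_nat_mult nm by (simp add: algebra_simps)
      qed
      have "m * - (2 * (p n)\<^sup>2) \<le> m * d" using d m0 by (intro mult_left_mono) auto
      moreover have "m * (2 * (p n)\<^sup>2) \<le> n * (2 * (p n)\<^sup>2)" using m0 by (intro mult_right_mono) auto
      moreover have "m * d \<le> 0" using d m0 by (simp add: mult_nonneg_nonpos)
      moreover have "0 \<le> real (Suc r) * p n" using p by simp
      moreover have "0 \<le> real n * (p n)\<^sup>2" by simp
      ultimately show ?case unfolding e real_norm_def by (simp add: abs_le_iff algebra_simps del: of_nat_Suc)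
    qed
  qed
  have lim: "(\<lambda>n. binomial_moment n (p n) r * ((real (n - r) / real n)\<^sup>2 * ?u n * exp (?e n)) / Suc r)
      \<longlonglongrightarrow> (exp (- c0) / 2) ^ r / fact r * (1\<^sup>2 * (1 / 2 * exp (- c0) + 0 * (c0 * exp (- c0))) * exp 0) / Suc r"
    by (intro tendsto_intros Suc.IH l3 u e_lim) simp
  have l_eq: "(exp (- c0) / 2) ^ r / fact r * (1\<^sup>2 * (1 / 2 * exp (- c0) + 0 * (c0 * exp (- c0))) * exp 0) / Suc r
      = (exp (- c0) / 2) ^ Suc r / fact (Suc r)" by (simp add: field_simps)
  have ev: "eventually (\<lambda>n. binomial_moment n (p n) r * ((real (n - r) / real n)\<^sup>2 * ?u n * exp (?e n)) / Suc r
      = binomial_moment n (p n) (Suc r)) sequentially"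
    using eventually_ge_at_top[of "r + 3"]
  proof eventually_elim
    case (elim n)
    have p: "0 \<le> p n" "p n \<le> 1 / 2" using p_bounds[of n] elim by auto
    have "(1 - p n) ^ (2 * (n - r - 1)) = exp (real (2 * (n - r - 1)) * ln (1 - p n))"
      using p by (subst exp_of_nat_mult) simp
    also have "\<dots> = exp (?e n) * exp (- (2 * real n * p n))" by (simp add: exp_add[symmetric])
    finally have pw: "(1 - p n) ^ (2 * (n - r - 1)) = exp (?e n) * exp (- (2 * real n * p n))" .
    have un: "?u n = (real n)\<^sup>2 * p n * exp (- (2 * real n * p n))"
      by (rule n_squared_p_exp[symmetric, OF p_eq]) (use elim in auto)
    have n0: "real n \<noteq> 0" using elim by simp
    have "(real (n - r) / real n)\<^sup>2 * ?u n * exp (?e n) = (real (n - r))\<^sup>2 * p n * (1 - p n) ^ (2 * (n - r - 1))"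
      unfolding pw un using n0 by (simp add: field_simps)
    then show ?case using binomial_moment_Suc[of "p n" r n] p elim by simp
  qed
  from Lim_transform_eventually[OF lim ev] show ?case by (simp only: l_eq)
qed

text \<open>
  The Bonferroni inequalities turn the convergence of the binomial moments into that of the
  probability: for fixed \<open>K\<close> the truncated sums converge, and the truncation error tends to
  \<open>(K + 1) * \<mu> ^ K / fact K\<close>, which vanishes as \<open>K\<close> grows.
\<close>

lemma prob_at_most_one_isolated_tendsto:
  fixes p c :: "nat \<Rightarrow> real"
  assumes p_eq: "\<And>n. n \<ge> 2 \<Longrightarrow> p n = 1 / (2 * real n) * (ln (real n) + ln (ln (real n)) + c n)"
    and p_bounds: "\<And>n. n \<ge> 2 \<Longrightarrow> 0 \<le> p n \<and> p n \<le> 1 / 2"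
    and c: "c \<longlonglongrightarrow> c0"
  shows "(\<lambda>n. measure_pmf.prob (cell_pmf n (p n)) {f. card (isolated_ones n f) \<le> 1}) \<longlonglongrightarrow> critical_prob c0"
proof -
  define \<mu> where "\<mu> = exp (- c0) / 2"
  let ?P = "\<lambda>n. measure_pmf.prob (cell_pmf n (p n)) {f. card (isolated_ones n f) \<le> 1}"
  let ?S = "\<lambda>n r. binomial_moment n (p n) r"
  let ?T = "\<lambda>K n. \<Sum>r\<le>K. (-1) ^ r * (1 - real r) * ?S n r"
  define T where "T K = (\<Sum>r\<le>K. (-1) ^ r * (1 - real r) * (\<mu> ^ r / fact r))" for K
  have S: "(\<lambda>n. ?S n r) \<longlonglongrightarrow> \<mu> ^ r / fact r" for r
    unfolding \<mu>_def by (rule binomial_moment_tendsto[OF p_eq p_bounds c])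
  have TK: "?T K \<longlonglongrightarrow> T K" for K
    unfolding T_def by (intro tendsto_intros S)
  have exp_sums: "(\<lambda>r. x ^ r / fact r) sums exp x" for x :: real
    using exp_converges[of x] by (simp add: field_simps)
  have "T \<longlonglongrightarrow> critical_prob c0"
  proof -
    have 1: "(\<lambda>r. (-\<mu>) ^ r / fact r) sums exp (-\<mu>)" by (rule exp_sums)
    have "(\<lambda>r. real (Suc r) * ((-\<mu>) ^ Suc r / fact (Suc r))) sums (- \<mu> * exp (-\<mu>))"
    proof -
      have "real (Suc r) * ((-\<mu>) ^ Suc r / fact (Suc r)) = - \<mu> * ((-\<mu>) ^ r / fact r)" for r
        by (simp add: field_simps del: of_nat_Suc)
      then show ?thesis using sums_mult[OF 1, of "- \<mu>"] by simp
    qed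
    then have 2: "(\<lambda>r. real r * ((-\<mu>) ^ r / fact r)) sums (- \<mu> * exp (-\<mu>))"
      by (subst (asm) sums_Suc_iff) simp
    have "(\<lambda>r. (-\<mu>) ^ r / fact r - real r * ((-\<mu>) ^ r / fact r)) sums (exp (-\<mu>) - (- \<mu> * exp (-\<mu>)))"
      by (rule sums_diff[OF 1 2])
    moreover have "(-\<mu>) ^ r / fact r - real r * ((-\<mu>) ^ r / fact r) = (-1) ^ r * (1 - real r) * (\<mu> ^ r / fact r)" for r
      by (simp add: power_minus[of \<mu>] algebra_simps)
    moreover have "exp (-\<mu>) - (- \<mu> * exp (-\<mu>)) = critical_prob c0"
      by (simp add: critical_prob_def \<mu>_def algebra_simps)
    ultimately show ?thesis unfolding T_def by (simp add: sums_def_le)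
  qed
  have err: "(\<lambda>K. real (Suc K) * (\<mu> ^ K / fact K)) \<longlonglongrightarrow> 0"
  proof -
    have "summable (\<lambda>r. \<mu> ^ r / fact r)" using exp_sums sums_summable by blast
    then have z: "(\<lambda>r. \<mu> ^ r / fact r) \<longlonglongrightarrow> 0" by (rule summable_LIMSEQ_zero)
    have "(\<lambda>K. real (Suc (Suc K)) * (\<mu> ^ Suc K / fact (Suc K))) \<longlonglongrightarrow> 0"
    proof -
      have "real (Suc (Suc K)) * (\<mu> ^ Suc K / fact (Suc K)) = \<mu> * (\<mu> ^ K / fact K) + \<mu> ^ Suc K / fact (Suc K)" for K
      proof -
        have "real (Suc K) * (\<mu> ^ Suc K / fact (Suc K)) = \<mu> * (\<mu> ^ K / fact K)"
          by (simp add: field_simps del: of_nat_Suc)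
        then show ?thesis by (simp only: of_nat_Suc[of "Suc K"] distrib_right mult_1 add.commute)
      qed
      moreover have "(\<lambda>K. \<mu> * (\<mu> ^ K / fact K) + \<mu> ^ Suc K / fact (Suc K)) \<longlonglongrightarrow> \<mu> * 0 + 0"
        by (intro tendsto_add tendsto_mult tendsto_const z LIMSEQ_Suc[OF z])
      ultimately show ?thesis by simp
    qed
    then show ?thesis by (subst (asm) filterlim_sequentially_Suc)
  qed
  show ?thesis
  proof (rule LIMSEQ_I)
    fix \<epsilon> :: real assume \<epsilon>: "0 < \<epsilon>"
    have e3: "0 < \<epsilon> / 3" using \<epsilon> by simp
    obtain K where K: "0 < K" "dist (T K) (critical_prob c0) < \<epsilon> / 3" "real (Suc K) * (\<mu> ^ K / fact K) < \<epsilon> / 3"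
      using eventually_happens'[OF sequentially_bot eventually_conj[OF eventually_gt_at_top[of 0]
        eventually_conj[OF tendstoD[OF \<open>T \<longlonglongrightarrow> critical_prob c0\<close> e3] order_tendstoD(2)[OF err e3]]]]
      by blast
    have "(\<lambda>n. real (Suc K) * ?S n K) \<longlonglongrightarrow> real (Suc K) * (\<mu> ^ K / fact K)" by (intro tendsto_intros S)
    from order_tendstoD(2)[OF this K(3)] have "eventually (\<lambda>n. real (Suc K) * ?S n K < \<epsilon> / 3) sequentially" .
    moreover have "eventually (\<lambda>n. dist (?T K n) (T K) < \<epsilon> / 3) sequentially"
      using \<epsilon> by (intro tendstoD[OF TK]) simp
    ultimately have "eventually (\<lambda>n. norm (?P n - critical_prob c0) < \<epsilon>) sequentially"
    proof eventually_elim
      case (elim n)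
      have "\<bar>?P n - ?T K n\<bar> \<le> real (Suc K) * ?S n K" by (rule prob_at_most_one_isolated_bonferroni[OF K(1)])
      then show ?case using elim K(2) unfolding dist_real_def real_norm_def by linarith
    qed
    then show "\<exists>n0. \<forall>n\<ge>n0. norm (?P n - critical_prob c0) < \<epsilon>" by (simp add: eventually_sequentially)
  qed
qed

text \<open>
  The events that two given cells in different rows and columns are isolated ones are nearly
  independent, so the variance exceeds the mean \<open>\<mu>\<close> by at most \<open>8 p\<close> times \<open>\<mu>\<^sup>2\<close>.
\<close>

lemma prob_at_most_one_isolated_le:
  assumes p: "0 \<le> p" "p \<le> 1 / 2" and n: "2 \<le> n"
    and \<mu>: "2 \<le> (real n)\<^sup>2 * p * (1 - p) ^ (2 * (n - 1))" (is "2 \<le> ?\<mu>")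
  shows "measure_pmf.prob (cell_pmf n p) {f. card (isolated_ones n f) \<le> 1} \<le> 32 * p + 4 / ?\<mu>"
proof -
  define m where "m = ?\<mu>"
  have m: "2 \<le> m" using \<mu> by (simp add: m_def)
  have b1: "binomial_moment n p 1 = m" unfolding m_def using expected_isolated_ones[of p n] p n by simp
  have q: "1 / 2 \<le> 1 - p" using p by simp
  \<comment> \<open>This replaces the factor \<open>1 / (1 - p)\<^sup>2\<close> by which pairs are more likely than under independence.\<close>
  have q2: "1 \<le> (1 + 8 * p) * (1 - p)\<^sup>2"
  proof -
    have prod: "(1 + 8 * p) * (1 - p)\<^sup>2 = 1 + p * (6 - 15 * p + 8 * p\<^sup>2)"
      by (simp add: power2_eq_square algebra_simps)
    have sq: "6 - 15 * p + 8 * p\<^sup>2 = 8 * (p - 1 / 2)\<^sup>2 + 7 * (1 / 2 - p) + 1 / 2"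
      by (simp add: power2_eq_square algebra_simps)
    have "0 \<le> 6 - 15 * p + 8 * p\<^sup>2"
      unfolding sq using p by (intro add_nonneg_nonneg mult_nonneg_nonneg) auto
    then show ?thesis unfolding prod using p by simp
  qed
  have b2: "2 * binomial_moment n p 2 \<le> m * (m * (1 + 8 * p))"
  proof -
    have "2 * binomial_moment n p 2 = m * ((real (n - 1))\<^sup>2 * p * (1 - p) ^ (2 * (n - 2)))"
    proof -
      have "binomial_moment n p (Suc 1) =
          binomial_moment n p 1 * ((real (n - 1))\<^sup>2 * p * (1 - p) ^ (2 * (n - 1 - 1))) / real (Suc 1)"
        using p n by (intro binomial_moment_Suc) auto
      moreover have "Suc 1 = 2" "n - 1 - 1 = n - 2" by simp_all
      ultimately show ?thesis by (simp add: b1 del: One_nat_def)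
    qed
    also have "\<dots> \<le> m * (m * (1 + 8 * p))"
    proof (rule mult_left_mono)
      have e: "2 * (n - 1) = 2 * (n - 2) + 2" using n by simp
      have "(real (n - 1))\<^sup>2 * p * (1 - p) ^ (2 * (n - 2)) \<le> (real n)\<^sup>2 * p * (1 - p) ^ (2 * (n - 2))"
        using p n by (intro mult_right_mono power_mono) auto
      also have "\<dots> \<le> (real n)\<^sup>2 * p * (1 - p) ^ (2 * (n - 2)) * ((1 + 8 * p) * (1 - p)\<^sup>2)"
        using mult_left_mono[OF q2, of "(real n)\<^sup>2 * p * (1 - p) ^ (2 * (n - 2))"] p by simp
      also have "\<dots> = m * (1 + 8 * p)" unfolding m_def e power_add by (simp add: mult_ac)
      finally show "(real (n - 1))\<^sup>2 * p * (1 - p) ^ (2 * (n - 2)) \<le> m * (1 + 8 * p)" .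
    qed (use m in simp)
    finally show ?thesis .
  qed
  have "measure_pmf.prob (cell_pmf n p) {f. card (isolated_ones n f) \<le> 1}
      \<le> (2 * binomial_moment n p 2 + m - m\<^sup>2) / (m - 1)\<^sup>2"
    using prob_at_most_one_isolated_chebyshev[of n p] b1 m by simp
  also have "\<dots> \<le> (m * (m * (1 + 8 * p)) + m - m\<^sup>2) / (m - 1)\<^sup>2"
    using b2 by (intro divide_right_mono) auto
  also have "\<dots> = (8 * p * m\<^sup>2 + m) / (m - 1)\<^sup>2" by (simp add: power2_eq_square algebra_simps)
  also have "\<dots> \<le> (8 * p * m\<^sup>2 + m) / (m / 2)\<^sup>2"
    using m p by (intro divide_left_mono power_mono) auto
  also have "\<dots> = 32 * p + 4 / m" using m by (simp add: power2_eq_square field_simps)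
  finally show ?thesis unfolding m_def .
qed

text \<open>
  As a function of \<open>a = n p\<close> the mean is about \<open>n a exp (- 2 a)\<close>, which increases and then decreases. If
  \<open>a\<close> is at least \<open>ln n / 8\<close>, it is of order \<open>exp (- c)\<close>; for smaller \<open>a\<close> it is at least a power of \<open>n\<close>
  because \<open>a\<close> is at least \<open>n powr (-0.6)\<close>.
\<close>

lemma expected_isolated_ones_lower_bound:
  assumes p: "0 \<le> p" "p \<le> 1 / 2" and n: "3 \<le> n"
    and p_eq: "2 * real n * p = ln n + ln (ln n) + c" and c: "c \<le> 0"
    and lnln: "ln (ln n) \<le> ln n" and ln2: "4 * (ln n)\<^sup>2 / n \<le> 1" and p_large: "real n powr (-1.6) \<le> p"
  shows "min (exp (- c) / 8) (n powr 0.15) / exp 1 \<le> (real n)\<^sup>2 * p * (1 - p) ^ (2 * (n - 1))"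
proof -
  have n0: "0 < real n" using n by simp
  have ln1: "0 < ln (real n)" using n by simp
  have p_le: "n * p \<le> ln n" using p_eq c lnln by simp
  have "4 * n * p\<^sup>2 = 4 * (n * p)\<^sup>2 / n" using n0 by (simp add: power2_eq_square field_simps)
  also have "\<dots> \<le> 4 * (ln n)\<^sup>2 / n" using p_le p by (intro divide_right_mono mult_left_mono power_mono) auto
  also have "\<dots> \<le> 1" by (rule ln2)
  finally have np2: "4 * n * p\<^sup>2 \<le> 1" .
  have "exp (- (2 * n * p)) / exp 1 = exp (- (2 * n * p) - 1)" by (simp add: exp_diff)
  also have "\<dots> \<le> exp (real (2 * n) * (- p - 2 * p\<^sup>2))" using np2 by (simp add: algebra_simps)
  also have "\<dots> \<le> exp (real (2 * n) * ln (1 - p))"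
    using ln_one_minus_pos_lower_bound[OF p] by (subst exp_le_cancel_iff) (intro mult_left_mono, auto)
  also have "\<dots> = (1 - p) ^ (2 * n)" using p by (subst exp_of_nat_mult) simp
  also have "\<dots> \<le> (1 - p) ^ (2 * (n - 1))" using p by (intro power_decreasing) auto
  finally have pw: "exp (- (2 * n * p)) / exp 1 \<le> (1 - p) ^ (2 * (n - 1))" .
  have main: "min (exp (- c) / 8) (n powr 0.15) \<le> (real n)\<^sup>2 * p * exp (- (2 * n * p))"
  proof (cases "ln n / 8 \<le> n * p")
    case True
    have "exp (- (2 * real n * p)) = exp (- ln n) * exp (- ln (ln n)) * exp (- c)"
      unfolding p_eq by (simp add: exp_add[symmetric])
    also have "\<dots> = exp (- c) / (n * ln n)" using n0 ln1 by (simp add: exp_minus field_simps)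
    finally have "(real n)\<^sup>2 * p * exp (- (2 * n * p)) = (n * p) * (exp (- c) / ln n)"
      using n0 ln1 by (simp add: power2_eq_square field_simps)
    moreover have "ln n / 8 * (exp (- c) / ln n) \<le> (n * p) * (exp (- c) / ln n)"
      using True ln1 by (intro mult_right_mono) auto
    moreover have "ln n / 8 * (exp (- c) / ln n) = exp (- c) / 8" using ln1 by simp
    ultimately show ?thesis by linarith
  next
    case False
    have "n powr 0.15 = n powr (2 + -1.6 + -0.25)" by simp
    also have "\<dots> = n powr 2 * n powr (-1.6) * n powr (-0.25)" by (simp only: powr_add)
    also have "\<dots> \<le> n powr 2 * p * exp (- (2 * n * p))"
    proof (intro mult_mono mult_left_mono p_large)
      have "n powr (-0.25) = exp (- (ln n / 4))" using n0 by (simp add: powr_def)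
      also have "\<dots> \<le> exp (- (2 * n * p))" using False by simp
      finally show "n powr (-0.25) \<le> exp (- (2 * n * p))" .
    qed (use p in auto)
    also have "n powr 2 = (real n)\<^sup>2" using n0 by (simp add: powr_numeral)
    finally show ?thesis by linarith
  qed
  have "min (exp (- c) / 8) (n powr 0.15) / exp 1 \<le> (real n)\<^sup>2 * p * exp (- (2 * n * p)) / exp 1"
    using main by (intro divide_right_mono) auto
  also have "\<dots> = (real n)\<^sup>2 * p * (exp (- (2 * n * p)) / exp 1)" by simp
  also have "\<dots> \<le> (real n)\<^sup>2 * p * (1 - p) ^ (2 * (n - 1))" using pw p by (intro mult_left_mono) auto
  finally show ?thesis .
qed

text \<open>
  If \<open>p\<close> is at most \<open>n powr (-1.6)\<close>, then two ones in a common row or column are unlikely, and any two ones are isolated.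
  Otherwise the expected number of isolated ones tends to infinity, and Chebyshev's inequality gives
  two of them.
\<close>

lemma prob_two_ones_and_reconstructible_tendsto_0:
  fixes p c :: "nat \<Rightarrow> real"
  assumes p_eq: "\<And>n. n \<ge> 2 \<Longrightarrow> p n = 1 / (2 * real n) * (ln (real n) + ln (ln (real n)) + c n)"
    and p_bounds: "\<And>n. n \<ge> 2 \<Longrightarrow> 0 \<le> p n \<and> p n \<le> 1 / 2"
    and c: "filterlim c at_bot sequentially"
  shows "(\<lambda>n. measure_pmf.prob (cell_pmf n (p n))
           {f. 2 \<le> num_ones (Matrix.mat n n f) \<and> reconstructible (Matrix.mat n n f)}) \<longlonglongrightarrow> 0"
proof -
  let ?P = "\<lambda>n. measure_pmf.prob (cell_pmf n (p n))
           {f. 2 \<le> num_ones (Matrix.mat n n f) \<and> reconstructible (Matrix.mat n n f)}"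
  let ?G = "\<lambda>n. 2 * real n powr (-0.2) + 32 * (ln n / n) + 4 * exp 1 * (8 * exp (c n) + n powr (-0.15))"
  have l1: "(\<lambda>n. 2 * real n powr (-0.2)) \<longlonglongrightarrow> 0" "(\<lambda>n. ln (real n) / real n) \<longlonglongrightarrow> 0" "(\<lambda>n. real n powr (-0.15)) \<longlonglongrightarrow> 0"
    by real_asymp+
  have l2: "(\<lambda>n. exp (c n)) \<longlonglongrightarrow> 0" by (rule filterlim_compose[OF exp_at_bot c])
  have "?G \<longlonglongrightarrow> 0 + 32 * 0 + 4 * exp 1 * (8 * 0 + 0)"
    by (intro tendsto_add tendsto_mult tendsto_const l1 l2)
  then have G: "?G \<longlonglongrightarrow> 0" by simp
  have c_small: "eventually (\<lambda>n. c n \<le> min 0 (- ln (16 * exp 1))) sequentially"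
    using c unfolding filterlim_at_bot by blast
  have e1: "eventually (\<lambda>n::nat. ln (ln n) \<le> ln n) sequentially"
    "eventually (\<lambda>n::nat. 4 * (ln n)\<^sup>2 / n \<le> 1) sequentially"
    "eventually (\<lambda>n::nat. 2 * exp 1 \<le> real n powr 0.15) sequentially"
    by real_asymp+
  have "eventually (\<lambda>n. ?P n \<le> ?G n) sequentially"
    using c_small e1 eventually_ge_at_top[of 3]
  proof eventually_elim
    case (elim n)
    have n0: "0 < real n" using elim by simp
    have ln1: "0 < ln (real n)" using elim by simp
    have p: "0 \<le> p n" "p n \<le> 1 / 2" using p_bounds[of n] elim by auto
    have pe: "2 * real n * p n = ln n + ln (ln n) + c n" using p_eq[of n] elim by (simp add: field_simps)
    have nonneg: "0 \<le> ln n / n" "0 \<le> exp (c n)" "0 \<le> real n powr (-0.15)" using ln1 by auto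
    show ?case
    proof (cases "p n \<le> real n powr (-1.6)")
      case True
      have "?P n \<le> measure_pmf.prob (cell_pmf n (p n))
          {f. \<exists>x\<in>ones n f. \<exists>y\<in>ones n f. x \<noteq> y \<and> (fst x = fst y \<or> snd x = snd y)}"
        using reconstructible_two_ones_in_line by (intro prob_mono) blast
      also have "\<dots> \<le> 2 * real n ^ 3 * (p n)\<^sup>2" by (rule prob_two_ones_in_line) (use p in auto)
      also have "\<dots> \<le> 2 * real n ^ 3 * (real n powr (-1.6))\<^sup>2"
        using True p by (intro mult_left_mono power_mono) auto
      also have "real n ^ 3 = n powr 3" using n0 by (simp add: powr_numeral)
      also have "2 * n powr 3 * (real n powr (-1.6))\<^sup>2 = 2 * n powr (-0.2)"
      proof -
        have "2 * n powr 3 * (real n powr (-1.6))\<^sup>2 = 2 * (n powr 3 * n powr (-1.6) * n powr (-1.6))"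
          by (simp only: power2_eq_square mult.assoc)
        also have "\<dots> = 2 * n powr (3 + -1.6 + -1.6)" by (simp only: powr_add)
        also have "\<dots> = 2 * n powr (-0.2)" by simp
        finally show ?thesis .
      qed
      also have "\<dots> \<le> ?G n" using nonneg by simp
      finally show ?thesis .
    next
      case False
      let ?\<mu> = "(real n)\<^sup>2 * p n * (1 - p n) ^ (2 * (n - 1))"
      let ?b = "min (exp (- c n) / 8) (n powr 0.15)"
      have b: "?b / exp 1 \<le> ?\<mu>"
        by (rule expected_isolated_ones_lower_bound[OF p elim(5) pe]) (use elim False in auto)
      have "16 * exp 1 \<le> exp (- c n)"
      proof -
        have "exp (ln (16 * exp 1)) \<le> exp (- c n)" using elim(1) by (subst exp_le_cancel_iff) simp
        then show ?thesis by simp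
      qed
      then have b2: "2 * exp 1 \<le> ?b" using elim(4) by simp
      then have "2 \<le> ?b / exp 1" by (simp add: field_simps)
      then have \<mu>: "2 \<le> ?\<mu>" using b by linarith
      have "?P n \<le> measure_pmf.prob (cell_pmf n (p n)) {f. card (isolated_ones n f) \<le> 1}"
      proof (rule prob_mono)
        fix f assume "2 \<le> num_ones (Matrix.mat n n f) \<and> reconstructible (Matrix.mat n n f)"
        then show "card (isolated_ones n f) \<le> 1" using two_isolated_ones_not_reconstructible[of n f] by linarith
      qed
      also have "\<dots> \<le> 32 * p n + 4 / ?\<mu>"
        by (rule prob_at_most_one_isolated_le[OF p _ \<mu>]) (use elim in simp)
      also have "\<dots> \<le> 32 * (ln n / n) + 4 * exp 1 * (8 * exp (c n) + n powr (-0.15))"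
      proof (rule add_mono)
        have "real n * p n \<le> ln n" using pe elim(1,2) by simp
        then show "32 * p n \<le> 32 * (ln n / n)" using n0 by (simp add: field_simps)
        have b0: "0 < ?b" using n0 by simp
        have "4 / ?\<mu> \<le> 4 / (?b / exp 1)" using b b0 \<mu> by (intro divide_left_mono) auto
        also have "\<dots> = 4 * exp 1 * (1 / ?b)" by simp
        also have "\<dots> \<le> 4 * exp 1 * (8 * exp (c n) + n powr (-0.15))"
        proof (rule mult_left_mono)
          have "1 / (exp (- c n) / 8) = 8 * exp (c n)" by (simp add: exp_minus field_simps)
          moreover have "1 / (n powr 0.15) = n powr (-0.15)" by (simp add: powr_minus_divide)
          ultimately show "1 / ?b \<le> 8 * exp (c n) + n powr (-0.15)"
            using nonneg by (auto simp: min_def)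
        qed simp
        finally show "4 / ?\<mu> \<le> 4 * exp 1 * (8 * exp (c n) + n powr (-0.15))" .
      qed
      also have "\<dots> \<le> ?G n" by simp
      finally show ?thesis .
    qed
  qed
  then show ?thesis
    by (intro tendsto_sandwich[OF _ _ tendsto_const G]) auto
qed

theorem theorem1:
  fixes p c :: "nat \<Rightarrow> real"
  assumes p_eq: "\<And>n. n \<ge> 2 \<Longrightarrow> p n = 1 / (2 * real n) * (ln (real n) + ln (ln (real n)) + c n)"
    and p_bounds: "\<And>n. n \<ge> 2 \<Longrightarrow> 0 \<le> p n \<and> p n \<le> 1 / 2"
  shows "(filterlim c at_top sequentially \<longrightarrow>
            (\<lambda>n. measure_pmf.prob (random_mat n (p n)) {A. reconstructible A}) \<longlonglongrightarrow> 1)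
       \<and> (filterlim c at_bot sequentially \<longrightarrow>
            (\<lambda>n. measure_pmf.prob (random_mat n (p n))
                   {A. num_ones A < 2 \<or> \<not> reconstructible A}) \<longlonglongrightarrow> 1)
       \<and> (\<forall>c0. c \<longlonglongrightarrow> c0 \<longrightarrow>
            (\<lambda>n. measure_pmf.prob (random_mat n (p n)) {A. reconstructible A}) \<longlonglongrightarrow> critical_prob c0
            \<and> 0 < critical_prob c0 \<and> critical_prob c0 < 1)"
proof (intro conjI impI allI)
  let ?E = "\<lambda>n. measure_pmf.prob (cell_pmf n (p n)) {f. card (isolated_ones n f) \<le> 1}"
  let ?N = "\<lambda>n. measure_pmf.prob (cell_pmf n (p n))
      {f. card (isolated_ones n f) \<le> 1 \<and> \<not> reconstructible (Matrix.mat n n f)}"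
  {
    assume c: "filterlim c at_top sequentially"
    have "eventually (\<lambda>n. - 0 \<le> c n) sequentially" using c by (simp add: filterlim_at_top)
    from prob_not_reconstructible_few_isolated_tendsto_0[OF p_eq p_bounds this]
    have N: "?N \<longlonglongrightarrow> 0" .
    have S: "(\<lambda>n. 1 - binomial_moment n (p n) 1) \<longlonglongrightarrow> 1 - 0"
      by (intro tendsto_diff tendsto_const expected_isolated_ones_tendsto_0[OF p_eq p_bounds c])
    have "?E \<longlonglongrightarrow> 1"
    proof (rule tendsto_sandwich[OF _ _ _ tendsto_const])
      show "(\<lambda>n. 1 - binomial_moment n (p n) 1) \<longlonglongrightarrow> 1" using S by simp
      show "eventually (\<lambda>n. 1 - binomial_moment n (p n) 1 \<le> ?E n) sequentially"
        using prob_isolated_one_le by (intro always_eventually allI) (simp add: algebra_simps)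
    qed (auto intro: always_eventually)
    from tendsto_diff[OF this N]
    show "(\<lambda>n. measure_pmf.prob (random_mat n (p n)) {A. reconstructible A}) \<longlonglongrightarrow> 1"
      by (simp add: prob_reconstructible_split)
  }
  {
    assume c: "filterlim c at_bot sequentially"
    have "measure_pmf.prob (random_mat n (p n)) {A. num_ones A < 2 \<or> \<not> reconstructible A} =
        1 - measure_pmf.prob (cell_pmf n (p n))
           {f. 2 \<le> num_ones (Matrix.mat n n f) \<and> reconstructible (Matrix.mat n n f)}" for n
    proof -
      let ?S = "{f. 2 \<le> num_ones (Matrix.mat n n f) \<and> reconstructible (Matrix.mat n n f)}"
      have "measure_pmf.prob (cell_pmf n (p n)) (space (measure_pmf (cell_pmf n (p n))) - ?S)
          = 1 - measure_pmf.prob (cell_pmf n (p n)) ?S"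
        by (rule measure_pmf.prob_compl) simp
      moreover have "space (measure_pmf (cell_pmf n (p n))) - ?S
          = {f. num_ones (Matrix.mat n n f) < 2 \<or> \<not> reconstructible (Matrix.mat n n f)}" by auto
      ultimately show ?thesis by (simp only: prob_random_mat)
    qed
    moreover have "(\<lambda>n. 1 - measure_pmf.prob (cell_pmf n (p n))
           {f. 2 \<le> num_ones (Matrix.mat n n f) \<and> reconstructible (Matrix.mat n n f)}) \<longlonglongrightarrow> 1 - 0"
      by (intro tendsto_diff tendsto_const prob_two_ones_and_reconstructible_tendsto_0[OF p_eq p_bounds c])
    ultimately show "(\<lambda>n. measure_pmf.prob (random_mat n (p n)) {A. num_ones A < 2 \<or> \<not> reconstructible A}) \<longlonglongrightarrow> 1"
      by simp
  }
  fix c0 assume c: "c \<longlonglongrightarrow> c0"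
  have "eventually (\<lambda>n. - (1 - c0) \<le> c n) sequentially"
    using order_tendstoD(1)[OF c, of "c0 - 1"] by (auto elim: eventually_mono)
  from prob_not_reconstructible_few_isolated_tendsto_0[OF p_eq p_bounds this]
  have N: "?N \<longlonglongrightarrow> 0" .
  from tendsto_diff[OF prob_at_most_one_isolated_tendsto[OF p_eq p_bounds c] N]
  show "(\<lambda>n. measure_pmf.prob (random_mat n (p n)) {A. reconstructible A}) \<longlonglongrightarrow> critical_prob c0"
    by (simp add: prob_reconstructible_split)
  have pos: "0 < exp (- c0) / 2" by simp
  then show "0 < critical_prob c0" unfolding critical_prob_def by (intro mult_pos_pos add_pos_pos) auto
  have "1 + exp (- c0) / 2 < exp (exp (- c0) / 2)"
  proof -
    define l where "l = exp (- c0) / 2"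
    have l: "0 < l" unfolding l_def by simp
    have "1 + l < (1 + l / 2)\<^sup>2" using l by (simp add: power2_eq_square algebra_simps)
    also have "\<dots> \<le> (exp (l / 2))\<^sup>2" using l by (intro power_mono) auto
    also have "\<dots> = exp l" by (simp add: exp_double[symmetric])
    finally show ?thesis by (simp only: l_def)
  qed
  then show "critical_prob c0 < 1"
    unfolding critical_prob_def by (simp add: exp_minus field_simps)
qed

end
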